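(* Let $d\in\{1,2\}$ and assume Assumption A and condition (C) hold. Then for any $p\ge2$ and $T>0$, $\lim_{n\to\infty}v_n^\varepsilon(t,x)=v^\varepsilon(t,x)$ in $L^p(\Omega)$ uniformly in $(t,x)\in[0,T]\times\mathbb R^d$ and $\varepsilon>0$, i.e. $$\sup_{\varepsilon>0}\sup_{(t,x)\in[0,T]\times\mathbb R^d}E|v_n^\varepsilon(t,x)-v^\varepsilon(t,x)|^p\to0\quad\text{as }n\to\infty.$$
   Context: $\gamma:\mathbb R^d\to[0,\infty]$ non-negative definite, $\mu$ tempered with $\gamma=\mathcal F\mu$; $W$ centered Gaussian indexed by $C_c^\infty(\mathbb R^d)$ with $E[W(\varphi)W(\psi)]=\int\int\varphi(x)\psi(y)\gamma(x-y)dxdy$, extended to the Hilbert completion $\mathcal H$. Assumption A: (a) $\gamma$ continuous, symmetric, $\gamma(x)<\infty$ iff $x\ne0$; (b) $\mu$ absolutely continuous. Condition (C): $\int(1+|\xi|^2)^{-1/2}\mu(d\xi)<\infty$. $G(t,x)=\frac12 1_{\{|x|<t\}}$ ($d=1$), $\frac1{2\pi}(t^2-|x|^2)^{-1/2}1_{\{|x|<t\}}$ ($d=2$). $p_\varepsilon(x)=(2\pi\varepsilon)^{-d/2}e^{-|x|^2/(2\varepsilon)}$, $\dot W^\varepsilon(x)=W(p_\varepsilon(x-\cdot))$. With $T_n(t)=\{0<t_1<\dots<t_n<t\}$, $t_{n+1}=t$, $x_{n+1}=x$: $H_n^\varepsilon(t,x)=\int_{T_n(t)}\int_{(\mathbb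 R^d)^n}\prod_{i=1}^nG(t_{i+1}-t_i,x_{i+1}-x_i)\prod_{i=1}^n\dot W^\varepsilon(x_i)d\mathbf xd\mathbf t$, $v_n^\varepsilon=1+\sum_{k=1}^nH_k^\varepsilon$, and $v^\varepsilon(t,x)$ is the solution of $v^\varepsilon(t,x)=1+\int_0^t\int G(t-s,x-y)v^\varepsilon(s,y)\dot W^\varepsilon(y)dyds$ obtained as the $L^p(\Omega)$-limit of $v_n^\varepsilon(t,x)$ as $n\to\infty$ for each fixed $\varepsilon$. *)

theory Defs
  imports "HOL-Probability.Probability"
begin

fun iter_dd :: "'a::real_normed_vector list \<Rightarrow> ('a \<Rightarrow> real) \<Rightarrow> 'a \<Rightarrow> real" where
  "iter_dd [] f = f"
| "iter_dd (v # vs) f = (\<lambda>x. deriv (\<lambda>h. iter_dd vs f (x + h *\<^sub>R v)) 0)"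

definition smooth_fun :: "('a::real_normed_vector \<Rightarrow> real) \<Rightarrow> bool" where
  "smooth_fun f \<longleftrightarrow>
     (\<forall>vs. continuous_on UNIV (iter_dd vs f) \<and>
          (\<forall>v x. (\<lambda>h. iter_dd vs f (x + h *\<^sub>R v)) differentiable (at 0)))"

definition Cc_inf :: "('a::euclidean_space \<Rightarrow> real) set" where
  "Cc_inf = {f. smooth_fun f \<and> compact (closure {x. f x \<noteq> 0})}"

definition gamma_r :: "('a::euclidean_space \<Rightarrow> ennreal) \<Rightarrow> 'a \<Rightarrow> real" where
  "gamma_r \<gamma> x = enn2real (\<gamma> x)"

definition cov_form :: "('a::euclidean_space \<Rightarrow> ennreal) \<Rightarrow> ('a \<Rightarrow> real) \<Rightarrow> ('a \<Rightarrow> real) \<Rightarrow> real" where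
  "cov_form \<gamma> \<phi> \<psi> =
     (\<integral>z. \<phi> (fst z) * \<psi> (snd z) * gamma_r \<gamma> (fst z - snd z) \<partial>(lborel \<Otimes>\<^sub>M lborel))"

definition fourier :: "('a::euclidean_space \<Rightarrow> real) \<Rightarrow> 'a \<Rightarrow> complex" where
  "fourier \<phi> \<xi> = (CLINT x|lborel. cis (- (\<xi> \<bullet> x)) * complex_of_real (\<phi> x))"

definition tempered_measure :: "'a::euclidean_space measure \<Rightarrow> bool" where
  "tempered_measure \<mu> \<longleftrightarrow> sets \<mu> = sets borel \<and>
     (\<exists>k::nat. (\<integral>\<^sup>+\<xi>. ennreal ((1 + (norm \<xi>)\<^sup>2) powr (- real k)) \<partial>\<mu>) < \<infinity>)"

definition is_fourier_of :: "('a::euclidean_space \<Rightarrow> ennreal) \<Rightarrow> 'a measure \<Rightarrow> bool" where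
  "is_fourier_of \<gamma> \<mu> \<longleftrightarrow>
     (\<forall>\<phi>\<in>Cc_inf. integrable lborel (\<lambda>x. gamma_r \<gamma> x * \<phi> x) \<and>
        integrable \<mu> (fourier \<phi>) \<and>
        complex_of_real (\<integral>x. gamma_r \<gamma> x * \<phi> x \<partial>lborel) = (CLINT \<xi>|\<mu>. fourier \<phi> \<xi>))"

definition nonneg_definite :: "('a::euclidean_space \<Rightarrow> ennreal) \<Rightarrow> bool" where
  "nonneg_definite \<gamma> \<longleftrightarrow> (\<forall>\<phi>\<in>Cc_inf. 0 \<le> cov_form \<gamma> \<phi> \<phi>)"

definition assumption_A :: "('a::euclidean_space \<Rightarrow> ennreal) \<Rightarrow> 'a measure \<Rightarrow> bool" where
  "assumption_A \<gamma> \<mu> \<longleftrightarrow>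
     continuous_on UNIV \<gamma> \<and> (\<forall>x. \<gamma> (- x) = \<gamma> x) \<and> (\<forall>x. \<gamma> x < \<infinity> \<longleftrightarrow> x \<noteq> 0) \<and>
     absolutely_continuous lborel \<mu>"

definition condition_C :: "'a::euclidean_space measure \<Rightarrow> bool" where
  "condition_C \<mu> \<longleftrightarrow> (\<integral>\<^sup>+\<xi>. ennreal ((1 + (norm \<xi>)\<^sup>2) powr (- 1 / 2)) \<partial>\<mu>) < \<infinity>"

text \<open>W is a centred Gaussian family indexed by C_c^infinity with covariance cov_form:
every finite linear combination has characteristic function exp(-variance/2).\<close>
definition gaussian_noise :: "'w measure \<Rightarrow> ('a::euclidean_space \<Rightarrow> ennreal) \<Rightarrow> (('a \<Rightarrow> real) \<Rightarrow> 'w \<Rightarrow> real) \<Rightarrow> bool" where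
  "gaussian_noise M \<gamma> W \<longleftrightarrow>
     (\<forall>\<phi>\<in>Cc_inf. W \<phi> \<in> borel_measurable M) \<and>
     (\<forall>(I::nat set) \<phi> c. finite I \<longrightarrow> (\<forall>i\<in>I. \<phi> i \<in> Cc_inf) \<longrightarrow>
        (CLINT \<omega>|M. cis (\<Sum>i\<in>I. c i * W (\<phi> i) \<omega>)) =
        complex_of_real (exp (- (\<Sum>i\<in>I. \<Sum>j\<in>I. c i * c j * cov_form \<gamma> (\<phi> i) (\<phi> j)) / 2)))"

definition heat :: "real \<Rightarrow> 'a::euclidean_space \<Rightarrow> real" where
  "heat \<epsilon> x = (2 * pi * \<epsilon>) powr (- real DIM('a) / 2) * exp (- (norm x)\<^sup>2 / (2 * \<epsilon>))"

text \<open>Values of the extension of W to the Hilbert completion H at the elements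
p_eps(x - .): W(psi) is the L^2-limit of W(phi_k) whenever phi_k in C_c^infinity
converges to psi in the norm of H.\<close>
definition extends_at :: "'w measure \<Rightarrow> ('a::euclidean_space \<Rightarrow> ennreal) \<Rightarrow> (('a \<Rightarrow> real) \<Rightarrow> 'w \<Rightarrow> real) \<Rightarrow> ('a \<Rightarrow> real) \<Rightarrow> bool" where
  "extends_at M \<gamma> W \<psi> \<longleftrightarrow> W \<psi> \<in> borel_measurable M \<and>
     (\<forall>f :: nat \<Rightarrow> 'a \<Rightarrow> real. (\<forall>k. f k \<in> Cc_inf) \<longrightarrow>
        (\<lambda>k. cov_form \<gamma> (\<lambda>y. f k y - \<psi> y) (\<lambda>y. f k y - \<psi> y)) \<longlonglongrightarrow> 0 \<longrightarrow>
        (\<lambda>k. \<integral>\<^sup>+\<omega>. ennreal ((W (f k) \<omega> - W \<psi> \<omega>)\<^sup>2) \<partial>M) \<longlonglongrightarrow> 0)"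

definition Wdot :: "(('a::euclidean_space \<Rightarrow> real) \<Rightarrow> 'w \<Rightarrow> real) \<Rightarrow> real \<Rightarrow> 'a \<Rightarrow> 'w \<Rightarrow> real" where
  "Wdot W \<epsilon> x = W (\<lambda>y. heat \<epsilon> (x - y))"

definition G :: "real \<Rightarrow> 'a::euclidean_space \<Rightarrow> real" where
  "G t x = (if norm x < t then
              (if DIM('a) = 1 then 1 / 2 else 1 / (2 * pi) / sqrt (t\<^sup>2 - (norm x)\<^sup>2))
            else 0)"

definition Hn :: "(('a::euclidean_space \<Rightarrow> real) \<Rightarrow> 'w \<Rightarrow> real) \<Rightarrow> nat \<Rightarrow> real \<Rightarrow> real \<Rightarrow> 'a \<Rightarrow> 'w \<Rightarrow> real" where
  "Hn W n \<epsilon> t x \<omega> =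
     (\<integral>z. (let tt = (\<lambda>i. if i = Suc n then t else fst (z i));
                xx = (\<lambda>i. if i = Suc n then x else snd (z i))
            in (if (n = 0 \<or> 0 < tt 1) \<and> (\<forall>i\<in>{1..n}. tt i < tt (Suc i)) then 1 else 0) *
               (\<Prod>i\<in>{1..n}. G (tt (Suc i) - tt i) (xx (Suc i) - xx i)) *
               (\<Prod>i\<in>{1..n}. Wdot W \<epsilon> (xx i) \<omega>))
      \<partial>(PiM {1..n} (\<lambda>_. (lborel::real measure) \<Otimes>\<^sub>M (lborel::'a measure))))"

definition vn :: "(('a::euclidean_space \<Rightarrow> real) \<Rightarrow> 'w \<Rightarrow> real) \<Rightarrow> nat \<Rightarrow> real \<Rightarrow> real \<Rightarrow> 'a \<Rightarrow> 'w \<Rightarrow> real" where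
  "vn W n \<epsilon> t x \<omega> = 1 + (\<Sum>k\<in>{1..n}. Hn W k \<epsilon> t x \<omega>)"

end

theory Submission
  imports Defs
begin

text \<open>
  Each \<open>H\<^sub>n\<^sup>\<epsilon>\<close> is estimated in position space. Expanding the \<open>q\<close>-th moment (\<open>q\<close> even) gives an
  integral over \<open>q\<close> chains of \<open>n\<close> points each, weighted by wave kernels and by a joint Gaussian moment.
  Integrate out the points one at a time, always the earliest one of a chain: it occurs in a
  single wave kernel and, by the Isserlis recursion, in at most one covariance factor, so its
  contribution is at most \<open>D\<close>, where \<open>D\<close> bounds the spatial integrals of \<open>G(t, x - y)\<close> and of
  \<open>G(t, x - y) Cov(y, z)\<close> over \<open>y\<close>, uniformly in \<open>\<epsilon>\<close> and \<open>t \<le> T\<close>. There are at most \<open>sqrt((q n)!)\<close>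
  pairings and every time simplex contributes \<open>t^n / n!\<close>, so the series converges uniformly.

  The covariance of the mollified noise is an average of translates of \<open>\<gamma>\<close>, so only the integral of
  \<open>G(t, x - y) \<gamma>(y)\<close> has to be bounded. For \<open>d = 1\<close>, \<open>G\<close> is dominated by a bump function, whose Fourier
  transform is \<open>\<mu>\<close>-integrable. For \<open>d = 2\<close> one mollifies \<open>G\<close>, uses that its Fourier transform is at most
  \<open>min(t, 1 / |\<xi>|)\<close> together with condition (C), and passes to the limit by Fatou's lemma.
\<close>

section \<open>Smooth bump functions\<close>

text \<open>The variance of the mollified noise is not bounded as \<epsilon> tends to 0, because
  \<gamma> is infinite at the origin. Two constants are therefore kept apart: \<open>B\<close>
  bounds the variance for one fixed \<epsilon> and is used only to justify Fubini; \<open>D\<close>,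
  in which every covariance is integrated against a wave kernel, is free of \<epsilon> and alone
  enters the estimates. Since \<gamma> is nonnegative, so are all Gaussian moments that occur; no
  cancellation has to be tracked, and everything after Fubini is an \<open>ennreal\<close> integral.
  The factorials balance as follows. For q = 2 m, sqrt((q n)!) is at most q^(m n) (n!)^m, the q
  simplices contribute (n!)^(-q), and the remaining (n!)^(-m) beats every geometric factor. In the
  plane the obstacle is that \<open>G\<close> is unbounded near the light cone, so no test function
  dominates it, while the Fourier identity for \<gamma> is given on test functions only.
  Mollification makes the identity applicable; on return only a lower limit is available, which is
  all that Fatou needs.\<close>

text \<open>A graded form of \<open>smooth_fun\<close>, chosen so that the closure properties go through by induction
  on the order of differentiation.\<close>

fun dirdiff :: "nat \<Rightarrow> ('a::real_normed_vector \<Rightarrow> real) \<Rightarrow> bool" where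
  "dirdiff 0 f \<longleftrightarrow> continuous_on UNIV f"
| "dirdiff (Suc n) f \<longleftrightarrow> continuous_on UNIV f \<and>
     (\<forall>v. \<exists>f'. (\<forall>x. ((\<lambda>h. f (x + h *\<^sub>R v)) has_real_derivative f' x) (at 0)) \<and> dirdiff n f')"

lemma dirdiff_cont: "dirdiff n f \<Longrightarrow> continuous_on UNIV f"
  by (cases n) auto

lemma dirdiff_Suc_imp: "dirdiff (Suc n) f \<Longrightarrow> dirdiff n f"
proof (induction n arbitrary: f)
  case (Suc n)
  show ?case unfolding dirdiff.simps(2)[of n]
  proof (intro conjI allI)
    show "continuous_on UNIV f" using Suc.prems by (rule dirdiff_cont)
    fix v
    obtain f' where "\<forall>x. ((\<lambda>h. f (x + h *\<^sub>R v)) has_real_derivative f' x) (at 0)" "dirdiff (Suc n) f'"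
      using Suc.prems unfolding dirdiff.simps(2)[of "Suc n"] by blast
    then show "\<exists>f'. (\<forall>x. ((\<lambda>h. f (x + h *\<^sub>R v)) has_real_derivative f' x) (at 0)) \<and> dirdiff n f'"
      using Suc.IH by blast
  qed
qed simp

lemma dirdiff_SucI:
  assumes "continuous_on UNIV f"
    and "\<And>v x. ((\<lambda>h. f (x + h *\<^sub>R v)) has_real_derivative f' v x) (at 0)" "\<And>v. dirdiff n (f' v)"
  shows "dirdiff (Suc n) f"
  using assms by auto

lemma dirdiff_const: "dirdiff n (\<lambda>x. c)"
proof (induction n arbitrary: c)
  case (Suc n)
  show ?case by (rule dirdiff_SucI[where f' = "\<lambda>v x. 0"]) (simp_all add: Suc.IH)
qed simp

lemma dirdiff_add: "dirdiff n f \<Longrightarrow> dirdiff n g \<Longrightarrow> dirdiff n (\<lambda>x. f x + g x)"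
proof (induction n arbitrary: f g)
  case (Suc n)
  obtain f' where f': "\<And>v x. ((\<lambda>h. f (x + h *\<^sub>R v)) has_real_derivative f' v x) (at 0)" "\<And>v. dirdiff n (f' v)"
    using Suc.prems(1) unfolding dirdiff.simps by metis
  obtain g' where g': "\<And>v x. ((\<lambda>h. g (x + h *\<^sub>R v)) has_real_derivative g' v x) (at 0)" "\<And>v. dirdiff n (g' v)"
    using Suc.prems(2) unfolding dirdiff.simps by metis
  show ?case
    by (rule dirdiff_SucI[where f' = "\<lambda>v x. f' v x + g' v x"])
      (simp_all add: Suc.prems[THEN dirdiff_cont] f' g' Suc.IH DERIV_add continuous_on_add)
qed (auto intro: continuous_intros)

lemma dirdiff_mult: "dirdiff n f \<Longrightarrow> dirdiff n g \<Longrightarrow> dirdiff n (\<lambda>x. f x * g x)"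
proof (induction n arbitrary: f g)
  case (Suc n)
  obtain f' where f': "\<And>v x. ((\<lambda>h. f (x + h *\<^sub>R v)) has_real_derivative f' v x) (at 0)" "\<And>v. dirdiff n (f' v)"
    using Suc.prems(1) unfolding dirdiff.simps by metis
  obtain g' where g': "\<And>v x. ((\<lambda>h. g (x + h *\<^sub>R v)) has_real_derivative g' v x) (at 0)" "\<And>v. dirdiff n (g' v)"
    using Suc.prems(2) unfolding dirdiff.simps by metis
  have fg: "dirdiff n f" "dirdiff n g" using Suc.prems dirdiff_Suc_imp by auto
  show ?case
  proof (rule dirdiff_SucI[where f' = "\<lambda>v x. f' v x * g x + g' v x * f x"])
    show "continuous_on UNIV (\<lambda>x. f x * g x)"
      using Suc.prems[THEN dirdiff_cont] by (intro continuous_intros)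
    show "((\<lambda>h. f (x + h *\<^sub>R v) * g (x + h *\<^sub>R v)) has_real_derivative f' v x * g x + g' v x * f x) (at 0)" for v x
      using DERIV_mult[OF f'(1)[of x v] g'(1)[of x v]] by simp
    show "dirdiff n (\<lambda>x. f' v x * g x + g' v x * f x)" for v
      using f' g' fg Suc.IH by (intro dirdiff_add) auto
  qed
qed (auto intro: continuous_intros)

lemma dirdiff_comp:
  fixes g :: "'a::real_normed_vector \<Rightarrow> real" and F :: "real \<Rightarrow> real"
  shows "dirdiff n F \<Longrightarrow> dirdiff n g \<Longrightarrow> dirdiff n (\<lambda>x. F (g x))"
proof (induction n arbitrary: F)
  case 0
  then show ?case by (auto intro: continuous_on_compose2)
next
  case (Suc n)
  obtain F' where F': "\<And>x. ((\<lambda>h. F (x + h *\<^sub>R 1)) has_real_derivative F' x) (at 0)" "dirdiff n F'"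
    using Suc.prems unfolding dirdiff.simps by metis
  \<comment> \<open>\<open>dirdiff\<close> speaks of derivatives at 0 along lines; shifting by
    \<open>x\<close> in direction 1 recovers the ordinary derivative that the chain rule
    needs.\<close>
  have F'': "(F has_real_derivative F' x) (at x)" for x
  proof -
    have "((\<lambda>u. F (x + (u - x) *\<^sub>R 1)) has_real_derivative F' x * 1) (at x)"
      by (rule DERIV_chain2[of "\<lambda>h. F (x + h *\<^sub>R 1)" _ "\<lambda>u. u - x" x 1 UNIV])
        (use F'(1)[of x] in \<open>auto intro!: derivative_eq_intros\<close>)
    then show ?thesis by simp
  qed
  obtain g' where g': "\<And>v x. ((\<lambda>h. g (x + h *\<^sub>R v)) has_real_derivative g' v x) (at 0)" "\<And>v. dirdiff n (g' v)"
    using Suc.prems unfolding dirdiff.simps by metis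
  show ?case
  proof (rule dirdiff_SucI[where f' = "\<lambda>v x. F' (g x) * g' v x"])
    show "continuous_on UNIV (\<lambda>x. F (g x))"
      using Suc.prems[THEN dirdiff_cont] by (auto intro: continuous_on_compose2)
    show "((\<lambda>h. F (g (x + h *\<^sub>R v))) has_real_derivative F' (g x) * g' v x) (at 0)" for v x
    proof -
      have "(F has_real_derivative F' (g x)) (at (g (x + 0 *\<^sub>R v)))"
        using F''[of "g x"] by simp
      from DERIV_chain2[OF this g'(1)[of x v]] show ?thesis by simp
    qed
    show "dirdiff n (\<lambda>x. F' (g x) * g' v x)" for v
      using g' F' Suc.IH dirdiff_Suc_imp[OF Suc.prems(2)] by (intro dirdiff_mult) auto
  qed
qed

lemma dirdiff_inner: "dirdiff n (\<lambda>x::'a::real_inner. x \<bullet> w)"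
proof (cases n)
  case 0 then show ?thesis by (auto intro!: continuous_intros)
next
  case (Suc m)
  show ?thesis unfolding Suc
  proof (rule dirdiff_SucI[where f' = "\<lambda>v x. v \<bullet> w"])
    show "((\<lambda>h. (x + h *\<^sub>R v) \<bullet> w) has_real_derivative v \<bullet> w) (at 0)" for x v :: 'a
      unfolding inner_add_left inner_scaleR_left by (auto intro!: derivative_eq_intros)
  qed (intro continuous_intros dirdiff_const)+
qed

text \<open>A quadratic polynomial in \<open>y\<close>: each directional derivative is affine, so
  the recursion ends at \<open>dirdiff_inner\<close>. \<open>bump\<close> and \<open>heat\<close>
  are treated through the squared norm because the norm itself is not differentiable at the
  origin.\<close>

lemma dirdiff_norm_sq: "dirdiff n (\<lambda>y::'a::real_inner. (norm (x - y))\<^sup>2)"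
proof (cases n)
  case 0 then show ?thesis by (auto intro!: continuous_intros)
next
  case (Suc m)
  have "((\<lambda>h. (norm (x - (y + h *\<^sub>R v)))\<^sup>2) has_real_derivative (2 * (y \<bullet> v) + (- (2 * (x \<bullet> v))))) (at 0)" for v y :: 'a
  proof -
    have "(\<lambda>h. (norm (x - (y + h *\<^sub>R v)))\<^sup>2) =
        (\<lambda>h. (x - y) \<bullet> (x - y) - h * (2 * ((x - y) \<bullet> v)) + h\<^sup>2 * (v \<bullet> v))"
      unfolding power2_norm_eq_inner
      by (rule ext) (simp add: algebra_simps inner_commute power2_eq_square)
    then show ?thesis
      by (auto intro!: derivative_eq_intros simp: algebra_simps)
  qed
  moreover have "dirdiff m (\<lambda>y. 2 * (y \<bullet> v) + (- (2 * (x \<bullet> v))))" for v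
    by (intro dirdiff_add dirdiff_mult dirdiff_const dirdiff_inner)
  ultimately show ?thesis unfolding Suc
    by (intro dirdiff_SucI[where f' = "\<lambda>v y. 2 * (y \<bullet> v) + (- (2 * (x \<bullet> v)))"] continuous_intros) auto
qed

text \<open>Each direction consumed by \<open>iter_dd\<close> costs one order and all orders are
  available; hence the induction on the list keeps \<open>n\<close> arbitrary.\<close>

lemma dirdiff_imp_smooth_fun:
  assumes "\<And>n. dirdiff n f" shows "smooth_fun f"
proof -
  have *: "dirdiff n (iter_dd vs f)" for n vs
  proof (induction vs arbitrary: n)
    case (Cons v vs)
    obtain g' where g': "\<And>x. ((\<lambda>h. iter_dd vs f (x + h *\<^sub>R v)) has_real_derivative g' x) (at 0)" "dirdiff n g'"
      using Cons.IH[of "Suc n"] by auto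
    have "iter_dd (v # vs) f = g'"
      using g'(1) by (auto simp: DERIV_imp_deriv)
    then show ?case using g' by simp
  qed (use assms in simp)
  show ?thesis unfolding smooth_fun_def
  proof (intro allI conjI)
    fix vs show "continuous_on UNIV (iter_dd vs f)" using *[of 0 vs] by simp
    fix v x
    show "(\<lambda>h. iter_dd vs f (x + h *\<^sub>R v)) differentiable (at 0)"
      using *[of 1 vs] by (auto simp: real_differentiable_def)
  qed
qed

text \<open>The flat function exp(-1/s) with an additional factor s^(-k). The derivative of a member
  combines the members \<open>k + 2\<close> and \<open>k + 1\<close>, so the family is closed under
  differentiation and smoothness at 0 follows for all orders at once.\<close>

definition expinv :: "nat \<Rightarrow> real \<Rightarrow> real" where
  "expinv k s = (if s > 0 then exp (- 1 / s) * inverse s ^ k else 0)"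

lemma expinv_nonneg [simp]: "expinv k s \<ge> 0"
  by (simp add: expinv_def)

text \<open>The substitution y = 1/h turns the quotient into y^(k+1) / exp y with y tending to
  infinity.\<close>

lemma exp_inverse_power_tendsto: "((\<lambda>h::real. exp (- 1 / h) * inverse h ^ k / h) \<longlongrightarrow> 0) (at_right 0)"
proof -
  have "((\<lambda>y::real. y ^ Suc k / exp y) \<longlongrightarrow> 0) at_top"
    by (rule tendsto_power_div_exp_0)
  then have "((\<lambda>h::real. inverse h ^ Suc k / exp (inverse h)) \<longlongrightarrow> 0) (at_right 0)"
    by (rule filterlim_compose[OF _ filterlim_inverse_at_top_right])
  then show ?thesis
    by (rule Lim_transform_eventually)
      (auto simp: eventually_at_filter field_simps exp_minus power_inverse)
qed

lemma expinv_DERIV: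
  "(expinv k has_real_derivative expinv (k + 2) s - real k * expinv (k + 1) s) (at s)"
proof -
  consider "s > 0" | "s < 0" | "s = 0" by linarith
  then show ?thesis
  proof cases
    case 1
    have "((\<lambda>s. exp (- 1 / s) * inverse s ^ k) has_real_derivative expinv (k + 2) s - real k * expinv (k + 1) s) (at s)"
    proof -
      have e: "((\<lambda>s. exp (- 1 / s)) has_real_derivative exp (- 1 / s) * inverse s ^ 2) (at s)"
        using 1 by (auto intro!: derivative_eq_intros simp: power2_eq_square divide_inverse)
      have p: "((\<lambda>s. inverse s ^ k) has_real_derivative - (real k * inverse s ^ (k + 1))) (at s)"
      proof (cases k)
        case (Suc m)
        have "((\<lambda>s. inverse s ^ Suc m) has_real_derivative
            real (Suc m) * inverse s ^ m * - (inverse s ^ Suc (Suc 0))) (at s)"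
          using DERIV_power_Suc[OF DERIV_inverse, of s m] 1 by (simp add: mult_ac)
        then show ?thesis unfolding Suc by (simp add: algebra_simps)
      qed simp
      show ?thesis using DERIV_mult[OF e p] 1 by (simp add: expinv_def power_add algebra_simps power2_eq_square)
    qed
    then show ?thesis
      by (rule has_field_derivative_transform_within_open[of _ _ _ "{0<..}"]) (use 1 in \<open>auto simp: expinv_def\<close>)
  next
    case 2
    have "((\<lambda>s. 0) has_real_derivative expinv (k + 2) s - real k * expinv (k + 1) s) (at s)"
      using 2 by (simp add: expinv_def)
    then show ?thesis
      by (rule has_field_derivative_transform_within_open[of _ _ _ "{..<0}"]) (use 2 in \<open>auto simp: expinv_def\<close>)
  next
    \<comment> \<open>At 0 the claimed derivative is 0, since both \<open>expinv\<close> terms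
      vanish there; the left quotient is identically 0 and only the right one needs a limit.\<close>
    case 3
    have "((\<lambda>h. (expinv k (0 + h) - expinv k 0) / h) \<longlongrightarrow> 0) (at 0)"
    proof (rule filterlim_split_at_real)
      have "((\<lambda>h. 0) \<longlongrightarrow> (0::real)) (at_left 0)" by simp
      then show "((\<lambda>h. (expinv k (0 + h) - expinv k 0) / h) \<longlongrightarrow> 0) (at_left 0)"
        by (rule Lim_transform_eventually) (auto simp: eventually_at_filter expinv_def)
      have "((\<lambda>h::real. exp (- 1 / h) * inverse h ^ k / h) \<longlongrightarrow> 0) (at_right 0)"
        by (rule exp_inverse_power_tendsto)
      then show "((\<lambda>h. (expinv k (0 + h) - expinv k 0) / h) \<longlongrightarrow> 0) (at_right 0)"
        by (rule Lim_transform_eventually) (auto simp: eventually_at_filter expinv_def)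
    qed
    then show ?thesis using 3 by (simp add: DERIV_def expinv_def)
  qed
qed

lemma dirdiff_expinv: "dirdiff n (expinv k)"
proof (induction n arbitrary: k)
  case 0
  show ?case using expinv_DERIV by (simp) (meson DERIV_isCont continuous_at_imp_continuous_on)
next
  case (Suc n)
  show ?case
  proof (rule dirdiff_SucI[where f' = "\<lambda>v s. (expinv (k + 2) s + (- real k) * expinv (k + 1) s) * v"])
    show "continuous_on UNIV (expinv k)"
      using expinv_DERIV by (meson DERIV_isCont continuous_at_imp_continuous_on)
    show "dirdiff n (\<lambda>s. (expinv (k + 2) s + (- real k) * expinv (k + 1) s) * v)" for v
      by (intro dirdiff_mult dirdiff_add dirdiff_const Suc.IH)
    show "((\<lambda>h. expinv k (x + h *\<^sub>R v)) has_real_derivative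
       (expinv (k + 2) x + (- real k) * expinv (k + 1) x) * v) (at 0)" for x v :: real
    proof -
      have "((\<lambda>h. x + h *\<^sub>R v) has_real_derivative v) (at 0)"
        by (auto intro!: derivative_eq_intros)
      moreover have "(expinv k has_real_derivative expinv (k + 2) x + (- real k) * expinv (k + 1) x) (at (x + 0 *\<^sub>R v))"
        using expinv_DERIV[of k x] by simp
      ultimately show ?thesis by (rule DERIV_chain2[rotated])
    qed
  qed
qed

lemma dirdiff_exp: "dirdiff n (exp :: real \<Rightarrow> real)"
proof (induction n)
  case (Suc n)
  show ?case
  proof (rule dirdiff_SucI[where f' = "\<lambda>v s. exp s * v"])
    show "((\<lambda>h. exp (x + h *\<^sub>R v)) has_real_derivative exp x * v) (at 0)" for x v :: real
      by (auto intro!: derivative_eq_intros)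
    show "dirdiff n (\<lambda>s. exp s * v)" for v :: real
      by (intro dirdiff_mult dirdiff_const Suc.IH)
  qed (intro continuous_intros)
qed (simp add: continuous_on_exp)

text \<open>The factor \<open>exp 1\<close> normalises the value at the origin to 1, so that growing
  radii give a cut-off tending to 1.\<close>

definition bump :: "real \<Rightarrow> 'a::euclidean_space \<Rightarrow> real" where
  "bump r x = exp 1 * expinv 0 (1 - (norm x / r)\<^sup>2)"

lemma bump_nonneg [simp]: "bump r x \<ge> 0"
  by (simp add: bump_def)

lemma bump_le_1: assumes "r > 0" shows "bump r x \<le> 1"
proof (cases "1 - (norm x / r)\<^sup>2 > 0")
  case True
  have "1 \<le> 1 / (1 - (norm x / r)\<^sup>2)" using True by (simp add: field_simps)
  then have "exp (- 1 / (1 - (norm x / r)\<^sup>2)) \<le> exp (-1)" by simp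
  then have "exp 1 * exp (- 1 / (1 - (norm x / r)\<^sup>2)) \<le> exp 1 * exp (-1)" by (intro mult_left_mono) auto
  then show ?thesis using True by (simp add: bump_def expinv_def exp_minus)
qed (simp add: bump_def expinv_def)

lemma bump_eq_0: assumes "r > 0" "norm x \<ge> r" shows "bump r x = 0"
proof -
  have "1 \<le> (norm x / r)\<^sup>2" using assms by (simp add: one_le_power)
  then show ?thesis by (simp add: bump_def expinv_def)
qed

text \<open>Within half the radius the argument of \<open>expinv\<close> is at least 3/4, and the
  exponent is then at least 1 - 4/3 = - 1/3 after the normalisation.\<close>

lemma bump_ge: assumes "r > 0" "norm x \<le> r / 2" shows "bump r x \<ge> exp (- 1 / 3)"
proof -
  have "(norm x / r)\<^sup>2 \<le> (1 / 2)\<^sup>2" using assms by (intro power_mono) (auto simp: field_simps)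
  then have *: "1 - (norm x / r)\<^sup>2 \<ge> 3 / 4" by (simp add: power2_eq_square)
  then have "1 / (1 - (norm x / r)\<^sup>2) \<le> 4 / 3" by (simp add: field_simps)
  then have "exp (- 1 / 3) \<le> exp (1 - 1 / (1 - (norm x / r)\<^sup>2))" by simp
  also have "\<dots> = bump r x" using * by (simp add: bump_def expinv_def exp_diff exp_minus field_simps)
  finally show ?thesis .
qed

lemma bump_tendsto_1: "(\<lambda>k. bump (real (Suc k)) x) \<longlonglongrightarrow> 1"
proof -
  have "(\<lambda>k. norm x * inverse (real (Suc k))) \<longlonglongrightarrow> norm x * 0"
    by (intro tendsto_mult_left LIMSEQ_inverse_real_of_nat)
  then have "(\<lambda>k. norm x / real (Suc k)) \<longlonglongrightarrow> 0"
    by (simp add: divide_inverse)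
  then have "(\<lambda>k. (norm x / real (Suc k))\<^sup>2) \<longlonglongrightarrow> 0\<^sup>2"
    by (rule tendsto_power)
  from tendsto_diff[OF tendsto_const[of 1] this]
  have lim: "(\<lambda>k. 1 - (norm x / real (Suc k))\<^sup>2) \<longlonglongrightarrow> 1" by simp
  have "isCont (expinv 0) 1" using expinv_DERIV by (rule DERIV_isCont)
  from tendsto_mult_left[OF isCont_tendsto_compose[OF this lim], of "exp 1"]
  show ?thesis unfolding bump_def by (simp add: expinv_def exp_minus)
qed

lemma dirdiff_bump: "dirdiff n (\<lambda>y. bump r (x - y))"
proof -
  have "(\<lambda>y. bump r (x - y)) = (\<lambda>y. exp 1 * expinv 0 (1 + (- (inverse r ^ 2)) * (norm (x - y))\<^sup>2))"
    by (simp add: bump_def divide_inverse power_mult_distrib algebra_simps)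
  then show ?thesis
    by (simp only:) (intro dirdiff_mult dirdiff_const dirdiff_comp[OF dirdiff_expinv] dirdiff_add dirdiff_norm_sq)
qed

lemma dirdiff_heat: "dirdiff n (\<lambda>y::'a::euclidean_space. heat \<epsilon> (x - y))"
proof -
  have "(\<lambda>y::'a. heat \<epsilon> (x - y)) = (\<lambda>y. (2 * pi * \<epsilon>) powr (- real DIM('a) / 2) * exp ((- 1 / (2 * \<epsilon>)) * (norm (x - y))\<^sup>2))"
    by (simp add: heat_def)
  then show ?thesis
    by (simp only:) (intro dirdiff_mult dirdiff_const dirdiff_comp[OF dirdiff_exp] dirdiff_norm_sq)
qed

lemma Cc_infI:
  assumes "\<And>n. dirdiff n f" "\<And>y. norm (y - x) \<ge> r \<Longrightarrow> f y = 0"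
  shows "f \<in> Cc_inf"
proof -
  have "{y. f y \<noteq> 0} \<subseteq> ball x r" using assms(2) by (force simp: dist_norm norm_minus_commute)
  then have "bounded {y. f y \<noteq> 0}" using bounded_ball bounded_subset by blast
  then show ?thesis using dirdiff_imp_smooth_fun[OF assms(1)]
    by (simp add: Cc_inf_def compact_closure)
qed

lemma bump_Cc_inf: "r > 0 \<Longrightarrow> (\<lambda>y. bump r (x - y)) \<in> Cc_inf"
  by (rule Cc_infI[OF dirdiff_bump, where x = x and r = r]) (simp add: bump_eq_0 norm_minus_commute)

text \<open>The heat kernel has no compact support; these truncations are the test functions through
  which \<open>extends_at\<close> gives access to \<open>Wdot\<close>.\<close>

lemma heat_bump_Cc_inf: "r > 0 \<Longrightarrow> (\<lambda>y. heat \<epsilon> (x - y) * bump r (x - y)) \<in> Cc_inf"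
  by (rule Cc_infI[OF dirdiff_mult[OF dirdiff_heat dirdiff_bump], where x = x and r = r]) (simp add: bump_eq_0 norm_minus_commute)

section \<open>Gaussian families and the Isserlis recursion\<close>

lemma borel_measurable_cis [measurable]: "cis \<in> borel_measurable borel"
  by (intro borel_measurable_continuous_onI continuous_on_cis continuous_on_id)

lemma norm_cis_diff_le: "norm (cis a - cis b) \<le> \<bar>a - b\<bar>"
proof -
  have "cis a - cis b = cis b * (cis (a - b) - 1)"
    by (simp add: cis_mult algebra_simps)
  moreover have "norm (cis (a - b) - 1) \<le> \<bar>a - b\<bar>"
    using iexp_approx1[of "a - b" 0] by (simp add: cis_conv_exp)
  ultimately show ?thesis by (simp add: norm_mult)
qed

section \<open>Differentiation of characteristic functions\<close>

text \<open>In difference quotient form, derivatives of expectations can be computed by dominated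
  convergence along sequences.\<close>

lemma has_vector_derivative_at_0_iff:
  fixes f :: "real \<Rightarrow> 'a::real_normed_vector"
  shows "(f has_vector_derivative D) (at 0) \<longleftrightarrow> ((\<lambda>h. (f h - f 0) /\<^sub>R h) \<longlongrightarrow> D) (at 0)"
proof -
  have "(f has_vector_derivative D) (at 0) \<longleftrightarrow> ((\<lambda>h. norm (f h - f 0 - h *\<^sub>R D) / \<bar>h\<bar>) \<longlongrightarrow> 0) (at 0)"
    unfolding has_vector_derivative_def has_derivative_at
    by (simp add: bounded_linear_scaleR_left)
  also have "\<dots> \<longleftrightarrow> ((\<lambda>h. norm ((f h - f 0) /\<^sub>R h - D)) \<longlongrightarrow> 0) (at 0)"
  proof (rule filterlim_cong[OF refl refl])
    have "norm (f h - f 0 - h *\<^sub>R D) / \<bar>h\<bar> = norm ((f h - f 0) /\<^sub>R h - D)" if "h \<noteq> 0" for h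
    proof -
      have "norm ((f h - f 0 - h *\<^sub>R D) /\<^sub>R h) = norm (f h - f 0 - h *\<^sub>R D) / \<bar>h\<bar>"
        by (simp add: divide_inverse mult.commute)
      moreover have "(f h - f 0 - h *\<^sub>R D) /\<^sub>R h = (f h - f 0) /\<^sub>R h - D"
        using that by (simp add: scaleR_diff_right)
      ultimately show ?thesis by simp
    qed
    then show "\<forall>\<^sub>F h in at 0. norm (f h - f 0 - h *\<^sub>R D) / \<bar>h\<bar> = norm ((f h - f 0) /\<^sub>R h - D)"
      by (auto simp: eventually_at_filter)
  qed
  also have "\<dots> \<longleftrightarrow> ((\<lambda>h. (f h - f 0) /\<^sub>R h) \<longlongrightarrow> D) (at 0)"
    by (metis (no_types) Lim_null tendsto_norm_zero_iff)
  finally show ?thesis .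
qed

lemma cis_quotient_tendsto: "((\<lambda>h. (cis (\<theta> + h * x) - cis \<theta>) /\<^sub>R h) \<longlongrightarrow> \<i> * of_real x * cis \<theta>) (at 0)"
proof -
  have "((\<lambda>h. cis (\<theta> + h * x)) has_vector_derivative (\<i> * of_real x * cis \<theta>)) (at 0)"
    unfolding has_vector_derivative_def
    by (auto intro!: derivative_eq_intros simp: algebra_simps scaleR_conv_of_real)
  then show ?thesis
    by (simp add: has_vector_derivative_at_0_iff)
qed

text \<open>\<open>cis\<close> is 1-Lipschitz, so |Y X| dominates the difference quotients for every
  \<open>h\<close>, and dominated convergence applies.\<close>

lemma has_vector_derivative_integral_cis:
  fixes Y X \<theta> :: "'w \<Rightarrow> real"
  assumes [measurable]: "\<theta> \<in> borel_measurable M" "X \<in> borel_measurable M"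
    and Y: "integrable M Y" and YX: "integrable M (\<lambda>\<omega>. Y \<omega> * X \<omega>)"
  shows "((\<lambda>h. CLINT \<omega>|M. of_real (Y \<omega>) * cis (\<theta> \<omega> + h * X \<omega>)) has_vector_derivative
           (\<i> * (CLINT \<omega>|M. of_real (Y \<omega> * X \<omega>) * cis (\<theta> \<omega>)))) (at 0)"
proof -
  have [measurable]: "Y \<in> borel_measurable M" using Y by auto
  have I: "complex_integrable M (\<lambda>\<omega>. of_real (Y \<omega>) * cis (\<theta> \<omega> + h * X \<omega>))" for h
    by (rule Bochner_Integration.integrable_bound[OF Y]) (auto simp: norm_mult)
  have "((\<lambda>h. ((CLINT \<omega>|M. of_real (Y \<omega>) * cis (\<theta> \<omega> + h * X \<omega>)) - (CLINT \<omega>|M. of_real (Y \<omega>) * cis (\<theta> \<omega>))) /\<^sub>R h)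
      \<longlongrightarrow> \<i> * (CLINT \<omega>|M. of_real (Y \<omega> * X \<omega>) * cis (\<theta> \<omega>))) (at 0)"
    unfolding tendsto_at_iff_sequentially
  proof (intro allI impI)
    fix h :: "nat \<Rightarrow> real" assume h: "\<forall>i. h i \<in> UNIV - {0}" "h \<longlonglongrightarrow> 0"
    have "(\<lambda>n. CLINT \<omega>|M. of_real (Y \<omega>) * ((cis (\<theta> \<omega> + h n * X \<omega>) - cis (\<theta> \<omega>)) /\<^sub>R h n))
        \<longlonglongrightarrow> (CLINT \<omega>|M. of_real (Y \<omega>) * (\<i> * of_real (X \<omega>) * cis (\<theta> \<omega>)))"
    proof (rule integral_dominated_convergence[where w = "\<lambda>\<omega>. \<bar>Y \<omega> * X \<omega>\<bar>"])
      show "AE \<omega> in M. (\<lambda>n. of_real (Y \<omega>) * ((cis (\<theta> \<omega> + h n * X \<omega>) - cis (\<theta> \<omega>)) /\<^sub>R h n))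
          \<longlonglongrightarrow> of_real (Y \<omega>) * (\<i> * of_real (X \<omega>) * cis (\<theta> \<omega>))"
      proof (rule AE_I2)
        fix \<omega>
        have "(\<lambda>n. (cis (\<theta> \<omega> + h n * X \<omega>) - cis (\<theta> \<omega>)) /\<^sub>R h n) \<longlonglongrightarrow> \<i> * of_real (X \<omega>) * cis (\<theta> \<omega>)"
          using cis_quotient_tendsto[of "\<theta> \<omega>" "X \<omega>"] h unfolding tendsto_at_iff_sequentially
          by (auto simp: comp_def)
        then show "(\<lambda>n. of_real (Y \<omega>) * ((cis (\<theta> \<omega> + h n * X \<omega>) - cis (\<theta> \<omega>)) /\<^sub>R h n))
          \<longlonglongrightarrow> of_real (Y \<omega>) * (\<i> * of_real (X \<omega>) * cis (\<theta> \<omega>))"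
          by (rule tendsto_mult_left)
      qed
      show "AE \<omega> in M. norm (of_real (Y \<omega>) * ((cis (\<theta> \<omega> + h n * X \<omega>) - cis (\<theta> \<omega>)) /\<^sub>R h n)) \<le> \<bar>Y \<omega> * X \<omega>\<bar>" for n
      proof (rule AE_I2)
        fix \<omega>
        have "norm (cis (\<theta> \<omega> + h n * X \<omega>) - cis (\<theta> \<omega>)) \<le> \<bar>h n\<bar> * \<bar>X \<omega>\<bar>"
          using norm_cis_diff_le[of "\<theta> \<omega> + h n * X \<omega>" "\<theta> \<omega>"] by (simp add: abs_mult)
        then have "norm ((cis (\<theta> \<omega> + h n * X \<omega>) - cis (\<theta> \<omega>)) /\<^sub>R h n) \<le> \<bar>X \<omega>\<bar>"
          using h(1) unfolding norm_scaleR by (simp add: field_simps)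
        then show "norm (of_real (Y \<omega>) * ((cis (\<theta> \<omega> + h n * X \<omega>) - cis (\<theta> \<omega>)) /\<^sub>R h n)) \<le> \<bar>Y \<omega> * X \<omega>\<bar>"
          unfolding norm_mult abs_mult by (intro mult_mono) auto
      qed
    qed (use YX in auto)
    moreover have "(CLINT \<omega>|M. of_real (Y \<omega>) * ((cis (\<theta> \<omega> + h n * X \<omega>) - cis (\<theta> \<omega>)) /\<^sub>R h n)) =
        ((CLINT \<omega>|M. of_real (Y \<omega>) * cis (\<theta> \<omega> + h n * X \<omega>)) - (CLINT \<omega>|M. of_real (Y \<omega>) * cis (\<theta> \<omega>))) /\<^sub>R h n" for n
    proof -
      have "(CLINT \<omega>|M. of_real (Y \<omega>) * ((cis (\<theta> \<omega> + h n * X \<omega>) - cis (\<theta> \<omega>)) /\<^sub>R h n)) =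
        (CLINT \<omega>|M. (of_real (Y \<omega>) * cis (\<theta> \<omega> + h n * X \<omega>) - of_real (Y \<omega>) * cis (\<theta> \<omega>)) /\<^sub>R h n)"
        by (simp add: algebra_simps)
      also have "\<dots> = (CLINT \<omega>|M. of_real (Y \<omega>) * cis (\<theta> \<omega> + h n * X \<omega>) - of_real (Y \<omega>) * cis (\<theta> \<omega>)) /\<^sub>R h n"
        by (rule integral_scaleR_right)
      also have "(CLINT \<omega>|M. of_real (Y \<omega>) * cis (\<theta> \<omega> + h n * X \<omega>) - of_real (Y \<omega>) * cis (\<theta> \<omega>)) =
         (CLINT \<omega>|M. of_real (Y \<omega>) * cis (\<theta> \<omega> + h n * X \<omega>)) - (CLINT \<omega>|M. of_real (Y \<omega>) * cis (\<theta> \<omega>))"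
        by (rule Bochner_Integration.integral_diff) (use I[of "h n"] I[of 0] in auto)
      finally show ?thesis .
    qed
    moreover have "(CLINT \<omega>|M. of_real (Y \<omega>) * (\<i> * of_real (X \<omega>) * cis (\<theta> \<omega>))) = \<i> * (CLINT \<omega>|M. of_real (Y \<omega> * X \<omega>) * cis (\<theta> \<omega>))"
      by (subst integral_mult_right_zero[symmetric]) (simp add: mult_ac)
    ultimately show "((\<lambda>h. ((CLINT \<omega>|M. of_real (Y \<omega>) * cis (\<theta> \<omega> + h * X \<omega>)) - (CLINT \<omega>|M. of_real (Y \<omega>) * cis (\<theta> \<omega>))) /\<^sub>R h) \<circ> h)
      \<longlonglongrightarrow> \<i> * (CLINT \<omega>|M. of_real (Y \<omega> * X \<omega>) * cis (\<theta> \<omega>))"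
      by (simp only: comp_def)
  qed
  then show ?thesis
    by (simp add: has_vector_derivative_at_0_iff)
qed

definition abs_normal_moment :: "nat \<Rightarrow> real" where
  "abs_normal_moment k = (LINT z|std_normal_distribution. \<bar>z\<bar> ^ k)"

text \<open>By Levy uniqueness the hypothesis identifies the law of \<open>X\<close> with that of
  sqrt v times a standard normal variable; v = 0 is included.\<close>

lemma normal_moment_abs:
  fixes X :: "'w \<Rightarrow> real"
  assumes M: "prob_space M" and [measurable]: "X \<in> borel_measurable M" and v: "v \<ge> 0"
    and ch: "\<And>s. (CLINT \<omega>|M. cis (s * X \<omega>)) = of_real (exp (- (s\<^sup>2 * v) / 2))"
  shows "integrable M (\<lambda>\<omega>. \<bar>X \<omega>\<bar> ^ k)"
    and "(LINT \<omega>|M. \<bar>X \<omega>\<bar> ^ k) = sqrt v ^ k * abs_normal_moment k"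
proof -
  interpret prob_space M by fact
  interpret N: prob_space std_normal_distribution by (rule prob_space_normal_density) simp
  have eq: "distr M borel X = distr std_normal_distribution borel (\<lambda>z. sqrt v * z)"
  proof (rule Levy_uniqueness)
    show "real_distribution (distr M borel X)"
      by (simp add: real_distribution_def real_distribution_axioms_def prob_space_distr)
    show "real_distribution (distr std_normal_distribution borel (\<lambda>z. sqrt v * z))"
      by (simp add: real_distribution_def real_distribution_axioms_def N.prob_space_distr)
    show "char (distr M borel X) = char (distr std_normal_distribution borel (\<lambda>z. sqrt v * z))"
    proof
      fix s
      have "char (distr M borel X) s = of_real (exp (- (s\<^sup>2 * v) / 2))"
        using ch[of s] by (simp add: char_def integral_distr cis_conv_exp)
      also have "\<dots> = char std_normal_distribution (s * sqrt v)"
        using v by (simp add: char_std_normal_distribution power_mult_distrib)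
      also have "\<dots> = char (distr std_normal_distribution borel (\<lambda>z. sqrt v * z)) s"
        by (simp add: char_def integral_distr mult_ac)
      finally show "char (distr M borel X) s = \<dots>" .
    qed
  qed
  have absn: "integrable std_normal_distribution (\<lambda>z. \<bar>z\<bar> ^ k)"
    using integrable_std_normal_distribution_moment[of k]
    by (simp add: integrable_abs power_abs[symmetric])
  have "integrable (distr M borel X) (\<lambda>z. \<bar>z\<bar> ^ k)"
    unfolding eq by (subst integrable_distr_eq) (auto simp: abs_mult power_mult_distrib absn)
  then show "integrable M (\<lambda>\<omega>. \<bar>X \<omega>\<bar> ^ k)"
    by (subst (asm) integrable_distr_eq) auto
  have "(LINT \<omega>|M. \<bar>X \<omega>\<bar> ^ k) = (LINT z|distr M borel X. \<bar>z\<bar> ^ k)"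
    by (simp add: integral_distr)
  also have "\<dots> = (LINT z|std_normal_distribution. sqrt v ^ k * \<bar>z\<bar> ^ k)"
    unfolding eq using v by (simp add: integral_distr abs_mult power_mult_distrib)
  finally show "(LINT \<omega>|M. \<bar>X \<omega>\<bar> ^ k) = sqrt v ^ k * abs_normal_moment k"
    by (simp add: abs_normal_moment_def)
qed

text \<open>Every factor is at most the largest one, whose power occurs in the sum. The summand 1 is
  for empty \<open>S\<close>, where the product is 1 and the sum 0. A crude substitute for Hoelder,
  sufficient for integrability.\<close>

lemma prod_abs_le_sum_power:
  fixes v :: "'i \<Rightarrow> real"
  assumes "finite S"
  shows "(\<Prod>i\<in>S. \<bar>v i\<bar>) \<le> 1 + (\<Sum>i\<in>S. \<bar>v i\<bar> ^ card S)"
proof (cases "S = {}")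
  case False
  define m where "m = Max ((\<lambda>i. \<bar>v i\<bar>) ` S)"
  have "m \<in> (\<lambda>i. \<bar>v i\<bar>) ` S" unfolding m_def using False assms by (intro Max_in) auto
  then obtain j where j: "j \<in> S" "m = \<bar>v j\<bar>" by auto
  have "(\<Prod>i\<in>S. \<bar>v i\<bar>) \<le> (\<Prod>i\<in>S. m)"
    by (intro prod_mono) (auto simp: m_def assms)
  also have "\<dots> = \<bar>v j\<bar> ^ card S" using j by simp
  also have "\<dots> \<le> (\<Sum>i\<in>S. \<bar>v i\<bar> ^ card S)"
    using j assms by (intro member_le_sum) auto
  finally show ?thesis by simp
qed simp

text \<open>Gaussianity is encoded by the joint characteristic function, the form in which the noise
  is given and which survives L^2 limits. Different indices may carry the same variable, so
  coinciding points need no special treatment.\<close>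

locale gaussian_family = prob_space M for M :: "'w measure" +
  fixes X :: "'i \<Rightarrow> 'w \<Rightarrow> real" and C :: "'i \<Rightarrow> 'i \<Rightarrow> real"
  assumes X_meas [measurable]: "X i \<in> borel_measurable M"
    and char_X: "finite I \<Longrightarrow> (CLINT \<omega>|M. cis (\<Sum>i\<in>I. c i * X i \<omega>)) =
        of_real (exp (- (\<Sum>i\<in>I. \<Sum>j\<in>I. c i * c j * C i j) / 2))"
    and C_sym: "C i j = C j i" and C_diag: "C i i \<ge> 0"
begin

lemma abs_moment:
  shows "integrable M (\<lambda>\<omega>. \<bar>X i \<omega>\<bar> ^ k)"
    and "(LINT \<omega>|M. \<bar>X i \<omega>\<bar> ^ k) = sqrt (C i i) ^ k * abs_normal_moment k"
proof -
  have "(CLINT \<omega>|M. cis (s * X i \<omega>)) = of_real (exp (- (s\<^sup>2 * C i i) / 2))" for s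
    using char_X[of "{i}" "\<lambda>_. s"] by (simp add: power2_eq_square)
  from normal_moment_abs[OF prob_space_axioms X_meas C_diag this]
  show "integrable M (\<lambda>\<omega>. \<bar>X i \<omega>\<bar> ^ k)"
    and "(LINT \<omega>|M. \<bar>X i \<omega>\<bar> ^ k) = sqrt (C i i) ^ k * abs_normal_moment k" by auto
qed

lemma integrable_prod:
  assumes "finite S" shows "integrable M (\<lambda>\<omega>. \<Prod>i\<in>S. X i \<omega>)"
proof (rule Bochner_Integration.integrable_bound)
  show "integrable M (\<lambda>\<omega>. 1 + (\<Sum>i\<in>S. \<bar>X i \<omega>\<bar> ^ card S))"
    by (intro Bochner_Integration.integrable_add Bochner_Integration.integrable_sum abs_moment) simp
  show "AE \<omega> in M. norm (\<Prod>i\<in>S. X i \<omega>) \<le> norm (1 + (\<Sum>i\<in>S. \<bar>X i \<omega>\<bar> ^ card S))"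
    using prod_abs_le_sum_power[OF assms] by (auto simp: abs_prod sum_nonneg intro: order_trans)
qed simp

text \<open>The bound sees the variables only through the variance bound \<open>B\<close>, hence is
  uniform in the positions of the points; it serves to license Fubini in
  \<open>chain_integral_moment\<close>.\<close>

lemma expectation_abs_prod_le:
  assumes "finite S" "\<And>i. i \<in> S \<Longrightarrow> C i i \<le> B"
  shows "(\<integral>\<^sup>+\<omega>. ennreal (\<Prod>i\<in>S. \<bar>X i \<omega>\<bar>) \<partial>M)
    \<le> ennreal (1 + card S * (sqrt B ^ card S * abs_normal_moment (card S)))"
proof -
  have mn: "abs_normal_moment k \<ge> 0" for k unfolding abs_normal_moment_def by simp
  have "(\<integral>\<^sup>+\<omega>. ennreal (\<Prod>i\<in>S. \<bar>X i \<omega>\<bar>) \<partial>M) \<le> (\<integral>\<^sup>+\<omega>. ennreal (1 + (\<Sum>i\<in>S. \<bar>X i \<omega>\<bar> ^ card S)) \<partial>M)"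
    using prod_abs_le_sum_power[OF assms(1)] by (intro nn_integral_mono ennreal_leI) auto
  also have "\<dots> = ennreal (LINT \<omega>|M. 1 + (\<Sum>i\<in>S. \<bar>X i \<omega>\<bar> ^ card S))"
    by (intro nn_integral_eq_integral Bochner_Integration.integrable_add
        Bochner_Integration.integrable_sum abs_moment) (auto simp: sum_nonneg)
  also have "(LINT \<omega>|M. 1 + (\<Sum>i\<in>S. \<bar>X i \<omega>\<bar> ^ card S)) = 1 + (\<Sum>i\<in>S. sqrt (C i i) ^ card S * abs_normal_moment (card S))"
    by (subst Bochner_Integration.integral_add)
      (auto intro!: Bochner_Integration.integrable_sum abs_moment
        simp: Bochner_Integration.integral_sum abs_moment prob_space)
  also have "\<dots> \<le> 1 + (\<Sum>i\<in>S. sqrt B ^ card S * abs_normal_moment (card S))"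
    using assms mn C_diag by (intro add_left_mono sum_mono mult_right_mono power_mono) auto
  finally show ?thesis by (simp add: ennreal_leI)
qed

section \<open>Tilted moments and Gaussian integration by parts\<close>

text \<open>Up to a power of the imaginary unit, a mixed partial derivative of the joint
  characteristic function at \<open>c\<close>. Keeping \<open>c\<close> free allows a further factor
  to be produced by differentiation.\<close>

definition tilted :: "'i set \<Rightarrow> 'i set \<Rightarrow> ('i \<Rightarrow> real) \<Rightarrow> complex" where
  "tilted I S c = (CLINT \<omega>|M. of_real (\<Prod>i\<in>S. X i \<omega>) * cis (\<Sum>i\<in>I. c i * X i \<omega>))"

lemma tilted_derivative:
  assumes "finite I" "S \<subseteq> I" "b \<in> I" "b \<notin> S"
  shows "((\<lambda>h. tilted I S (c(b := c b + h))) has_vector_derivative \<i> * tilted I (insert b S) c) (at 0)"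
proof -
  have fS: "finite S" using assms finite_subset by blast
  have s: "(\<Sum>i\<in>I. (c(b := c b + h)) i * X i \<omega>) = (\<Sum>i\<in>I. c i * X i \<omega>) + h * X b \<omega>" for h \<omega>
    using assms(1,3) by (simp add: sum.remove[of I b] algebra_simps)
  have "((\<lambda>h. CLINT \<omega>|M. of_real (\<Prod>i\<in>S. X i \<omega>) * cis ((\<Sum>i\<in>I. c i * X i \<omega>) + h * X b \<omega>)) has_vector_derivative
     \<i> * (CLINT \<omega>|M. of_real ((\<Prod>i\<in>S. X i \<omega>) * X b \<omega>) * cis (\<Sum>i\<in>I. c i * X i \<omega>))) (at 0)"
    using integrable_prod[OF fS] integrable_prod[of "insert b S"] fS assms(4)
    by (intro has_vector_derivative_integral_cis) (auto simp: mult_ac)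
  then show ?thesis
    unfolding tilted_def s using fS assms(4) by (simp add: mult_ac)
qed

text \<open>Gaussian integration by parts, by induction on \<open>S\<close>. The base case
  differentiates exp(- Q / 2). In the step, the formula for \<open>S\<close> is differentiated in
  \<open>c b\<close>: the linear factor yields the summand \<open>j = b\<close>, and the tilted
  moments acquire the factor \<open>b\<close>.\<close>

lemma tilted_insert:
  assumes I: "finite I" and S: "finite S" "S \<subseteq> I" and a: "a \<in> I" "a \<notin> S"
  shows "tilted I (insert a S) c =
    \<i> * of_real (\<Sum>j\<in>I. C a j * c j) * tilted I S c + (\<Sum>j\<in>S. of_real (C a j) * tilted I (S - {j}) c)"
  using S a
proof (induction S arbitrary: a c rule: finite_induct)
  case empty
  define Q where "Q c = (\<Sum>i\<in>I. \<Sum>j\<in>I. c i * c j * C i j)" for c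
  have Qh: "Q (c(a := c a + h)) = Q c + 2 * h * (\<Sum>j\<in>I. C a j * c j) + h\<^sup>2 * C a a" for h
  proof -
    have e: "(c(a := c a + h)) i = c i + (if i = a then h else 0)" for i by simp
    have "Q (c(a := c a + h)) = (\<Sum>i\<in>I. \<Sum>j\<in>I. c i * c j * C i j + (if j = a then c i * h * C i a else 0)
        + (if i = a then h * c j * C a j else 0) + (if i = a then (if j = a then h * h * C a a else 0) else 0))"
      unfolding Q_def e by (intro sum.cong refl) (auto simp: algebra_simps)
    also have "\<dots> = Q c + (\<Sum>i\<in>I. c i * h * C i a) + (\<Sum>i\<in>I. if i = a then (\<Sum>j\<in>I. h * c j * C a j) else 0) + h * h * C a a"
    proof -
      have "(\<Sum>j\<in>I. if i = a then h * c j * C a j else 0) = (if i = a then (\<Sum>j\<in>I. h * c j * C a j) else 0)"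
        "(\<Sum>j\<in>I. if i = a then (if j = a then h * h * C a a else 0) else 0) = (if i = a then h * h * C a a else 0)" for i
        using I empty by (auto simp: sum.delta)
      then show ?thesis using I empty by (simp add: sum.distrib Q_def sum.delta)
    qed
    also have "\<dots> = Q c + 2 * h * (\<Sum>j\<in>I. C a j * c j) + h\<^sup>2 * C a a"
    proof -
      have "(\<Sum>i\<in>I. c i * h * C i a) = (\<Sum>j\<in>I. h * c j * C a j)"
        by (intro sum.cong refl) (simp add: C_sym[of _ a])
      moreover have "(\<Sum>j\<in>I. h * c j * C a j) = h * (\<Sum>j\<in>I. C a j * c j)"
        by (simp add: sum_distrib_left mult_ac)
      ultimately show ?thesis
        using I empty by (simp add: sum.delta power2_eq_square)
    qed
    finally show ?thesis .
  qed
  have t0: "tilted I {} c = of_real (exp (- Q c / 2))" for c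
    unfolding tilted_def Q_def using char_X[OF I, of c] by simp
  have "((\<lambda>h. tilted I {} (c(a := c a + h))) has_vector_derivative \<i> * tilted I {a} c) (at 0)"
    using tilted_derivative[OF I, of "{}" a c] empty by simp
  moreover have "((\<lambda>h. tilted I {} (c(a := c a + h))) has_vector_derivative
      of_real (exp (- Q c / 2) * - (\<Sum>j\<in>I. C a j * c j))) (at 0)"
    unfolding t0 Qh
    by (intro has_vector_derivative_of_real) (auto intro!: derivative_eq_intros simp: has_real_derivative_iff_has_vector_derivative[symmetric])
  ultimately have "\<i> * tilted I {a} c = of_real (exp (- Q c / 2) * - (\<Sum>j\<in>I. C a j * c j))"
    by (rule vector_derivative_unique_at)
  then have "\<i> * (\<i> * tilted I {a} c) = \<i> * of_real (exp (- Q c / 2) * - (\<Sum>j\<in>I. C a j * c j))"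
    by simp
  then have "tilted I {a} c = \<i> * of_real (\<Sum>j\<in>I. C a j * c j) * of_real (exp (- Q c / 2))"
    by (simp add: mult_ac)
  then show ?case by (simp add: t0)
next
  case (insert b S)
  let ?L = "\<lambda>c. \<Sum>j\<in>I. C a j * c j"
  have bI: "b \<in> I" "b \<notin> S" "S \<subseteq> I" "a \<noteq> b" "a \<notin> S" "a \<in> I" using insert by auto
  have Lh: "?L (c(b := c b + h)) = ?L c + h * C a b" for h
    using I bI by (simp add: sum.remove[of I b] algebra_simps)
  let ?F = "\<lambda>h. \<i> * of_real (?L c + h * C a b) * tilted I S (c(b := c b + h))
      + (\<Sum>j\<in>S. of_real (C a j) * tilted I (S - {j}) (c(b := c b + h)))"
  have "((\<lambda>h. tilted I (insert a S) (c(b := c b + h))) has_vector_derivative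
      \<i> * tilted I (insert b (insert a S)) c) (at 0)"
    using bI by (intro tilted_derivative[OF I]) auto
  moreover have "(\<lambda>h. tilted I (insert a S) (c(b := c b + h))) = ?F"
    using insert.IH[of a] bI unfolding Lh[symmetric] by auto
  ultimately have 1: "(?F has_vector_derivative \<i> * tilted I (insert b (insert a S)) c) (at 0)"
    by simp
  have d1: "((\<lambda>h. \<i> * of_real (?L c + h * C a b)) has_vector_derivative \<i> * of_real (C a b)) (at 0)"
    by (intro has_vector_derivative_mult_right has_vector_derivative_of_real)
      (auto intro!: derivative_eq_intros simp: has_real_derivative_iff_has_vector_derivative[symmetric])
  have d2: "((\<lambda>h. tilted I S (c(b := c b + h))) has_vector_derivative \<i> * tilted I (insert b S) c) (at 0)"
    using bI by (intro tilted_derivative[OF I]) auto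
  have d3: "((\<lambda>h. tilted I (S - {j}) (c(b := c b + h))) has_vector_derivative \<i> * tilted I (insert b (S - {j})) c) (at 0)" for j
    using bI by (intro tilted_derivative[OF I]) auto
  have "(?F has_vector_derivative
      (\<i> * of_real (?L c + 0 * C a b) * (\<i> * tilted I (insert b S) c) + \<i> * of_real (C a b) * tilted I S (c(b := c b + 0)))
      + (\<Sum>j\<in>S. of_real (C a j) * (\<i> * tilted I (insert b (S - {j})) c))) (at 0)"
    by (intro has_vector_derivative_add has_vector_derivative_mult d1 d2 has_vector_derivative_sum
        has_vector_derivative_mult_right d3)
  from vector_derivative_unique_at[OF 1 this]
  have "\<i> * tilted I (insert b (insert a S)) c = \<i> * (
      \<i> * of_real (?L c) * tilted I (insert b S) c + of_real (C a b) * tilted I S c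
      + (\<Sum>j\<in>S. of_real (C a j) * tilted I (insert b (S - {j})) c))"
    by (simp add: algebra_simps sum_distrib_left)
  then have "tilted I (insert b (insert a S)) c =
      \<i> * of_real (?L c) * tilted I (insert b S) c + of_real (C a b) * tilted I S c
      + (\<Sum>j\<in>S. of_real (C a j) * tilted I (insert b (S - {j})) c)"
    by simp
  moreover have "(\<Sum>j\<in>S. of_real (C a j) * tilted I (insert b (S - {j})) c) =
      (\<Sum>j\<in>S. of_real (C a j) * tilted I (insert b S - {j}) c)"
    using bI by (intro sum.cong refl) (metis insert_Diff_if singletonD)
  ultimately show ?case
    using insert.hyps by (simp add: insert_commute)
qed

text \<open>At \<open>c = 0\<close> the linear term of \<open>tilted_insert\<close> vanishes and the
  tilt is 1, which leaves the sum over the partners of \<open>a\<close>. One point is expanded at a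
  time; the full sum over pairings is never written down.\<close>

theorem isserlis:
  assumes "finite S" "a \<notin> S"
  shows "expectation (\<lambda>\<omega>. \<Prod>i\<in>insert a S. X i \<omega>) =
    (\<Sum>j\<in>S. C a j * expectation (\<lambda>\<omega>. \<Prod>i\<in>S - {j}. X i \<omega>))"
proof -
  have t: "tilted (insert a S) T (\<lambda>_. 0) = of_real (expectation (\<lambda>\<omega>. \<Prod>i\<in>T. X i \<omega>))" for T
    unfolding tilted_def by (simp del: of_real_prod)
  show ?thesis
    using tilted_insert[of "insert a S" S a "\<lambda>_. 0", OF _ assms(1) subset_insertI insertI1 assms(2)] assms(1)
    unfolding t
    by (simp flip: of_real_mult of_real_sum del: of_real_prod prod.insert add: assms)
qed

end

section \<open>Moments of Gaussian chains\<close>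

text \<open>Volume of the set of times 0 < t_1 < ... < t_k < s. The value 0 for nonpositive
  \<open>s\<close> matters at \<open>k = 0\<close>, where it encodes that the first time must be
  positive.\<close>

definition simplex_weight :: "nat \<Rightarrow> real \<Rightarrow> real" where
  "simplex_weight k s = (if 0 < s then s ^ k / fact k else 0)"

lemma simplex_weight_nonneg [simp]: "simplex_weight k s \<ge> 0"
  by (simp add: simplex_weight_def)

lemma simplex_weight_measurable [measurable]: "simplex_weight k \<in> borel_measurable borel"
  unfolding simplex_weight_def[abs_def] by measurable

lemma simplex_weight_integral:
  "(\<integral>\<^sup>+s. ennreal (simplex_weight k s) * indicator {..<r} s \<partial>lborel) = ennreal (simplex_weight (Suc k) r)"
proof (cases "r > 0")
  case True
  have "(\<integral>\<^sup>+s. ennreal (simplex_weight k s) * indicator {..<r} s \<partial>lborel)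
      = (\<integral>\<^sup>+s. ennreal (s ^ k / fact k) * indicator {0..r} s \<partial>lborel)"
  proof (rule nn_integral_cong_AE)
    have "AE s in lborel. s \<noteq> (0::real)" "AE s in lborel. s \<noteq> r"
      by (rule AE_lborel_singleton)+
    then show "AE s in lborel. ennreal (simplex_weight k s) * indicator {..<r} s
        = ennreal (s ^ k / fact k) * indicator {0..r} s"
    proof eventually_elim
      case (elim s)
      then show ?case
        by (cases "0 < s"; cases "s < r") (simp_all add: simplex_weight_def indicator_def)
    qed
  qed
  also have "\<dots> = ennreal (r ^ Suc k / fact (Suc k) - 0 ^ Suc k / fact (Suc k))"
  proof (rule nn_integral_FTC_Icc)
    show "((\<lambda>s. s ^ Suc k / fact (Suc k)) has_real_derivative x ^ k / fact k) (at x)" for x :: real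
    proof -
      have "((\<lambda>s. s ^ Suc k / fact (Suc k)) has_real_derivative (real (Suc k) * x ^ k) / fact (Suc k)) (at x)"
        using DERIV_cdivide[OF DERIV_pow[of "Suc k" x UNIV], of "fact (Suc k)"]
        by (simp del: fact_Suc power_Suc of_nat_Suc)
      moreover have "(real (Suc k) * x ^ k) / fact (Suc k) = x ^ k / fact k"
        unfolding fact_Suc by (simp del: of_nat_Suc)
      ultimately show ?thesis by (simp only:)
    qed
  qed (use True in auto)
  finally show ?thesis using True by (simp add: simplex_weight_def)
next
  case False
  then have "ennreal (simplex_weight k s) * indicator {..<r} s = 0" for s
    by (auto simp: simplex_weight_def split: split_indicator)
  then have "(\<integral>\<^sup>+s. ennreal (simplex_weight k s) * indicator {..<r} s \<partial>lborel) = 0"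
    by (simp only: nn_integral_0_iff_AE) simp
  then show ?thesis using False by (simp add: simplex_weight_def)
qed

text \<open>\<open>sqrt (fact s)\<close> replaces the number \<open>(s - 1)!!\<close> of pairings: it satisfies the recursive inequality
  that results from pairing one of \<open>s\<close> points with each of the others.\<close>

lemma sqrt_fact_step:
  assumes "s \<ge> 1" shows "real s * sqrt (fact (s - 1)) \<le> sqrt (fact (Suc s))"
proof -
  obtain m where s: "s = Suc m" using assms by (cases s) auto
  have "(real s * sqrt (fact (s - 1)))\<^sup>2 = real s * (real s * fact m)"
    by (simp add: s power_mult_distrib power2_eq_square mult_ac)
  also have "\<dots> \<le> real (Suc s) * (real s * fact m)" by (intro mult_right_mono) auto
  also have "\<dots> = fact (Suc s)" by (simp add: s algebra_simps)
  finally show ?thesis by (rule real_le_rsqrt)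
qed

lemma nn_integral_cmult_real:
  assumes "p \<ge> 0" and [measurable]: "F \<in> borel_measurable N"
  shows "(\<integral>\<^sup>+z. ennreal (p * F z) \<partial>N) = ennreal p * (\<integral>\<^sup>+z. ennreal (F z) \<partial>N)"
  using assms(1) by (simp add: ennreal_mult' nn_integral_cmult)

lemma nn_integral_sum_cmult:
  assumes F: "\<And>j. j \<in> J \<Longrightarrow> F j \<in> borel_measurable N"
  shows "(\<integral>\<^sup>+z. (\<Sum>j\<in>J. (c::ennreal) * F j z) \<partial>N) = (\<Sum>j\<in>J. c * (\<integral>\<^sup>+z. F j z \<partial>N))"
  using F by (simp add: nn_integral_sum nn_integral_cmult)

text \<open>\<open>B\<close> may depend on the mollification and only secures absolute
  integrability; \<open>D\<close> is the constant that survives. \<open>K_0\<close> lets the kernels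
  themselves enforce increasing times.\<close>

locale gaussian_chain = prob_space M for M :: "'w measure" +
  fixes V :: "'a::euclidean_space \<Rightarrow> 'w \<Rightarrow> real" and \<Gamma> :: "'a \<Rightarrow> 'a \<Rightarrow> real"
    and K :: "real \<Rightarrow> 'a \<Rightarrow> real" and B D :: real
  assumes V_meas: "(\<lambda>(x, \<omega>). V x \<omega>) \<in> borel_measurable (lborel \<Otimes>\<^sub>M M)"
    and Gam_nonneg: "\<Gamma> x y \<ge> 0"
    and Gam_meas: "(\<lambda>x. \<Gamma> x y) \<in> borel_measurable borel"
    and gaussian: "\<And>x :: nat \<times> nat \<Rightarrow> 'a. gaussian_family M (\<lambda>i. V (x i)) (\<lambda>i j. \<Gamma> (x i) (x j))"
    and Gam_le: "\<Gamma> x x \<le> B"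
    and K_nonneg: "K r x \<ge> 0"
    and K_meas: "(\<lambda>(r, x). K r x) \<in> borel_measurable (borel \<Otimes>\<^sub>M borel)"
    and K_0: "r \<le> 0 \<Longrightarrow> K r x = 0"
    and D: "D \<ge> 1"
    and K_int: "(\<integral>\<^sup>+y. ennreal (K r (x - y)) \<partial>lborel) \<le> ennreal D"
    and K_Gam: "(\<integral>\<^sup>+y. ennreal (K r (x - y)) * ennreal (\<Gamma> y x') \<partial>lborel) \<le> ennreal D"
begin

abbreviation X :: "(real \<times> 'a) measure" where "X \<equiv> lborel \<Otimes>\<^sub>M lborel"

lemma K_meas' [measurable (raw)]:
  assumes "f \<in> borel_measurable N" "g \<in> borel_measurable N"
  shows "(\<lambda>z. K (f z) (g z)) \<in> borel_measurable N"
  using measurable_compose[OF measurable_Pair[OF assms] K_meas] by simp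

definition moment :: "(nat \<times> nat) set \<Rightarrow> (nat \<times> nat \<Rightarrow> 'a) \<Rightarrow> real" where
  "moment S x = expectation (\<lambda>\<omega>. \<Prod>j\<in>S. V (x j) \<omega>)"

lemma V_meas2:
  assumes "f \<in> borel_measurable N" "g \<in> measurable N M"
  shows "(\<lambda>z. V (f z) (g z)) \<in> borel_measurable N"
proof -
  have "f \<in> measurable N lborel" using assms by simp
  from measurable_compose[OF measurable_Pair[OF this assms(2)] V_meas] show ?thesis by simp
qed

lemma moment_measurable:
  assumes f: "\<And>j. j \<in> S \<Longrightarrow> (\<lambda>z. f z j) \<in> borel_measurable N"
  shows "(\<lambda>z. moment S (f z)) \<in> borel_measurable N"
  unfolding moment_def
proof (rule borel_measurable_lebesgue_integral)
  show "(\<lambda>(z, \<omega>). \<Prod>j\<in>S. V (f z j) \<omega>) \<in> borel_measurable (N \<Otimes>\<^sub>M M)"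
    unfolding split_beta
  proof (rule borel_measurable_prod)
    fix j assume "j \<in> S"
    show "(\<lambda>p. V (f (fst p) j) (snd p)) \<in> borel_measurable (N \<Otimes>\<^sub>M M)"
      by (intro V_meas2 measurable_compose[OF measurable_fst f[OF \<open>j \<in> S\<close>]] measurable_snd)
  qed
qed

lemma moment_empty: "moment {} x = 1" unfolding moment_def by (simp add: prob_space)

lemma moment_insert:
  assumes "finite S" "a \<notin> S"
  shows "moment (insert a S) x = (\<Sum>j\<in>S. \<Gamma> (x a) (x j) * moment (S - {j}) x)"
proof -
  interpret gf: gaussian_family M "\<lambda>i. V (x i)" "\<lambda>i j. \<Gamma> (x i) (x j)" by (rule gaussian)
  show ?thesis unfolding moment_def by (rule gf.isserlis[OF assms])
qed

text \<open>The recursion removes two points, so the induction is on the cardinality. With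
  \<open>\<Gamma>\<close> nonnegative all summands are, which allows the later estimates to be made
  with \<open>ennreal\<close> integrals.\<close>

lemma moment_nonneg: "finite S \<Longrightarrow> moment S x \<ge> 0"
proof (induction "card S" arbitrary: S rule: less_induct)
  case less
  show ?case
  proof (cases "S = {}")
    case False
    then obtain a where "a \<in> S" by auto
    define S' where "S' = S - {a}"
    have S: "S = insert a S'" "a \<notin> S'" "finite S'" using \<open>a \<in> S\<close> less.prems by (auto simp: S'_def)
    have "moment (S' - {j}) x \<ge> 0" for j
    proof (rule less.hyps)
      have "card (S' - {j}) \<le> card S'" using S(3) by (intro card_mono) auto
      also have "\<dots> < card S" unfolding S(1) using S(2,3) by simp
      finally show "card (S' - {j}) < card S" .
    qed (use S in simp)
    then show ?thesis
      unfolding S(1) moment_insert[OF S(3,2)] by (intro sum_nonneg mult_nonneg_nonneg Gam_nonneg)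
  qed (simp add: moment_empty)
qed

lemma moment_cong: "(\<And>j. j \<in> S \<Longrightarrow> x j = y j) \<Longrightarrow> moment S x = moment S y"
  unfolding moment_def by (auto intro!: Bochner_Integration.integral_cong prod.cong)

text \<open>The space integral is at most \<open>A\<close> whatever the time gap and vanishes unless
  the gap is positive; the remaining time integral raises the simplex weight by one. In the
  applications \<open>f\<close> is 1 or the covariance with a fixed partner.\<close>

lemma kernel_step:
  assumes [measurable]: "f \<in> borel_measurable borel"
    and f: "\<And>r. (\<integral>\<^sup>+u. ennreal (K r (x - u)) * f u \<partial>lborel) \<le> A"
  shows "(\<integral>\<^sup>+y. ennreal (simplex_weight k (fst y) * K (r - fst y) (x - snd y)) * f (snd y) \<partial>X)
    \<le> A * ennreal (simplex_weight (Suc k) r)"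
proof -
  have "(\<integral>\<^sup>+y. ennreal (simplex_weight k (fst y) * K (r - fst y) (x - snd y)) * f (snd y) \<partial>X)
     = (\<integral>\<^sup>+s. \<integral>\<^sup>+u. ennreal (simplex_weight k s * K (r - s) (x - u)) * f u \<partial>lborel \<partial>lborel)"
    by (subst lborel.nn_integral_fst[symmetric]) simp_all
  also have "\<dots> \<le> (\<integral>\<^sup>+s. A * (ennreal (simplex_weight k s) * indicator {..<r} s) \<partial>lborel)"
  proof (rule nn_integral_mono)
    fix s
    have "(\<integral>\<^sup>+u. ennreal (simplex_weight k s * K (r - s) (x - u)) * f u \<partial>lborel)
      = ennreal (simplex_weight k s) * (\<integral>\<^sup>+u. ennreal (K (r - s) (x - u)) * f u \<partial>lborel)"
      by (subst nn_integral_cmult[symmetric]) (simp_all add: ennreal_mult K_nonneg mult.assoc)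
    also have "\<dots> \<le> A * (ennreal (simplex_weight k s) * indicator {..<r} s)"
    proof (cases "s < r")
      case True
      then show ?thesis using mult_left_mono[OF f[of "r - s"], of "ennreal (simplex_weight k s)"]
        by (simp add: mult.commute)
    qed (simp add: K_0)
    finally show "(\<integral>\<^sup>+u. ennreal (simplex_weight k s * K (r - s) (x - u)) * f u \<partial>lborel)
      \<le> A * (ennreal (simplex_weight k s) * indicator {..<r} s)" .
  qed
  also have "\<dots> = A * ennreal (simplex_weight (Suc k) r)"
    by (subst nn_integral_cmult) (simp_all add: simplex_weight_integral)
  finally show ?thesis .
qed

end

locale gaussian_chain_at = gaussian_chain M V \<Gamma> K B D
  for M :: "'w measure" and V :: "'a::euclidean_space \<Rightarrow> 'w \<Rightarrow> real" and \<Gamma> K B D +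
  fixes n :: nat and t :: real and x :: 'a
begin

definition node :: "(nat \<Rightarrow> real \<times> 'a) \<Rightarrow> nat \<Rightarrow> real \<times> 'a" where
  "node z i = (if i = Suc n then (t, x) else z i)"

text \<open>The part of the chain kernel that is left once the points \<open>1, \<dots>, k\<close> have been integrated out; the
  simplex weight accounts for the times of these points.\<close>

definition chain :: "nat \<Rightarrow> (nat \<Rightarrow> real \<times> 'a) \<Rightarrow> real" where
  "chain k z = simplex_weight k (fst (node z (Suc k))) *
     (\<Prod>i\<in>{Suc k..n}. K (fst (node z (Suc i)) - fst (node z i)) (snd (node z (Suc i)) - snd (node z i)))"

abbreviation P :: "nat set \<Rightarrow> (nat \<Rightarrow> real \<times> 'a) measure" where "P I \<equiv> PiM I (\<lambda>_. X)"

definition pos :: "(nat \<Rightarrow> nat \<Rightarrow> real \<times> 'a) \<Rightarrow> nat \<times> nat \<Rightarrow> 'a" where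
  "pos Z j = snd (Z (fst j) (snd j))"

lemma chain_nonneg [simp]: "chain k z \<ge> 0"
  by (auto simp: chain_def K_nonneg intro!: mult_nonneg_nonneg prod_nonneg)

lemma node_measurable:
  assumes "i \<in> {Suc k..Suc n}"
  shows "(\<lambda>z. node z i) \<in> measurable (P {Suc k..n}) X"
  using assms by (cases "i = Suc n") (auto simp: node_def)

lemma chain_measurable [measurable]:
  assumes "k \<le> n" shows "chain k \<in> borel_measurable (P {Suc k..n})"
proof -
  have 1: "(\<lambda>z. fst (node z i)) \<in> borel_measurable (P {Suc k..n})"
    "(\<lambda>z. snd (node z i)) \<in> borel_measurable (P {Suc k..n})" if "i \<in> {Suc k..Suc n}" for i
    using measurable_compose[OF node_measurable[OF that] measurable_fst]
      measurable_compose[OF node_measurable[OF that] measurable_snd] by simp_all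
  show ?thesis
    unfolding chain_def
    using assms by (intro borel_measurable_times borel_measurable_prod K_meas' borel_measurable_diff 1
        measurable_compose[OF 1(1) simplex_weight_measurable]) auto
qed

text \<open>The earliest remaining point meets two factors only, the simplex weight and the kernel
  to its successor; for \<open>Suc k = n\<close> the successor is the endpoint
  \<open>(t, x)\<close>.\<close>

lemma chain_Suc:
  assumes "k < n"
  shows "chain k (z(Suc k := y)) =
     simplex_weight k (fst y) * K (fst (node z (Suc (Suc k))) - fst y) (snd (node z (Suc (Suc k))) - snd y)
     * (\<Prod>i\<in>{Suc (Suc k)..n}. K (fst (node z (Suc i)) - fst (node z i)) (snd (node z (Suc i)) - snd (node z i)))"
proof -
  have 1: "{Suc k..n} = insert (Suc k) {Suc (Suc k)..n}" using assms by auto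
  have 2: "node (z(Suc k := y)) (Suc k) = y" "\<And>i. i \<noteq> Suc k \<Longrightarrow> node (z(Suc k := y)) i = node z i"
    using assms by (auto simp: node_def)
  show ?thesis unfolding chain_def 1 by (simp add: 2)
qed

sublocale PX: product_sigma_finite "\<lambda>_::nat. X"
  unfolding product_sigma_finite_def
  by (auto intro: sigma_finite_pair_measure lborel.sigma_finite_measure_axioms)

lemma P_sigma_finite: "finite I \<Longrightarrow> sigma_finite_measure (P I)" by (rule PX.sigma_finite)

sublocale PP: product_sigma_finite "\<lambda>_::nat. P {1..n}"
  by (simp add: product_sigma_finite_def P_sigma_finite)

section \<open>Recursive integration over the copies of the chain\<close>

abbreviation Q :: "nat \<Rightarrow> (nat \<Rightarrow> nat \<Rightarrow> real \<times> 'a) measure" where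
  "Q c \<equiv> PiM {..<c} (\<lambda>_. P {1..n})"

text \<open>\<open>S\<close> is arbitrary, since pairing with points of later copies may already
  have removed Gaussian factors from these copies.\<close>

definition outer_int :: "nat \<Rightarrow> (nat \<times> nat) set \<Rightarrow> ennreal" where
  "outer_int c S = (\<integral>\<^sup>+Z. ennreal ((\<Prod>d<c. chain 0 (Z d)) * moment S (pos Z)) \<partial>Q c)"

text \<open>Copies \<open>0, \<dots>, c - 1\<close> are complete, and in copy \<open>c\<close> the points \<open>1, \<dots>, k\<close> are already
  integrated out; \<open>S\<close> is the set of points at which a Gaussian factor remains.\<close>

definition inner_int :: "nat \<Rightarrow> nat \<Rightarrow> (nat \<times> nat) set \<Rightarrow> ennreal" where
  "inner_int c k S = (\<integral>\<^sup>+Z. (\<integral>\<^sup>+z. ennreal ((\<Prod>d<c. chain 0 (Z d)) * (chain k z * moment S (pos (Z(c := z))))) \<partial>P {Suc k..n}) \<partial>Q c)"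

lemma Q_component: "d < c \<Longrightarrow> i \<in> {1..n} \<Longrightarrow> (\<lambda>Z. Z d i) \<in> measurable (Q c) X"
  by (rule measurable_compose[of "\<lambda>Z. Z d" _ "P {1..n}"]) auto

lemma Q_pos: "d < c \<Longrightarrow> i \<in> {1..n} \<Longrightarrow> (\<lambda>Z. pos Z (d, i)) \<in> borel_measurable (Q c)"
  using measurable_compose[OF Q_component measurable_snd] by (simp add: pos_def)

lemma Q_chain: "(\<lambda>Z. \<Prod>d<c. chain 0 (Z d)) \<in> borel_measurable (Q c)"
proof (rule borel_measurable_prod)
  fix d assume d: "d \<in> {..<c}"
  have "chain 0 \<in> borel_measurable (P {1..n})" using chain_measurable[of 0] by simp
  from measurable_compose[OF measurable_component_singleton[OF d] this]
  show "(\<lambda>Z. chain 0 (Z d)) \<in> borel_measurable (Q c)" .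
qed

lemma joint_moment_measurable:
  assumes S: "S \<subseteq> {..<c} \<times> {1..n} \<union> {c} \<times> {Suc k..n}"
  shows "(\<lambda>(Z, z). moment S (pos (Z(c := z)))) \<in> borel_measurable (Q c \<Otimes>\<^sub>M P {Suc k..n})"
  unfolding split_beta
proof (rule moment_measurable)
  fix j assume "j \<in> S"
  then consider d i where "j = (d, i)" "d < c" "i \<in> {1..n}" | i where "j = (c, i)" "i \<in> {Suc k..n}"
    using S by auto
  then show "(\<lambda>p. pos ((fst p)(c := snd p)) j) \<in> borel_measurable (Q c \<Otimes>\<^sub>M P {Suc k..n})"
  proof cases
    case 1
    have "(\<lambda>p. pos (fst p) (d, i)) \<in> borel_measurable (Q c \<Otimes>\<^sub>M P {Suc k..n})"
      using 1 by (intro measurable_compose[OF measurable_fst] Q_pos)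
    then show ?thesis using 1 by (simp add: pos_def)
  next
    case 2
    have "(\<lambda>p. snd (snd p i)) \<in> borel_measurable (Q c \<Otimes>\<^sub>M P {Suc k..n})"
      using 2 by (intro measurable_compose[OF measurable_snd] measurable_compose[of "\<lambda>z. z i" _ X snd]) auto
    then show ?thesis using 2 by (simp add: pos_def)
  qed
qed

text \<open>If the point carries no Gaussian factor, as happens to a former partner,
  \<open>K_int\<close> suffices. Otherwise the moment is expanded at this point: each summand
  contains one covariance in \<open>y\<close>, bounded by \<open>K_Gam\<close>, and the partner, in
  this or an earlier copy, loses its factor but keeps its kernels.\<close>

lemma inner_step_pointwise:
  assumes k: "k < n" and S: "finite S" "S \<subseteq> {..<c} \<times> {1..n} \<union> {c} \<times> {Suc k..n}"
    and z: "z \<in> space (P {Suc (Suc k)..n})" and Z: "Z \<in> space (Q c)"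
  shows "(\<integral>\<^sup>+y. ennreal (chain k (z(Suc k := y)) * moment S (pos (Z(c := z(Suc k := y))))) \<partial>X) \<le>
    (if (c, Suc k) \<in> S
     then (\<Sum>j\<in>S - {(c, Suc k)}. ennreal D * ennreal (chain (Suc k) z * moment (S - {(c, Suc k)} - {j}) (pos (Z(c := z)))))
     else ennreal D * ennreal (chain (Suc k) z * moment S (pos (Z(c := z)))))"
proof -
  let ?r = "fst (node z (Suc (Suc k)))" and ?x = "snd (node z (Suc (Suc k)))"
  define R where "R = (\<Prod>i\<in>{Suc (Suc k)..n}. K (fst (node z (Suc i)) - fst (node z i)) (snd (node z (Suc i)) - snd (node z i)))"
  have R0: "R \<ge> 0" unfolding R_def by (intro prod_nonneg) (simp add: K_nonneg)
  have cS: "chain (Suc k) z = simplex_weight (Suc k) ?r * R" by (simp add: chain_def R_def)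
  have ck: "chain k (z(Suc k := y)) = simplex_weight k (fst y) * K (?r - fst y) (?x - snd y) * R" for y
    using chain_Suc[OF k] by (simp add: R_def)
  have posne: "pos (Z(c := z(Suc k := y))) j = pos (Z(c := z)) j" if "j \<noteq> (c, Suc k)" for j y
    using that by (cases j) (auto simp: pos_def)
  have poseq: "pos (Z(c := z(Suc k := y))) (c, Suc k) = snd y" for y
    by (simp add: pos_def)
  show ?thesis
  proof (cases "(c, Suc k) \<in> S")
    case False
    have "moment S (pos (Z(c := z(Suc k := y)))) = moment S (pos (Z(c := z)))" for y
      using False by (intro moment_cong posne) blast
    then have "(\<integral>\<^sup>+y. ennreal (chain k (z(Suc k := y)) * moment S (pos (Z(c := z(Suc k := y))))) \<partial>X)
      = (\<integral>\<^sup>+y. ennreal (R * moment S (pos (Z(c := z)))) *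
           (ennreal (simplex_weight k (fst y) * K (?r - fst y) (?x - snd y)) * 1) \<partial>X)"
      by (intro nn_integral_cong) (simp add: ck K_nonneg R0 moment_nonneg S(1) mult_ac flip: ennreal_mult)
    also have "\<dots> = ennreal (R * moment S (pos (Z(c := z)))) *
           (\<integral>\<^sup>+y. ennreal (simplex_weight k (fst y) * K (?r - fst y) (?x - snd y)) * 1 \<partial>X)"
      by (rule nn_integral_cmult) simp
    also have "\<dots> \<le> ennreal (R * moment S (pos (Z(c := z)))) * (ennreal D * ennreal (simplex_weight (Suc k) ?r))"
      using K_int by (intro mult_left_mono kernel_step) auto
    also have "\<dots> = ennreal D * ennreal (chain (Suc k) z * moment S (pos (Z(c := z))))"
      using D by (simp add: cS R0 moment_nonneg S(1) mult_ac flip: ennreal_mult)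
    finally show ?thesis using False by simp
  next
    case True
    define S' where "S' = S - {(c, Suc k)}"
    have S': "S = insert (c, Suc k) S'" "(c, Suc k) \<notin> S'" "finite S'" using True S by (auto simp: S'_def)
    have m: "moment S (pos (Z(c := z(Suc k := y)))) =
       (\<Sum>j\<in>S'. \<Gamma> (snd y) (pos (Z(c := z)) j) * moment (S' - {j}) (pos (Z(c := z))))" for y
    proof -
      have "moment S (pos (Z(c := z(Suc k := y)))) =
         (\<Sum>j\<in>S'. \<Gamma> (snd y) (pos (Z(c := z(Suc k := y))) j) * moment (S' - {j}) (pos (Z(c := z(Suc k := y)))))"
        unfolding S'(1) moment_insert[OF S'(3,2)] poseq ..
      also have "\<dots> = (\<Sum>j\<in>S'. \<Gamma> (snd y) (pos (Z(c := z)) j) * moment (S' - {j}) (pos (Z(c := z))))"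
        using S'(2) by (intro sum.cong refl arg_cong2[where f = "(*)"] arg_cong2[where f = \<Gamma>] moment_cong posne) auto
      finally show ?thesis .
    qed
    have "(\<integral>\<^sup>+y. ennreal (chain k (z(Suc k := y)) * moment S (pos (Z(c := z(Suc k := y))))) \<partial>X)
      = (\<integral>\<^sup>+y. (\<Sum>j\<in>S'. ennreal (R * moment (S' - {j}) (pos (Z(c := z)))) *
           (ennreal (simplex_weight k (fst y) * K (?r - fst y) (?x - snd y)) * ennreal (\<Gamma> (snd y) (pos (Z(c := z)) j)))) \<partial>X)"
    proof (rule nn_integral_cong)
      fix y
      have "chain k (z(Suc k := y)) * moment S (pos (Z(c := z(Suc k := y)))) =
        (\<Sum>j\<in>S'. (R * moment (S' - {j}) (pos (Z(c := z)))) *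
           ((simplex_weight k (fst y) * K (?r - fst y) (?x - snd y)) * \<Gamma> (snd y) (pos (Z(c := z)) j)))"
        unfolding ck m sum_distrib_left by (intro sum.cong refl) (simp add: mult_ac)
      then show "ennreal (chain k (z(Suc k := y)) * moment S (pos (Z(c := z(Suc k := y))))) =
        (\<Sum>j\<in>S'. ennreal (R * moment (S' - {j}) (pos (Z(c := z)))) *
           (ennreal (simplex_weight k (fst y) * K (?r - fst y) (?x - snd y)) * ennreal (\<Gamma> (snd y) (pos (Z(c := z)) j))))"
        using S' R0 by (simp add: K_nonneg moment_nonneg Gam_nonneg flip: ennreal_mult sum_ennreal)
    qed
    also have "\<dots> = (\<Sum>j\<in>S'. ennreal (R * moment (S' - {j}) (pos (Z(c := z)))) *
           (\<integral>\<^sup>+y. (ennreal (simplex_weight k (fst y) * K (?r - fst y) (?x - snd y)) * ennreal (\<Gamma> (snd y) (pos (Z(c := z)) j))) \<partial>X))"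
    proof -
      have [measurable]: "(\<lambda>y. \<Gamma> (snd y) q) \<in> borel_measurable X" for q
      proof -
        have "snd \<in> borel_measurable X" by simp
        from measurable_compose[OF this Gam_meas] show ?thesis .
      qed
      show ?thesis by (simp add: nn_integral_sum nn_integral_cmult)
    qed
    also have "\<dots> \<le> (\<Sum>j\<in>S'. ennreal (R * moment (S' - {j}) (pos (Z(c := z)))) * (ennreal D * ennreal (simplex_weight (Suc k) ?r)))"
      using K_Gam Gam_meas by (intro sum_mono mult_left_mono kernel_step) auto
    also have "\<dots> = (\<Sum>j\<in>S'. ennreal D * ennreal (chain (Suc k) z * moment (S' - {j}) (pos (Z(c := z)))))"
      using D S' by (intro sum.cong refl) (simp add: cS R0 moment_nonneg mult_ac flip: ennreal_mult)
    finally show ?thesis using True by (simp add: S'_def)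
  qed
qed

lemma inner_meas:
  assumes k: "k \<le> n" and S: "S \<subseteq> {..<c} \<times> {1..n} \<union> {c} \<times> {Suc k..n}"
  shows "(\<lambda>(Z, z). ennreal ((\<Prod>d<c. chain 0 (Z d)) * (chain k z * moment S (pos (Z(c := z))))))
      \<in> borel_measurable (Q c \<Otimes>\<^sub>M P {Suc k..n})"
proof -
  have "(\<lambda>p. (\<Prod>d<c. chain 0 (fst p d)) * (chain k (snd p) * (\<lambda>(Z, z). moment S (pos (Z(c := z)))) p))
      \<in> borel_measurable (Q c \<Otimes>\<^sub>M P {Suc k..n})"
    by (intro borel_measurable_times measurable_compose[OF measurable_fst Q_chain]
        measurable_compose[OF measurable_snd chain_measurable[OF k]] joint_moment_measurable[OF S])
  then show ?thesis
    unfolding split_beta by (rule measurable_compose[OF _ measurable_ennreal])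
qed

lemma moment_meas_section:
  assumes Z: "Z \<in> space (Q c)" and S: "S \<subseteq> {..<c} \<times> {1..n} \<union> {c} \<times> {Suc k..n}"
  shows "(\<lambda>z. moment S (pos (Z(c := z)))) \<in> borel_measurable (P {Suc k..n})"
  using measurable_compose[OF measurable_Pair1'[OF Z] joint_moment_measurable[OF S]] by simp

lemma inner_step:
  assumes k: "k < n" and S: "finite S" "S \<subseteq> {..<c} \<times> {1..n} \<union> {c} \<times> {Suc k..n}"
  shows "inner_int c k S \<le>
    (if (c, Suc k) \<in> S
     then (\<Sum>j\<in>S - {(c, Suc k)}. ennreal D * inner_int c (Suc k) (S - {(c, Suc k)} - {j}))
     else ennreal D * inner_int c (Suc k) S)"
proof -
  define a where "a = (c, Suc k)"
  \<comment> \<open>\<open>J\<close> and \<open>S'\<close> merge the two cases: the partners of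
    \<open>a\<close>, or a single dummy index if \<open>a\<close> is not in
    \<open>S\<close>.\<close>
  define J where "J = (if a \<in> S then S - {a} else {a})"
  define S' where "S' j = (if a \<in> S then S - {a} - {j} else S)" for j
  have J: "finite J" using S by (auto simp: J_def)
  have fS': "finite (S' j)" for j using S by (auto simp: S'_def)
  have S': "S' j \<subseteq> {..<c} \<times> {1..n} \<union> {c} \<times> {Suc (Suc k)..n}" for j
  proof -
    have "{Suc k..n} = insert (Suc k) {Suc (Suc k)..n}" using k by auto
    then have "S \<subseteq> insert a ({..<c} \<times> {1..n} \<union> {c} \<times> {Suc (Suc k)..n})"
      using S(2) by (simp add: a_def)
    moreover have "a \<notin> S' j" "S' j \<subseteq> S" by (auto simp: S'_def)
    ultimately show ?thesis by blast
  qed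
  let ?p = "\<lambda>Z. \<Prod>d<c. chain 0 (Z d)"
  have p0: "?p Z \<ge> 0" for Z by (intro prod_nonneg) simp
  have ins: "{Suc k..n} = insert (Suc k) {Suc (Suc k)..n}" using k by auto
  have pw: "(\<integral>\<^sup>+z. ennreal (?p Z * (chain k z * moment S (pos (Z(c := z))))) \<partial>P {Suc k..n})
     \<le> (\<Sum>j\<in>J. ennreal D * (\<integral>\<^sup>+z. ennreal (?p Z * (chain (Suc k) z * moment (S' j) (pos (Z(c := z))))) \<partial>P {Suc (Suc k)..n}))"
    if Z: "Z \<in> space (Q c)" for Z
  proof -
    have m1: "(\<lambda>z. chain k z * moment S (pos (Z(c := z)))) \<in> borel_measurable (P {Suc k..n})"
      using k by (intro borel_measurable_times chain_measurable moment_meas_section[OF Z S(2)]) simp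
    have m2: "(\<lambda>z. chain (Suc k) z * moment (S' j) (pos (Z(c := z)))) \<in> borel_measurable (P {Suc (Suc k)..n})" for j
      using k by (intro borel_measurable_times chain_measurable moment_meas_section[OF Z S']) simp
    have m2e: "(\<lambda>z. ennreal (chain (Suc k) z * moment (S' j) (pos (Z(c := z))))) \<in> borel_measurable (P {Suc (Suc k)..n})" for j
      by (rule measurable_compose[OF m2 measurable_ennreal])
    have e1: "(\<integral>\<^sup>+z. ennreal (?p Z * (chain k z * moment S (pos (Z(c := z))))) \<partial>P {Suc k..n})
      = ennreal (?p Z) * (\<integral>\<^sup>+z. ennreal (chain k z * moment S (pos (Z(c := z)))) \<partial>P {Suc k..n})"
      by (rule nn_integral_cmult_real[OF p0 m1])
    have "(\<integral>\<^sup>+z. ennreal (chain k z * moment S (pos (Z(c := z)))) \<partial>P {Suc k..n})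
      = (\<integral>\<^sup>+z. (\<integral>\<^sup>+y. ennreal (chain k (z(Suc k := y)) * moment S (pos (Z(c := z(Suc k := y))))) \<partial>X) \<partial>P {Suc (Suc k)..n})"
      using m1 unfolding ins by (intro PX.product_nn_integral_insert) auto
    also have "\<dots> \<le> (\<integral>\<^sup>+z. (\<Sum>j\<in>J. ennreal D * ennreal (chain (Suc k) z * moment (S' j) (pos (Z(c := z))))) \<partial>P {Suc (Suc k)..n})"
    proof (rule nn_integral_mono)
      fix z assume z: "z \<in> space (P {Suc (Suc k)..n})"
      show "(\<integral>\<^sup>+y. ennreal (chain k (z(Suc k := y)) * moment S (pos (Z(c := z(Suc k := y))))) \<partial>X)
        \<le> (\<Sum>j\<in>J. ennreal D * ennreal (chain (Suc k) z * moment (S' j) (pos (Z(c := z)))))"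
        using inner_step_pointwise[OF k S z Z] unfolding J_def S'_def a_def by (auto split: if_splits)
    qed
    also have "\<dots> = (\<Sum>j\<in>J. ennreal D * (\<integral>\<^sup>+z. ennreal (chain (Suc k) z * moment (S' j) (pos (Z(c := z)))) \<partial>P {Suc (Suc k)..n}))"
      by (rule nn_integral_sum_cmult[OF m2e])
    finally have e2: "(\<integral>\<^sup>+z. ennreal (chain k z * moment S (pos (Z(c := z)))) \<partial>P {Suc k..n})
      \<le> (\<Sum>j\<in>J. ennreal D * (\<integral>\<^sup>+z. ennreal (chain (Suc k) z * moment (S' j) (pos (Z(c := z)))) \<partial>P {Suc (Suc k)..n}))" .
    show ?thesis
      unfolding e1 nn_integral_cmult_real[OF p0 m2] mult.left_commute[of "ennreal D"] sum_distrib_left[where r = "ennreal (?p Z)", symmetric]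
      by (rule mult_left_mono[OF e2]) simp
  qed
  have m3: "(\<lambda>Z. \<integral>\<^sup>+z. ennreal (?p Z * (chain (Suc k) z * moment (S' j) (pos (Z(c := z))))) \<partial>P {Suc (Suc k)..n})
      \<in> borel_measurable (Q c)" for j
    using inner_meas[OF _ S'[of j]] k
    by (intro sigma_finite_measure.borel_measurable_nn_integral P_sigma_finite) (auto simp: split_beta)
  have "inner_int c k S \<le> (\<integral>\<^sup>+Z. (\<Sum>j\<in>J. ennreal D * (\<integral>\<^sup>+z. ennreal (?p Z * (chain (Suc k) z * moment (S' j) (pos (Z(c := z))))) \<partial>P {Suc (Suc k)..n})) \<partial>Q c)"
    unfolding inner_int_def by (rule nn_integral_mono) (rule pw)
  also have "\<dots> = (\<Sum>j\<in>J. ennreal D * inner_int c (Suc k) (S' j))"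
    unfolding inner_int_def by (rule nn_integral_sum_cmult[OF m3])
  finally show ?thesis by (auto simp: J_def S'_def a_def)
qed

definition simplex_vol :: "real" where "simplex_vol = simplex_weight n t"

text \<open>Induction on the number of points of copy \<open>c\<close> still to be integrated. Each
  costs one factor \<open>D\<close>; the sum over partners has \<open>card S'\<close> equal bounds,
  absorbed by \<open>sqrt_fact_step\<close>. At \<open>k = n\<close> only the simplex volume is left
  of this copy and \<open>outer\<close> takes over.\<close>

lemma inner_bound:
  assumes outer: "\<And>S. S \<subseteq> {..<c} \<times> {1..n} \<Longrightarrow> outer_int c S \<le> ennreal (A * sqrt (fact (card S)))"
    and A: "A \<ge> 0"
  shows "k \<le> n \<Longrightarrow> S \<subseteq> {..<c} \<times> {1..n} \<union> {c} \<times> {Suc k..n} \<Longrightarrow>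
    inner_int c k S \<le> ennreal (A * sqrt (fact (card S)) * D ^ (n - k) * simplex_vol)"
proof (induction "n - k" arbitrary: k S)
  case 0
  then have k: "k = n" by simp
  then have S: "S \<subseteq> {..<c} \<times> {1..n}" using 0 by auto
  have fS: "finite S" using S finite_subset by blast
  have "moment S (pos (Z(c := z))) = moment S (pos Z)" for Z z
    using S by (intro moment_cong) (auto simp: pos_def)
  moreover have "chain n z = simplex_vol" for z by (simp add: chain_def node_def simplex_vol_def)
  ultimately have "inner_int c k S = (\<integral>\<^sup>+Z. ennreal simplex_vol * ennreal ((\<Prod>d<c. chain 0 (Z d)) * moment S (pos Z)) \<partial>Q c)"
    unfolding inner_int_def k using PX.nn_integral_empty[of "\<lambda>_. 1"]
    by (simp add: simplex_vol_def moment_nonneg fS prod_nonneg mult_ac flip: ennreal_mult)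
  also have "\<dots> = ennreal simplex_vol * outer_int c S"
    unfolding outer_int_def
  proof (rule nn_integral_cmult)
    have "(\<lambda>Z. (\<Prod>d<c. chain 0 (Z d)) * moment S (pos Z)) \<in> borel_measurable (Q c)"
      using S Q_pos by (intro borel_measurable_times Q_chain moment_measurable) auto
    then show "(\<lambda>Z. ennreal ((\<Prod>d<c. chain 0 (Z d)) * moment S (pos Z))) \<in> borel_measurable (Q c)"
      by measurable
  qed
  also have "\<dots> \<le> ennreal simplex_vol * ennreal (A * sqrt (fact (card S)))"
    by (intro mult_left_mono outer S) simp
  also have "\<dots> = ennreal (A * sqrt (fact (card S)) * D ^ (n - k) * simplex_vol)"
    using A by (simp add: k simplex_vol_def mult_ac flip: ennreal_mult)
  finally show ?case .
next
  case (Suc m)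
  have k: "k < n" using Suc by simp
  have fS: "finite S" using finite_subset[OF Suc.prems(2)] by simp
  have IH: "inner_int c (Suc k) S' \<le> ennreal (A * sqrt (fact (card S')) * D ^ (n - Suc k) * simplex_vol)"
    if "S' \<subseteq> S" "(c, Suc k) \<notin> S'" for S'
  proof (rule Suc.hyps)
    show "S' \<subseteq> {..<c} \<times> {1..n} \<union> {c} \<times> {Suc (Suc k)..n}"
    proof -
      have "{Suc k..n} = insert (Suc k) {Suc (Suc k)..n}" using k by auto
      then have "S \<subseteq> insert (c, Suc k) ({..<c} \<times> {1..n} \<union> {c} \<times> {Suc (Suc k)..n})"
        using Suc.prems(2) by simp
      then show ?thesis using that by blast
    qed
  qed (use Suc in auto)
  have tot: "simplex_vol \<ge> 0" by (simp add: simplex_vol_def)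
  have Dk: "D * D ^ (n - Suc k) = D ^ (n - k)" using k by (simp flip: power_Suc add: Suc_diff_Suc)
  show ?case
  proof (cases "(c, Suc k) \<in> S")
    case False
    have "inner_int c k S \<le> ennreal D * inner_int c (Suc k) S"
      using inner_step[OF k fS Suc.prems(2)] False by simp
    also have "\<dots> \<le> ennreal D * ennreal (A * sqrt (fact (card S)) * D ^ (n - Suc k) * simplex_vol)"
      using False by (intro mult_left_mono IH) auto
    also have "\<dots> = ennreal (D * (A * sqrt (fact (card S)) * D ^ (n - Suc k) * simplex_vol))"
      using D by (simp add: ennreal_mult')
    also have "D * (A * sqrt (fact (card S)) * D ^ (n - Suc k) * simplex_vol) = A * sqrt (fact (card S)) * D ^ (n - k) * simplex_vol"
      unfolding Dk[symmetric] by (simp add: mult_ac)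
    finally show ?thesis .
  next
    case True
    define S' where "S' = S - {(c, Suc k)}"
    have S': "finite S'" "card S = Suc (card S')" using fS card.remove[OF fS True]
      by (simp_all add: S'_def)
    have "inner_int c k S \<le> (\<Sum>j\<in>S'. ennreal D * inner_int c (Suc k) (S' - {j}))"
      using inner_step[OF k fS Suc.prems(2)] True by (simp add: S'_def)
    also have "\<dots> \<le> (\<Sum>j\<in>S'. ennreal D * ennreal (A * sqrt (fact (card (S' - {j}))) * D ^ (n - Suc k) * simplex_vol))"
      by (intro sum_mono mult_left_mono IH) (auto simp: S'_def)
    also have "\<dots> = (\<Sum>j\<in>S'. ennreal (A * sqrt (fact (card S' - 1)) * D ^ (n - k) * simplex_vol))"
    proof (intro sum.cong refl)
      fix j assume j: "j \<in> S'"
      have "ennreal D * ennreal (A * sqrt (fact (card (S' - {j}))) * D ^ (n - Suc k) * simplex_vol)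
        = ennreal (D * (A * sqrt (fact (card S' - 1)) * D ^ (n - Suc k) * simplex_vol))"
        using D S' j by (simp add: ennreal_mult')
      also have "D * (A * sqrt (fact (card S' - 1)) * D ^ (n - Suc k) * simplex_vol) = A * sqrt (fact (card S' - 1)) * D ^ (n - k) * simplex_vol"
        unfolding Dk[symmetric] by (simp add: mult_ac)
      finally show "ennreal D * ennreal (A * sqrt (fact (card (S' - {j}))) * D ^ (n - Suc k) * simplex_vol)
        = ennreal (A * sqrt (fact (card S' - 1)) * D ^ (n - k) * simplex_vol)" .
    qed
    also have "\<dots> = ennreal (real (card S') * (A * sqrt (fact (card S' - 1)) * D ^ (n - k) * simplex_vol))"
      by (simp add: ennreal_mult' ennreal_of_nat_eq_real_of_nat)
    also have "\<dots> \<le> ennreal (A * sqrt (fact (card S)) * D ^ (n - k) * simplex_vol)"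
    proof (rule ennreal_leI)
      \<comment> \<open>Without partners the left side is 0, a case that
        \<open>sqrt_fact_step\<close> excludes.\<close>
      have "real (card S') * sqrt (fact (card S' - 1)) \<le> sqrt (fact (card S))"
        unfolding S'(2) by (cases "card S' = 0") (simp, rule sqrt_fact_step, simp)
      then have "A * D ^ (n - k) * simplex_vol * (real (card S') * sqrt (fact (card S' - 1))) \<le> A * D ^ (n - k) * simplex_vol * sqrt (fact (card S))"
        using A D tot by (intro mult_left_mono) auto
      then show "real (card S') * (A * sqrt (fact (card S' - 1)) * D ^ (n - k) * simplex_vol) \<le> A * sqrt (fact (card S)) * D ^ (n - k) * simplex_vol"
        by (simp add: mult_ac)
    qed
    finally show ?thesis .
  qed
qed

text \<open>The last copy is integrated first. Every copy yields a factor
  \<open>D ^ n * simplex_vol\<close>, whereas the pairing count couples the copies and is therefore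
  kept as one factor in \<open>card S\<close>.\<close>

lemma outer_bound:
  "S \<subseteq> {..<c} \<times> {1..n} \<Longrightarrow> outer_int c S \<le> ennreal ((D ^ n * simplex_vol) ^ c * sqrt (fact (card S)))"
proof (induction c arbitrary: S)
  case 0
  then have "S = {}" by auto
  then show ?case
    unfolding outer_int_def using PP.nn_integral_empty[of "\<lambda>_. 1"] by (simp add: moment_empty)
next
  case (Suc c)
  have S: "S \<subseteq> {..<c} \<times> {1..n} \<union> {c} \<times> {Suc 0..n}"
    using Suc.prems by (auto simp: less_Suc_eq)
  have tot: "simplex_vol \<ge> 0" by (simp add: simplex_vol_def)
  have m: "(\<lambda>Z. (\<Prod>d<Suc c. chain 0 (Z d)) * moment S (pos Z)) \<in> borel_measurable (Q (Suc c))"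
    using Suc.prems Q_pos by (intro borel_measurable_times Q_chain moment_measurable) auto
  have "outer_int (Suc c) S = (\<integral>\<^sup>+Z. (\<integral>\<^sup>+z. ennreal ((\<Prod>d<Suc c. chain 0 ((Z(c := z)) d)) * moment S (pos (Z(c := z)))) \<partial>P {1..n}) \<partial>Q c)"
    using m unfolding outer_int_def lessThan_Suc by (intro PP.product_nn_integral_insert) auto
  also have "\<dots> = inner_int c 0 S"
    unfolding inner_int_def by (intro nn_integral_cong) (simp add: mult_ac)
  also have "\<dots> \<le> ennreal ((D ^ n * simplex_vol) ^ c * sqrt (fact (card S)) * D ^ (n - 0) * simplex_vol)"
    using D tot by (intro inner_bound Suc.IH S) auto
  also have "\<dots> = ennreal ((D ^ n * simplex_vol) ^ Suc c * sqrt (fact (card S)))"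
    by (simp add: mult_ac)
  finally show ?case .
qed

section \<open>From the recursion to even moments\<close>

text \<open>A Bochner integral, hence 0 by convention wherever the integrand is not integrable; its
  power is therefore expanded only for almost every \<omega>.\<close>

definition chain_integral :: "'w \<Rightarrow> real" where
  "chain_integral \<omega> = (\<integral>z. chain 0 z * (\<Prod>i\<in>{1..n}. V (snd (z i)) \<omega>) \<partial>P {1..n})"

lemma chain_integrand_measurable:
  "(\<lambda>p. chain 0 (fst p) * (\<Prod>i\<in>{1..n}. V (snd (fst p i)) (snd p))) \<in> borel_measurable (P {1..n} \<Otimes>\<^sub>M M)"
proof (intro borel_measurable_times borel_measurable_prod V_meas2 measurable_snd)
  show "(\<lambda>p. chain 0 (fst p)) \<in> borel_measurable (P {1..n} \<Otimes>\<^sub>M M)"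
    using measurable_compose[OF measurable_fst chain_measurable[of 0]] by simp
  show "(\<lambda>p. snd (fst p i)) \<in> borel_measurable (P {1..n} \<Otimes>\<^sub>M M)" if "i \<in> {1..n}" for i
  proof -
    have "(\<lambda>z. z i) \<in> P {1..n} \<rightarrow>\<^sub>M X" using that by (rule measurable_component_singleton)
    then have "(\<lambda>z. snd (z i)) \<in> P {1..n} \<rightarrow>\<^sub>M lborel" by (rule measurable_compose) (rule measurable_snd)
    then have "(\<lambda>z. snd (z i)) \<in> borel_measurable (P {1..n})" by simp
    then show ?thesis by (rule measurable_compose[OF measurable_fst])
  qed
qed

lemma chain_integral_measurable: "chain_integral \<in> borel_measurable M"
proof -
  have sf: "sigma_finite_measure (P {1..n})" by (rule P_sigma_finite) simp
  have "(\<lambda>(\<omega>, z). chain 0 z * (\<Prod>i\<in>{1..n}. V (snd (z i)) \<omega>)) \<in> borel_measurable (M \<Otimes>\<^sub>M P {1..n})"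
    using measurable_compose[OF measurable_pair_swap' chain_integrand_measurable] by (simp add: split_beta)
  from sigma_finite_measure.borel_measurable_lebesgue_integral[OF sf this] show ?thesis
    unfolding chain_integral_def[abs_def] .
qed

lemma Q_sigma_finite: "sigma_finite_measure (Q c)"
  by (rule PP.sigma_finite) simp

text \<open>Evenness makes the power nonnegative. It is an integral over \<open>q\<close> copies;
  Fubini moves the expectation inside and leaves the nonnegative integrand of
  \<open>outer_int\<close> for the full set of points.\<close>

lemma chain_integral_moment:
  assumes q: "even q" "q > 0"
  shows "(\<integral>\<^sup>+\<omega>. ennreal (chain_integral \<omega> ^ q) \<partial>M) \<le> ennreal ((D ^ n * simplex_vol) ^ q * sqrt (fact (q * n)))"
proof -
  interpret Qq: sigma_finite_measure "Q q" by (rule Q_sigma_finite)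
  interpret QM: pair_sigma_finite "Q q" M ..
  define S where "S = {..<q} \<times> {1..n}"
  have S: "finite S" "S \<subseteq> {..<q} \<times> {1..n}" "card S = q * n" by (auto simp: S_def card_cartesian_product)
  define f where "f \<omega> z = chain 0 z * (\<Prod>i\<in>{1..n}. V (snd (z i)) \<omega>)" for \<omega> z
  define p where "p Z = (\<Prod>d<q. chain 0 (Z d))" for Z
  define F where "F Z \<omega> = (\<Prod>d<q. f \<omega> (Z d))" for Z \<omega>
  have p0: "p Z \<ge> 0" for Z unfolding p_def by (intro prod_nonneg) simp
  have F_eq: "F Z \<omega> = p Z * (\<Prod>j\<in>S. V (pos Z j) \<omega>)" for Z \<omega>
  proof -
    have "(\<Prod>d<q. \<Prod>i\<in>{1..n}. V (snd (Z d i)) \<omega>) = (\<Prod>j\<in>S. V (pos Z j) \<omega>)"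
      unfolding S_def pos_def by (subst prod.cartesian_product) (simp add: split_beta)
    then show ?thesis unfolding F_def f_def p_def prod.distrib by simp
  qed
  have V_pos: "(\<lambda>x. V (pos (fst x) j) (snd x)) \<in> borel_measurable (Q q \<Otimes>\<^sub>M M)" if "j \<in> S" for j
  proof -
    obtain d i where j: "j = (d, i)" "d < q" "i \<in> {1..n}" using \<open>j \<in> S\<close> by (auto simp: S_def)
    show ?thesis unfolding j(1)
      by (rule V_meas2[OF measurable_compose[OF measurable_fst Q_pos[OF j(2,3)]] measurable_snd])
  qed
  have p_meas: "p \<in> borel_measurable (Q q)" unfolding p_def[abs_def] by (rule Q_chain)
  have F_meas: "(\<lambda>x. F (fst x) (snd x)) \<in> borel_measurable (Q q \<Otimes>\<^sub>M M)"
    unfolding F_eq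
    by (intro borel_measurable_times borel_measurable_prod V_pos measurable_compose[OF measurable_fst p_meas])
  have f_meas: "f \<omega> \<in> borel_measurable (P {1..n})" if "\<omega> \<in> space M" for \<omega>
    using measurable_compose[OF measurable_Pair2'[OF that] chain_integrand_measurable] by (simp add: f_def[abs_def])
  have p_int: "(\<integral>\<^sup>+Z. ennreal (p Z) \<partial>Q q) < \<infinity>"
  proof -
    have "(\<integral>\<^sup>+Z. ennreal (p Z) \<partial>Q q) = outer_int q {}"
      by (simp add: outer_int_def moment_empty p_def)
    also have "\<dots> \<le> ennreal ((D ^ n * simplex_vol) ^ q * sqrt (fact (card ({} :: (nat \<times> nat) set))))"
      by (rule outer_bound) simp
    finally show ?thesis by (simp add: le_less_trans)
  qed
  \<comment> \<open>This finite constant, built from \<open>B\<close>, makes the integrand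
    integrable jointly in the points and \<omega>; it does not reach the final bound.\<close>
  define A where "A = ennreal (1 + card S * (sqrt B ^ card S * abs_normal_moment (card S)))"
  have abs_le: "(\<integral>\<^sup>+\<omega>. ennreal (norm (F Z \<omega>)) \<partial>M) \<le> A * ennreal (p Z)" for Z
  proof -
    interpret gf: gaussian_family M "\<lambda>i. V (pos Z i)" "\<lambda>i j. \<Gamma> (pos Z i) (pos Z j)" by (rule gaussian)
    have m: "(\<lambda>\<omega>. \<Prod>j\<in>S. \<bar>V (pos Z j) \<omega>\<bar>) \<in> borel_measurable M"
      by (intro borel_measurable_prod borel_measurable_abs gf.X_meas)
    have "(\<integral>\<^sup>+\<omega>. ennreal (norm (F Z \<omega>)) \<partial>M) = (\<integral>\<^sup>+\<omega>. ennreal (p Z * (\<Prod>j\<in>S. \<bar>V (pos Z j) \<omega>\<bar>)) \<partial>M)"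
      unfolding F_eq using p0 by (simp add: abs_mult abs_prod)
    also have "\<dots> = ennreal (p Z) * (\<integral>\<^sup>+\<omega>. ennreal (\<Prod>j\<in>S. \<bar>V (pos Z j) \<omega>\<bar>) \<partial>M)"
      by (rule nn_integral_cmult_real[OF p0 m])
    also have "\<dots> \<le> ennreal (p Z) * A"
      unfolding A_def using Gam_le by (intro mult_left_mono gf.expectation_abs_prod_le S) auto
    finally show ?thesis by (simp add: mult.commute)
  qed
  have F_int: "integrable (Q q \<Otimes>\<^sub>M M) (\<lambda>x. F (fst x) (snd x))"
  proof (rule integrableI_bounded[OF F_meas])
    have nm: "(\<lambda>x. ennreal (norm (F (fst x) (snd x)))) \<in> borel_measurable (Q q \<Otimes>\<^sub>M M)"
      by (rule measurable_compose[OF measurable_compose[OF F_meas borel_measurable_norm] measurable_ennreal])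
    have "(\<integral>\<^sup>+x. ennreal (norm (F (fst x) (snd x))) \<partial>(Q q \<Otimes>\<^sub>M M)) = (\<integral>\<^sup>+Z. \<integral>\<^sup>+\<omega>. ennreal (norm (F Z \<omega>)) \<partial>M \<partial>Q q)"
      using nn_integral_fst[OF nm] by simp
    also have "\<dots> \<le> (\<integral>\<^sup>+Z. A * ennreal (p Z) \<partial>Q q)"
      by (intro nn_integral_mono abs_le)
    also have "\<dots> = A * (\<integral>\<^sup>+Z. ennreal (p Z) \<partial>Q q)"
      by (rule nn_integral_cmult) (rule measurable_compose[OF p_meas measurable_ennreal])
    also have "\<dots> < \<infinity>" using p_int by (auto simp: A_def ennreal_mult_less_top)
    finally show "(\<integral>\<^sup>+x. ennreal (norm (F (fst x) (snd x))) \<partial>(Q q \<Otimes>\<^sub>M M)) < \<infinity>" .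
  qed
  then have F_int': "integrable (Q q \<Otimes>\<^sub>M M) (case_prod F)" by (simp add: case_prod_beta')
  \<comment> \<open>For almost every \<omega> the product over the copies is integrable. The
    integral of its norm is the \<open>q\<close>-th power of that of one copy, and
    \<open>q > 0\<close> forces the latter to be finite, so the product integral splits.\<close>
  have pow: "AE \<omega> in M. chain_integral \<omega> ^ q = (\<integral>Z. F Z \<omega> \<partial>Q q)"
    using QM.AE_integrable_snd[OF F_int'] AE_space
  proof eventually_elim
    case (elim \<omega>)
    have "(\<integral>\<^sup>+Z. ennreal (norm (F Z \<omega>)) \<partial>Q q) = (\<integral>\<^sup>+Z. (\<Prod>d<q. ennreal (norm (f \<omega> (Z d)))) \<partial>Q q)"
      by (simp add: F_def abs_prod prod_ennreal)
    also have "\<dots> = (\<Prod>d<q. \<integral>\<^sup>+z. ennreal (norm (f \<omega> z)) \<partial>P {1..n})"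
      using f_meas[OF elim(2)] by (intro PP.product_nn_integral_prod) auto
    also have "\<dots> = (\<integral>\<^sup>+z. ennreal (norm (f \<omega> z)) \<partial>P {1..n}) ^ q" by simp
    finally have "(\<integral>\<^sup>+z. ennreal (norm (f \<omega> z)) \<partial>P {1..n}) ^ q < \<infinity>"
      using elim(1) by (simp add: integrable_iff_bounded)
    then have "(\<integral>\<^sup>+z. ennreal (norm (f \<omega> z)) \<partial>P {1..n}) < \<infinity>"
      using q by (simp add: power_eq_top_ennreal less_top[symmetric])
    then have "integrable (P {1..n}) (f \<omega>)"
      using f_meas[OF elim(2)] by (intro integrableI_bounded)
    then have "(\<integral>Z. F Z \<omega> \<partial>Q q) = (\<Prod>d<q. \<integral>z. f \<omega> z \<partial>P {1..n})"
      unfolding F_def by (intro PP.product_integral_prod) auto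
    then show ?case by (simp add: chain_integral_def f_def)
  qed
  have Fmom: "(\<integral>\<omega>. F Z \<omega> \<partial>M) = p Z * moment S (pos Z)" for Z
    unfolding F_eq moment_def by (rule integral_mult_right_zero)
  have "(\<integral>\<^sup>+\<omega>. ennreal (chain_integral \<omega> ^ q) \<partial>M) = ennreal (\<integral>\<omega>. chain_integral \<omega> ^ q \<partial>M)"
  proof (rule nn_integral_eq_integral)
    have "integrable M (\<lambda>\<omega>. \<integral>Z. F Z \<omega> \<partial>Q q)" by (rule QM.integrable_snd[OF F_int'])
    then show "integrable M (\<lambda>\<omega>. chain_integral \<omega> ^ q)"
      by (rule integrable_cong_AE_imp)
        (use pow chain_integral_measurable in \<open>auto intro!: borel_measurable_power elim: eventually_mono\<close>)
  qed (use q in auto)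
  also have "(\<integral>\<omega>. chain_integral \<omega> ^ q \<partial>M) = (\<integral>\<omega>. (\<integral>Z. F Z \<omega> \<partial>Q q) \<partial>M)"
    using pow chain_integral_measurable QM.integrable_snd[OF F_int']
    by (intro integral_cong_AE) (auto intro!: borel_measurable_power)
  also have "\<dots> = (\<integral>Z. (\<integral>\<omega>. F Z \<omega> \<partial>M) \<partial>Q q)"
    by (rule QM.Fubini_integral[OF F_int'])
  also have "\<dots> = (\<integral>Z. p Z * moment S (pos Z) \<partial>Q q)" unfolding Fmom ..
  also have "ennreal \<dots> \<le> outer_int q S"
  proof -
    have i: "integrable (Q q) (\<lambda>Z. p Z * moment S (pos Z))"
      using QM.integrable_fst[OF F_int'] unfolding Fmom .
    have "(\<integral>\<^sup>+Z. ennreal (p Z * moment S (pos Z)) \<partial>Q q) = ennreal (\<integral>Z. p Z * moment S (pos Z) \<partial>Q q)"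
      by (rule nn_integral_eq_integral[OF i]) (simp add: p0 moment_nonneg S)
    then show ?thesis by (simp add: outer_int_def p_def)
  qed
  also have "\<dots> \<le> ennreal ((D ^ n * simplex_vol) ^ q * sqrt (fact (card S)))"
    by (rule outer_bound[OF S(2)])
  finally show ?thesis by (simp add: S)
qed

end

section \<open>The planar wave kernel\<close>

definition inv_sqrt_pos :: "real \<Rightarrow> real" where
  "inv_sqrt_pos s = (if 0 < s then 1 / sqrt s else 0)"

lemma inv_sqrt_pos_nonneg [simp]: "inv_sqrt_pos s \<ge> 0"
  by (simp add: inv_sqrt_pos_def)

lemma inv_sqrt_pos_measurable [measurable]: "inv_sqrt_pos \<in> borel_measurable borel"
  unfolding inv_sqrt_pos_def[abs_def] by measurable

text \<open>The primitive arcsin (u / sqrt A) runs from - pi/2 to pi/2, and sqrt A cancels in this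
  scaling, so the value is the same for all positive \<open>A\<close>. The singular endpoints enter
  through one-sided limits of the primitive.\<close>

lemma nn_integral_inv_sqrt_pos:
  "(\<integral>\<^sup>+u. ennreal (inv_sqrt_pos (A - u\<^sup>2)) \<partial>lborel) = (if A > 0 then ennreal pi else 0)"
proof (cases "A > 0")
  case True
  define r where "r = sqrt A"
  have r: "r > 0" "A = r\<^sup>2" using True by (auto simp: r_def)
  have iff: "0 < A - u\<^sup>2 \<longleftrightarrow> - r < u \<and> u < r" for u
    using r abs_square_less_1[of "u / r"] by (simp add: power_divide field_simps abs_less_iff) (auto simp: field_simps)
  have D: "((\<lambda>u. arcsin (u / r)) has_real_derivative inv_sqrt_pos (A - u\<^sup>2)) (at u)" if "- r < u" "u < r" for u
  proof -
    have 1: "- 1 < u / r" "u / r < 1" using that r by (auto simp: field_simps)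
    have "((\<lambda>u. arcsin (u / r)) has_real_derivative inverse (sqrt (1 - (u / r)\<^sup>2)) * (1 / r)) (at u)"
      by (rule DERIV_chain2[where f = arcsin and g = "\<lambda>u. u / r", OF DERIV_arcsin[OF 1]])
        (use r in \<open>auto intro!: derivative_eq_intros\<close>)
    moreover have "inverse (sqrt (1 - (u / r)\<^sup>2)) * (1 / r) = inv_sqrt_pos (A - u\<^sup>2)"
    proof -
      have "sqrt (A - u\<^sup>2) = r * sqrt (1 - (u / r)\<^sup>2)"
      proof -
        have "A - u\<^sup>2 = r\<^sup>2 * (1 - (u / r)\<^sup>2)" using r by (simp add: power_divide field_simps)
        then show ?thesis using r by (simp add: real_sqrt_mult)
      qed
      then show ?thesis using that iff[of u] by (simp add: inv_sqrt_pos_def divide_inverse)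
    qed
    ultimately show ?thesis by simp
  qed
  have C: "isCont (\<lambda>u. inv_sqrt_pos (A - u\<^sup>2)) u" if "- r < u" "u < r" for u
  proof -
    have "isCont (\<lambda>u. 1 / sqrt (A - u\<^sup>2)) u"
      using that iff[of u] by (intro continuous_intros) auto
    moreover have "\<forall>\<^sub>F v in nhds u. inv_sqrt_pos (A - v\<^sup>2) = 1 / sqrt (A - v\<^sup>2)"
      unfolding eventually_nhds using that iff by (intro exI[of _ "{- r<..<r}"]) (auto simp: inv_sqrt_pos_def)
    ultimately show ?thesis by (simp add: isCont_cong)
  qed
  have lim: "((\<lambda>u. arcsin (u / r)) \<longlongrightarrow> arcsin (l / r)) (at l within {-r..r})" if "l \<in> {-r..r}" for l
  proof -
    have "continuous_on {-r..r} (\<lambda>u. arcsin (u / r))"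
      using r by (intro continuous_intros) (auto simp: field_simps)
    then show ?thesis using that by (auto simp: continuous_on_def)
  qed
  have at_r: "at_right (- r) = at (- r) within {-r..r}" "at_left r = at r within {-r..r}"
    using r by (auto simp: at_within_Icc_at_right at_within_Icc_at_left)
  have A: "(((\<lambda>u. arcsin (u / r)) \<circ> real_of_ereal) \<longlongrightarrow> - (pi / 2)) (at_right (ereal (- r)))"
    unfolding at_right_ereal using lim[of "-r"] r
    by (simp add: filterlim_def filtermap_filtermap comp_def at_r del: uminus_ereal.simps)
  have B: "(((\<lambda>u. arcsin (u / r)) \<circ> real_of_ereal) \<longlongrightarrow> pi / 2) (at_left (ereal r))"
    unfolding at_left_ereal using lim[of r] r
    by (simp add: filterlim_def filtermap_filtermap comp_def at_r)
  have FTC: "set_integrable lborel (einterval (ereal (- r)) (ereal r)) (\<lambda>u. inv_sqrt_pos (A - u\<^sup>2))"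
    "(LBINT u=ereal (- r)..ereal r. inv_sqrt_pos (A - u\<^sup>2)) = pi / 2 - (- (pi / 2))"
    using r D C A B by (intro interval_integral_FTC_nonneg[where F = "\<lambda>u. arcsin (u / r)"]; simp)+
  have ei: "einterval (ereal (- r)) (ereal r) = {- r<..<r}" by (auto simp: einterval_def)
  have eq: "indicator {- r<..<r} u *\<^sub>R inv_sqrt_pos (A - u\<^sup>2) = inv_sqrt_pos (A - u\<^sup>2)" for u
    using iff[of u] by (auto simp: indicator_def inv_sqrt_pos_def)
  have int: "integrable lborel (\<lambda>u. inv_sqrt_pos (A - u\<^sup>2))"
    using FTC(1) unfolding set_integrable_def ei eq .
  have "(\<integral>u. inv_sqrt_pos (A - u\<^sup>2) \<partial>lborel) = pi"
    using FTC(2) r unfolding interval_lebesgue_integral_def set_lebesgue_integral_def ei eq by simp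
  then show ?thesis using True nn_integral_eq_integral[OF int] by simp
next
  case False
  then have "inv_sqrt_pos (A - u\<^sup>2) = 0" for u
  proof -
    have "A - u\<^sup>2 \<le> 0" using \<open>\<not> A > 0\<close> zero_le_power2[of u] by linarith
    then show ?thesis by (simp add: inv_sqrt_pos_def)
  qed
  then show ?thesis using False by simp
qed

text \<open>Completing the square in \<open>q\<close>: with vertex \<open>q0\<close> and scale
  \<open>1 / s\<close> the substitution gives the unsheared integral with \<open>A\<close> in place
  of \<open>t\<^sup>2\<close>.\<close>

lemma nn_integral_inv_sqrt_pos_sheared:
  "(\<integral>\<^sup>+q. ennreal (inv_sqrt_pos (t\<^sup>2 - (a - c * q)\<^sup>2 - q\<^sup>2)) \<partial>lborel) =
     ennreal (pi / sqrt (1 + c\<^sup>2)) * indicator {a. a\<^sup>2 < t\<^sup>2 * (1 + c\<^sup>2)} a"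
proof -
  define s where "s = sqrt (1 + c\<^sup>2)"
  have s: "s > 0" "s\<^sup>2 = 1 + c\<^sup>2" unfolding s_def by (auto simp: add_pos_nonneg)
  define q0 where "q0 = c * a / s\<^sup>2"
  define A where "A = t\<^sup>2 - a\<^sup>2 / s\<^sup>2"
  have eq: "t\<^sup>2 - (a - c * (q0 + 1 / s * u))\<^sup>2 - (q0 + 1 / s * u)\<^sup>2 = A - u\<^sup>2" for u
  proof -
    have "(a - c * (q0 + 1 / s * u))\<^sup>2 + (q0 + 1 / s * u)\<^sup>2
      = a\<^sup>2 - 2 * a * c * (q0 + u / s) + (1 + c\<^sup>2) * (q0 + u / s)\<^sup>2"
      by (simp add: power2_eq_square algebra_simps add_divide_distrib)
    also have "\<dots> = a\<^sup>2 - 2 * a * c * (q0 + u / s) + s\<^sup>2 * (q0 + u / s)\<^sup>2" by (simp add: s)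
    also have "\<dots> = a\<^sup>2 - (c * a)\<^sup>2 / s\<^sup>2 + u\<^sup>2"
      using s(1) by (simp add: q0_def field_simps power2_eq_square)
    also have "\<dots> = (s\<^sup>2 - c\<^sup>2) * a\<^sup>2 / s\<^sup>2 + u\<^sup>2"
      using s(1) by (simp add: field_simps power2_eq_square)
    also have "\<dots> = a\<^sup>2 / s\<^sup>2 + u\<^sup>2" by (simp add: s)
    finally show ?thesis by (simp add: A_def)
  qed
  have "(\<integral>\<^sup>+q. ennreal (inv_sqrt_pos (t\<^sup>2 - (a - c * q)\<^sup>2 - q\<^sup>2)) \<partial>lborel)
     = \<bar>1 / s\<bar> * (\<integral>\<^sup>+u. ennreal (inv_sqrt_pos (A - u\<^sup>2)) \<partial>lborel)"
  proof -
    have m: "(\<lambda>q. ennreal (inv_sqrt_pos (t\<^sup>2 - (a - c * q)\<^sup>2 - q\<^sup>2))) \<in> borel_measurable borel" by measurable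
    have "1 / s \<noteq> 0" using s(1) by simp
    from nn_integral_real_affine[OF m this, of q0] show ?thesis unfolding eq .
  qed
  also have "\<dots> = ennreal (1 / s) * (if A > 0 then ennreal pi else 0)"
    using s by (simp add: nn_integral_inv_sqrt_pos)
  also have "A > 0 \<longleftrightarrow> a\<^sup>2 < t\<^sup>2 * (1 + c\<^sup>2)"
    using s(1) unfolding A_def s(2)[symmetric] by (simp add: field_simps)
  finally show ?thesis
    using s by (simp add: indicator_def s_def[symmetric] flip: ennreal_mult)
qed

text \<open>The primitive has modulus 1 / |k| everywhere, so oscillation controls the integral
  however long the interval is.\<close>

lemma norm_integral_cis_le:
  assumes "k \<noteq> 0" "L \<ge> 0"
  shows "norm (CLINT a|lborel. indicator {-L..L} a *\<^sub>R cis (- (k * a))) \<le> 2 / \<bar>k\<bar>"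
proof -
  define F where "F a = cis (- (k * a)) * (\<i> / of_real k)" for a
  have "(CLINT a|lborel. indicator {-L..L} a *\<^sub>R cis (- (k * a))) = F L - F (- L)"
  proof (rule integral_FTC_Icc)
    show "(F has_vector_derivative cis (- (k * x))) (at x within {-L..L})" for x
      unfolding F_def has_vector_derivative_def using assms(1)
      by (auto intro!: derivative_eq_intros simp: field_simps scaleR_conv_of_real)
    show "continuous_on {-L..L} (\<lambda>x. cis (- (k * x)))" by (intro continuous_intros continuous_on_cis)
  qed (use assms in simp)
  also have "norm \<dots> \<le> norm (F L) + norm (F (- L))" by (rule norm_triangle_ineq4)
  also have "\<dots> = 2 / \<bar>k\<bar>" by (simp add: F_def norm_mult norm_divide)
  finally show ?thesis .
qed

text \<open>The two-dimensional kernel in coordinates, with the indicator of the light cone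
  contained in \<open>inv_sqrt_pos\<close>. It depends on \<open>t\<close> only through its square,
  so it is compared with \<open>G\<close> for \<open>t > 0\<close> only.\<close>

definition wave_plane :: "real \<Rightarrow> real \<Rightarrow> real \<Rightarrow> real" where
  "wave_plane t p q = inv_sqrt_pos (t\<^sup>2 - p\<^sup>2 - q\<^sup>2) / (2 * pi)"

lemma wave_plane_nonneg [simp]: "wave_plane t p q \<ge> 0"
  by (simp add: wave_plane_def)

lemma wave_plane_measurable [measurable]: "(\<lambda>x. wave_plane t (f x) (g x)) \<in> borel_measurable N"
  if [measurable]: "f \<in> borel_measurable N" "g \<in> borel_measurable N"
  unfolding wave_plane_def by measurable

text \<open>Hadamard descent along an arbitrary direction: the shear \<open>p = a - c q\<close> turns the
  marginal of the two-dimensional kernel into a multiple of the one-dimensional one.\<close>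

lemma wave_plane_descent:
  "(\<integral>\<^sup>+q. ennreal (wave_plane t (a - c * q) q) \<partial>lborel) =
     ennreal (1 / (2 * sqrt (1 + c\<^sup>2))) * indicator {a. a\<^sup>2 < t\<^sup>2 * (1 + c\<^sup>2)} a"
proof -
  have "(\<integral>\<^sup>+q. ennreal (wave_plane t (a - c * q) q) \<partial>lborel) =
     (\<integral>\<^sup>+q. ennreal (1 / (2 * pi)) * ennreal (inv_sqrt_pos (t\<^sup>2 - (a - c * q)\<^sup>2 - q\<^sup>2)) \<partial>lborel)"
    by (simp add: wave_plane_def flip: ennreal_mult)
  also have "\<dots> = ennreal (1 / (2 * pi)) * (\<integral>\<^sup>+q. ennreal (inv_sqrt_pos (t\<^sup>2 - (a - c * q)\<^sup>2 - q\<^sup>2)) \<partial>lborel)"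
    by (rule nn_integral_cmult) measurable
  also have "\<dots> = ennreal (1 / (2 * pi)) * ennreal (pi / sqrt (1 + c\<^sup>2)) * indicator {a. a\<^sup>2 < t\<^sup>2 * (1 + c\<^sup>2)} a"
    by (simp add: nn_integral_inv_sqrt_pos_sheared mult.assoc)
  also have "ennreal (1 / (2 * pi)) * ennreal (pi / sqrt (1 + c\<^sup>2)) = ennreal (1 / (2 * sqrt (1 + c\<^sup>2)))"
    by (simp flip: ennreal_mult)
  finally show ?thesis .
qed

lemma descent_interval:
  assumes "t > 0"
  shows "{a. a\<^sup>2 < t\<^sup>2 * (1 + c\<^sup>2)} = {- (t * sqrt (1 + c\<^sup>2))<..<t * sqrt (1 + c\<^sup>2)}"
proof -
  have "t\<^sup>2 * (1 + c\<^sup>2) = (t * sqrt (1 + c\<^sup>2))\<^sup>2" by (simp add: power_mult_distrib add_nonneg_nonneg)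
  moreover have "a\<^sup>2 < L\<^sup>2 \<longleftrightarrow> - L < a \<and> a < L" if "L \<ge> 0" for a L :: real
    using that abs_le_square_iff[of L a] by (simp add: not_le[symmetric]) linarith
  ultimately show ?thesis using assms by auto
qed

text \<open>A shear preserves area, so the mass does not depend on \<open>c\<close>;
  \<open>c = 0\<close> is the plain integral, other values serve the sheared Fourier
  integrand.\<close>

lemma wave_plane_mass:
  assumes "t > 0"
  shows "(\<integral>\<^sup>+a. \<integral>\<^sup>+q. ennreal (wave_plane t (a - c * q) q) \<partial>lborel \<partial>lborel) = ennreal t"
proof -
  have s: "sqrt (1 + c\<^sup>2) > 0" by (simp add: add_pos_nonneg)
  have "(\<integral>\<^sup>+a. \<integral>\<^sup>+q. ennreal (wave_plane t (a - c * q) q) \<partial>lborel \<partial>lborel) =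
    ennreal (1 / (2 * sqrt (1 + c\<^sup>2))) * emeasure lborel {- (t * sqrt (1 + c\<^sup>2))<..<t * sqrt (1 + c\<^sup>2)}"
    unfolding wave_plane_descent descent_interval[OF assms] by (simp add: nn_integral_cmult_indicator)
  also have "\<dots> = ennreal (1 / (2 * sqrt (1 + c\<^sup>2)) * (2 * (t * sqrt (1 + c\<^sup>2))))"
    using assms s by (subst ennreal_mult) auto
  also have "1 / (2 * sqrt (1 + c\<^sup>2)) * (2 * (t * sqrt (1 + c\<^sup>2))) = t"
    using s by (simp add: field_simps)
  finally show ?thesis .
qed

text \<open>With \<open>c = l / k\<close> the phase becomes k a, free of \<open>q\<close>, and
  descent leaves an oscillating integral over an interval. Its bound 2 / |k| ignores the length of
  the interval, so the estimate is uniform in \<open>t\<close>; the factor from descent completes it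
  to the reciprocal length of (k, l).\<close>

lemma wave_plane_fourier:
  assumes t: "t > 0" and k: "k \<noteq> 0"
  shows "integrable (lborel \<Otimes>\<^sub>M lborel) (\<lambda>(p, q). wave_plane t p q)"
    and "norm (CLINT x|lborel \<Otimes>\<^sub>M lborel. cis (- (k * fst x + l * snd x)) * of_real (wave_plane t (fst x) (snd x)))
      \<le> 1 / sqrt (k\<^sup>2 + l\<^sup>2)"
proof -
  have "(\<integral>\<^sup>+x. ennreal (norm (case x of (p, q) \<Rightarrow> wave_plane t p q)) \<partial>(lborel \<Otimes>\<^sub>M lborel)) = ennreal t"
    using wave_plane_mass[OF t, of 0] by (subst lborel.nn_integral_fst[symmetric]) auto
  then show "integrable (lborel \<Otimes>\<^sub>M lborel) (\<lambda>(p, q). wave_plane t p q)"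
    by (intro integrableI_bounded) (auto simp: split_beta)
  then have int: "complex_integrable (lborel \<Otimes>\<^sub>M lborel) (\<lambda>x. cis (- (k * fst x + l * snd x)) * of_real (wave_plane t (fst x) (snd x)))"
    by (rule Bochner_Integration.integrable_bound) (auto simp: norm_mult split_beta)
  define c where "c = l / k"
  define f where "f a q = cis (- (k * a)) * of_real (wave_plane t (a - c * q) q)" for a q
  have fm: "(\<lambda>(a, q). f a q) \<in> borel_measurable (lborel \<Otimes>\<^sub>M lborel)"
    unfolding f_def by measurable
  have "(\<integral>\<^sup>+x. ennreal (norm (case x of (a, q) \<Rightarrow> f a q)) \<partial>(lborel \<Otimes>\<^sub>M lborel)) = ennreal t"
    using wave_plane_mass[OF t, of c]
      lborel.nn_integral_fst[OF measurable_compose[OF measurable_compose[OF fm borel_measurable_norm] measurable_ennreal]]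
    by (simp add: f_def norm_mult)
  then have fint: "complex_integrable (lborel \<Otimes>\<^sub>M lborel) (\<lambda>(a, q). f a q)"
    using fm by (intro integrableI_bounded) auto
  have "(CLINT x|lborel \<Otimes>\<^sub>M lborel. cis (- (k * fst x + l * snd x)) * of_real (wave_plane t (fst x) (snd x)))
    = (CLINT q|lborel. CLINT p|lborel. cis (- (k * p + l * q)) * of_real (wave_plane t p q))"
  proof -
    have "complex_integrable (lborel \<Otimes>\<^sub>M lborel) (\<lambda>(p, q). cis (- (k * p + l * q)) * of_real (wave_plane t p q))"
      using int by (simp only: case_prod_beta')
    from lborel_pair.integral_snd[OF this] show ?thesis by (simp only: case_prod_beta')
  qed
  also have "\<dots> = (CLINT q|lborel. CLINT a|lborel. f a q)"
  proof (rule Bochner_Integration.integral_cong[OF refl])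
    fix q :: real
    have "(CLINT p|lborel. cis (- (k * p + l * q)) * of_real (wave_plane t p q))
      = (CLINT a|lborel. cis (- (k * (- (c * q) + 1 * a) + l * q)) * of_real (wave_plane t (- (c * q) + 1 * a) q))"
      by (subst lborel_integral_real_affine[where c = 1 and t = "- (c * q)"]) auto
    also have "\<dots> = (CLINT a|lborel. f a q)"
      using k by (intro Bochner_Integration.integral_cong refl) (simp add: f_def c_def field_simps)
    finally show "(CLINT p|lborel. cis (- (k * p + l * q)) * of_real (wave_plane t p q)) = (CLINT a|lborel. f a q)" .
  qed
  also have "\<dots> = (CLINT a|lborel. CLINT q|lborel. f a q)"
    by (rule lborel_pair.Fubini_integral[OF fint])
  also have "\<dots> = (CLINT a|lborel. (1 / (2 * sqrt (1 + c\<^sup>2))) *\<^sub>R (indicator {- (t * sqrt (1 + c\<^sup>2))..t * sqrt (1 + c\<^sup>2)} a *\<^sub>R cis (- (k * a))))"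
  proof (rule integral_cong_AE)
    show "(\<lambda>a. CLINT q|lborel. f a q) \<in> borel_measurable lborel"
      using fm by (rule lborel.borel_measurable_lebesgue_integral)
    \<comment> \<open>Descent produces an open interval, while \<open>norm_integral_cis_le\<close>
      is stated for a closed one.\<close>
    have "AE a in lborel. a \<noteq> t * sqrt (1 + c\<^sup>2)" "AE a in lborel. a \<noteq> - (t * sqrt (1 + c\<^sup>2))"
      by (rule AE_lborel_singleton)+
    then show "AE a in lborel. (CLINT q|lborel. f a q) =
      (1 / (2 * sqrt (1 + c\<^sup>2))) *\<^sub>R (indicator {- (t * sqrt (1 + c\<^sup>2))..t * sqrt (1 + c\<^sup>2)} a *\<^sub>R cis (- (k * a)))"
    proof eventually_elim
      case (elim a)
      have "(\<integral>q. wave_plane t (a - c * q) q \<partial>lborel) = enn2real (\<integral>\<^sup>+q. ennreal (wave_plane t (a - c * q) q) \<partial>lborel)"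
        by (rule integral_eq_nn_integral) auto
      also have "\<dots> = 1 / (2 * sqrt (1 + c\<^sup>2)) * indicator {- (t * sqrt (1 + c\<^sup>2))..t * sqrt (1 + c\<^sup>2)} a"
        unfolding wave_plane_descent descent_interval[OF t] using elim
        by (auto simp: indicator_def add_nonneg_nonneg)
      finally show ?case unfolding f_def
        by (simp add: scaleR_conv_of_real mult_ac)
    qed
  qed auto
  also have "\<dots> = (1 / (2 * sqrt (1 + c\<^sup>2))) *\<^sub>R (CLINT a|lborel. indicator {- (t * sqrt (1 + c\<^sup>2))..t * sqrt (1 + c\<^sup>2)} a *\<^sub>R cis (- (k * a)))"
    by (rule integral_scaleR_right)
  finally have "norm (CLINT x|lborel \<Otimes>\<^sub>M lborel. cis (- (k * fst x + l * snd x)) * of_real (wave_plane t (fst x) (snd x)))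
    = 1 / (2 * sqrt (1 + c\<^sup>2)) * norm (CLINT a|lborel. indicator {- (t * sqrt (1 + c\<^sup>2))..t * sqrt (1 + c\<^sup>2)} a *\<^sub>R cis (- (k * a)))"
    by (simp add: add_nonneg_nonneg)
  also have "\<dots> \<le> 1 / (2 * sqrt (1 + c\<^sup>2)) * (2 / \<bar>k\<bar>)"
    using t k by (intro mult_left_mono norm_integral_cis_le) (auto simp: add_nonneg_nonneg)
  also have "\<dots> = 1 / (sqrt (k\<^sup>2) * sqrt (1 + c\<^sup>2))" by simp
  also have "sqrt (k\<^sup>2) * sqrt (1 + c\<^sup>2) = sqrt (k\<^sup>2 + l\<^sup>2)"
  proof -
    have "k\<^sup>2 * (1 + c\<^sup>2) = k\<^sup>2 + l\<^sup>2"
      using k by (simp add: c_def power_divide distrib_left)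
    then show ?thesis by (simp only: real_sqrt_mult[symmetric])
  qed
  finally show "norm (CLINT x|lborel \<Otimes>\<^sub>M lborel. cis (- (k * fst x + l * snd x)) * of_real (wave_plane t (fst x) (snd x)))
      \<le> 1 / sqrt (k\<^sup>2 + l\<^sup>2)" .
qed

section \<open>From coordinates to an abstract plane\<close>

lemma plane_basis_inner:
  fixes b1 b2 :: "'a::euclidean_space"
  assumes B: "Basis = {b1, b2}" "b1 \<noteq> b2"
  shows "b1 \<bullet> b1 = 1" "b2 \<bullet> b2 = 1" "b1 \<bullet> b2 = 0" "b2 \<bullet> b1 = 0"
proof -
  have "b1 \<in> Basis" "b2 \<in> Basis" unfolding B by auto
  then show "b1 \<bullet> b1 = 1" "b2 \<bullet> b2 = 1" "b1 \<bullet> b2 = 0" "b2 \<bullet> b1 = 0"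
    using B(2) by (simp_all add: inner_Basis)
qed

text \<open>The dimension is a hypothesis on the type, so the plane is not literally a product;
  agreement on boxes identifies its Lebesgue measure with the image of the product measure.\<close>

lemma lborel_eq_distr_plane:
  fixes b1 b2 :: "'a::euclidean_space"
  assumes B: "Basis = {b1, b2}" "b1 \<noteq> b2"
  shows "(lborel :: 'a measure) = distr (lborel \<Otimes>\<^sub>M lborel) borel (\<lambda>x. fst x *\<^sub>R b1 + snd x *\<^sub>R b2)"
proof (rule lborel_eqI)
  have ip: "b1 \<bullet> b1 = 1" "b2 \<bullet> b2 = 1" "b1 \<bullet> b2 = 0" "b2 \<bullet> b1 = 0"
    using plane_basis_inner[OF B] by auto
  fix l u :: 'a assume le: "\<And>b. b \<in> Basis \<Longrightarrow> l \<bullet> b \<le> u \<bullet> b"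
  have le12: "l \<bullet> b1 \<le> u \<bullet> b1" "l \<bullet> b2 \<le> u \<bullet> b2" using le[of b1] le[of b2] unfolding B by auto
  let ?T = "\<lambda>x. fst x *\<^sub>R b1 + snd x *\<^sub>R b2"
  have "?T -` box l u \<inter> space (lborel \<Otimes>\<^sub>M lborel) = {l \<bullet> b1<..<u \<bullet> b1} \<times> {l \<bullet> b2<..<u \<bullet> b2}"
    unfolding box_def B by (auto simp: inner_add_left ip space_pair_measure)
  then have "emeasure (distr (lborel \<Otimes>\<^sub>M lborel) borel ?T) (box l u)
      = emeasure (lborel \<Otimes>\<^sub>M lborel) ({l \<bullet> b1<..<u \<bullet> b1} \<times> {l \<bullet> b2<..<u \<bullet> b2})"
    by (subst emeasure_distr) auto
  also have "\<dots> = ennreal (u \<bullet> b1 - l \<bullet> b1) * ennreal (u \<bullet> b2 - l \<bullet> b2)"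
    using le12 by (subst lborel.emeasure_pair_measure_Times) auto
  also have "\<dots> = ennreal (\<Prod>b\<in>Basis. (u - l) \<bullet> b)"
    unfolding B(1) using le12 B(2) by (simp add: inner_diff_left ennreal_mult)
  finally show "emeasure (distr (lborel \<Otimes>\<^sub>M lborel) borel ?T) (box l u) = (\<Prod>b\<in>Basis. (u - l) \<bullet> b)" .
qed simp

lemma G_measurable2 [measurable]:
  "(\<lambda>x. G (f x) (g x :: 'a::euclidean_space)) \<in> borel_measurable N"
  if [measurable]: "f \<in> borel_measurable N" "g \<in> borel_measurable N"
  unfolding G_def by measurable

lemma G_nonneg [simp]: "G t x \<ge> 0"
proof (cases "norm x < t")
  case True
  then have "(norm x)\<^sup>2 \<le> t\<^sup>2" by (intro power_mono) auto
  then show ?thesis by (simp add: G_def)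
qed (simp add: G_def)

lemma G_nonpos: "t \<le> 0 \<Longrightarrow> G t x = 0"
  using norm_ge_zero[of x] by (auto simp: G_def simp del: norm_ge_zero)

lemma G_eq_wave_plane:
  fixes b1 b2 :: "'a::euclidean_space"
  assumes B: "Basis = {b1, b2}" "b1 \<noteq> b2" and t: "t > 0"
  shows "G t (p *\<^sub>R b1 + q *\<^sub>R b2) = wave_plane t p q"
proof -
  have ip: "b1 \<bullet> b1 = 1" "b2 \<bullet> b2 = 1" "b1 \<bullet> b2 = 0" "b2 \<bullet> b1 = 0"
    using plane_basis_inner[OF B] by auto
  have D: "DIM('a) = 2" unfolding B(1) using B(2) by simp
  have n: "(norm (p *\<^sub>R b1 + q *\<^sub>R b2))\<^sup>2 = p\<^sup>2 + q\<^sup>2"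
    unfolding power2_norm_eq_inner by (simp add: inner_add_left inner_add_right ip power2_eq_square)
  have "norm (p *\<^sub>R b1 + q *\<^sub>R b2) < t \<longleftrightarrow> (norm (p *\<^sub>R b1 + q *\<^sub>R b2))\<^sup>2 < t\<^sup>2"
    using t by (auto intro: power_strict_mono power_less_imp_less_base[of _ 2])
  then show ?thesis using t n D
    by (simp add: G_def wave_plane_def inv_sqrt_pos_def)
qed

lemma G_plane_integrable:
  assumes "DIM('a::euclidean_space) = 2" and t: "t > 0"
  shows "(\<integral>\<^sup>+x. ennreal (G t (x::'a)) \<partial>lborel) = ennreal t"
proof -
  obtain b1 b2 where B: "(Basis :: 'a set) = {b1, b2}" "b1 \<noteq> b2"
    using assms(1) by (auto simp: card_2_iff)
  have m: "(\<lambda>x::'a. ennreal (G t x)) \<in> borel_measurable borel" by measurable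
  have "(\<integral>\<^sup>+x. ennreal (G t (x::'a)) \<partial>lborel) =
      (\<integral>\<^sup>+x. ennreal (wave_plane t (fst x) (snd x)) \<partial>(lborel \<Otimes>\<^sub>M lborel))"
    by (subst lborel_eq_distr_plane[OF B], subst nn_integral_distr) (auto simp: G_eq_wave_plane[OF B t])
  also have "\<dots> = ennreal t"
    using wave_plane_mass[OF t, of 0] by (subst lborel.nn_integral_fst[symmetric]) auto
  finally show ?thesis .
qed

lemma fourier_G_plane_le:
  fixes \<xi> :: "'a::euclidean_space"
  assumes D: "DIM('a) = 2" and t: "t > 0" and xi: "\<xi> \<noteq> 0"
  shows "norm (fourier (G t) \<xi>) \<le> 1 / norm \<xi>"
proof -
  obtain c1 c2 where C: "(Basis :: 'a set) = {c1, c2}" "c1 \<noteq> c2"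
    using D by (auto simp: card_2_iff)
  \<comment> \<open>The shear divides by the first frequency coordinate, so the basis is ordered to
    make that coordinate nonzero.\<close>
  obtain b1 b2 where B: "(Basis :: 'a set) = {b1, b2}" "b1 \<noteq> b2" and k: "\<xi> \<bullet> b1 \<noteq> 0"
  proof (cases "\<xi> \<bullet> c1 = 0")
    case True
    have "\<xi> \<bullet> c2 \<noteq> 0" using xi True C(1) euclidean_all_zero_iff[of \<xi>] by auto
    then show ?thesis using that[of c2 c1] C by auto
  qed (use that C in blast)
  have n: "(norm \<xi>)\<^sup>2 = (\<xi> \<bullet> b1)\<^sup>2 + (\<xi> \<bullet> b2)\<^sup>2"
    unfolding power2_norm_eq_inner euclidean_inner[of \<xi> \<xi>] B(1) using B(2) by (simp add: power2_eq_square)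
  have "fourier (G t) \<xi> = (CLINT x|distr (lborel \<Otimes>\<^sub>M lborel) borel (\<lambda>x. fst x *\<^sub>R b1 + snd x *\<^sub>R b2). cis (- (\<xi> \<bullet> x)) * of_real (G t x))"
    unfolding fourier_def by (subst lborel_eq_distr_plane[OF B]) simp
  also have "\<dots> = (CLINT x|lborel \<Otimes>\<^sub>M lborel. cis (- ((\<xi> \<bullet> b1) * fst x + (\<xi> \<bullet> b2) * snd x)) * of_real (wave_plane t (fst x) (snd x)))"
    by (subst integral_distr) (auto simp: G_eq_wave_plane[OF B t] inner_add_right mult_ac)
  finally have "norm (fourier (G t) \<xi>) \<le> 1 / sqrt ((\<xi> \<bullet> b1)\<^sup>2 + (\<xi> \<bullet> b2)\<^sup>2)"
    using wave_plane_fourier(2)[OF t k, of "\<xi> \<bullet> b2"] by simp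
  then show ?thesis unfolding n[symmetric] by simp
qed

text \<open>Converts the decay into the weight of condition (C): up to frequency 1 the mass
  \<open>t\<close> is used, beyond it 1 / |\<xi>|. The root of 1 + |\<xi>|^2 is at most 2,
  respectively 2 |\<xi>|, whence the 2; the factor \<open>1 + t\<close> covers both cases.\<close>

lemma fourier_G_plane_weight:
  fixes \<xi> :: "'a::euclidean_space"
  assumes D: "DIM('a) = 2" and t: "t > 0"
  shows "norm (fourier (G t) \<xi>) \<le> (2 * (1 + t)) * (1 + (norm \<xi>)\<^sup>2) powr (- 1 / 2)"
proof -
  have pw: "(1 + (norm \<xi>)\<^sup>2) powr (- 1 / 2) = 1 / sqrt (1 + (norm \<xi>)\<^sup>2)"
  proof -
    have "0 \<le> 1 + (norm \<xi>)\<^sup>2" by simp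
    then show ?thesis
      using powr_minus[of "1 + (norm \<xi>)\<^sup>2" "1 / 2"] powr_half_sqrt[of "1 + (norm \<xi>)\<^sup>2"]
      by (simp add: inverse_eq_divide)
  qed
  have pos: "sqrt (1 + (norm \<xi>)\<^sup>2) > 0" by (simp add: add_pos_nonneg)
  show ?thesis
  proof (cases "norm \<xi> \<le> 1")
    case True
    have "norm (fourier (G t) \<xi>) \<le> (\<integral>x. norm (cis (- (\<xi> \<bullet> x)) * of_real (G t x)) \<partial>lborel)"
      unfolding fourier_def by (rule integral_norm_bound)
    also have "\<dots> = (\<integral>x. G t (x::'a) \<partial>lborel)" by (simp add: norm_mult)
    also have "\<dots> = t"
      using G_plane_integrable[OF D t] t by (subst integral_eq_nn_integral) auto
    finally have 1: "norm (fourier (G t) \<xi>) \<le> t" .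
    have "sqrt (1 + (norm \<xi>)\<^sup>2) \<le> 2"
      using power_le_one[of "norm \<xi>" 2] True by (intro real_le_lsqrt) auto
    then have "t * sqrt (1 + (norm \<xi>)\<^sup>2) \<le> t * 2"
      using t by (intro mult_left_mono) auto
    also have "\<dots> \<le> 2 * (1 + t)" by simp
    finally have "t * sqrt (1 + (norm \<xi>)\<^sup>2) \<le> 2 * (1 + t)" .
    then have "t \<le> 2 * (1 + t) / sqrt (1 + (norm \<xi>)\<^sup>2)"
      using pos by (simp add: pos_le_divide_eq)
    then show ?thesis using 1 unfolding pw by simp
  next
    case False
    then have xi: "\<xi> \<noteq> 0" by auto
    have "sqrt (1 + (norm \<xi>)\<^sup>2) \<le> 2 * norm \<xi>"
    proof (rule real_le_lsqrt)
      have "1 \<le> (norm \<xi>)\<^sup>2" using False by (simp add: one_le_power)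
      then show "1 + (norm \<xi>)\<^sup>2 \<le> (2 * norm \<xi>)\<^sup>2" by (simp add: power_mult_distrib)
    qed simp
    also have "\<dots> \<le> 2 * (1 + t) * norm \<xi>" using t by (intro mult_right_mono) auto
    finally have "1 / norm \<xi> \<le> 2 * (1 + t) / sqrt (1 + (norm \<xi>)\<^sup>2)"
      using pos xi by (simp add: field_simps)
    then show ?thesis using fourier_G_plane_le[OF D t xi] unfolding pw by simp
  qed
qed

section \<open>The spectral kernel\<close>

lemma lborel_distr_shift: "distr lborel borel (\<lambda>x. x + c) = (lborel :: 'a::euclidean_space measure)"
proof -
  have "(\<lambda>x. x + c) = (+) c" by (auto simp: add.commute)
  then show ?thesis by (simp add: lborel_distr_plus)
qed

lemma lborel_distr_reflect: "distr lborel borel (\<lambda>x. c - x) = (lborel :: 'a::euclidean_space measure)"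
  using lborel_affine[of "-1" c] by (simp add: density_1 one_ennreal_def[symmetric])

lemma nn_integral_lborel_shift:
  fixes c :: "'a::euclidean_space"
  assumes "f \<in> borel_measurable borel"
  shows "(\<integral>\<^sup>+x. f (x + c) \<partial>lborel) = (\<integral>\<^sup>+x. f x \<partial>lborel)"
  by (subst (2) lborel_distr_shift[of c, symmetric], subst nn_integral_distr) (use assms in auto)

lemma nn_integral_lborel_reflect:
  fixes c :: "'a::euclidean_space"
  assumes "f \<in> borel_measurable borel"
  shows "(\<integral>\<^sup>+x. f (c - x) \<partial>lborel) = (\<integral>\<^sup>+x. f x \<partial>lborel)"
  by (subst (2) lborel_distr_reflect[of c, symmetric], subst nn_integral_distr) (use assms in auto)

lemma fourier_shift:
  fixes \<phi> :: "'a::euclidean_space \<Rightarrow> real"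
  assumes [measurable]: "\<phi> \<in> borel_measurable borel"
  shows "fourier (\<lambda>y. \<phi> (y - u)) \<xi> = cis (- (\<xi> \<bullet> u)) * fourier \<phi> \<xi>"
proof -
  have "fourier (\<lambda>y. \<phi> (y - u)) \<xi> = (CLINT x|distr lborel borel (\<lambda>x. x + u). cis (- (\<xi> \<bullet> x)) * of_real (\<phi> (x - u)))"
    unfolding fourier_def lborel_distr_shift ..
  also have "\<dots> = (CLINT x|lborel. cis (- (\<xi> \<bullet> (x + u))) * of_real (\<phi> x))"
    by (subst integral_distr) auto
  also have "\<dots> = (CLINT x|lborel. cis (- (\<xi> \<bullet> u)) * (cis (- (\<xi> \<bullet> x)) * of_real (\<phi> x)))"
    by (simp add: inner_add_right cis_mult mult.assoc[symmetric] add.commute)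
  also have "\<dots> = cis (- (\<xi> \<bullet> u)) * fourier \<phi> \<xi>"
    unfolding fourier_def by (rule integral_mult_right_zero)
  finally show ?thesis .
qed

lemma bump_measurable2 [measurable]: "(\<lambda>x. bump r (f x)) \<in> borel_measurable N"
  if [measurable]: "f \<in> borel_measurable N"
proof -
  have "continuous_on UNIV (expinv 0)" using dirdiff_cont[OF dirdiff_expinv] .
  then have [measurable]: "expinv 0 \<in> borel_measurable borel" by (rule borel_measurable_continuous_onI)
  show ?thesis unfolding bump_def by measurable
qed

lemma heat_measurable2 [measurable]: "(\<lambda>x. heat e (f x)) \<in> borel_measurable N"
  if [measurable]: "f \<in> borel_measurable N"
  unfolding heat_def by measurable

lemma heat_nonneg [simp]: "heat e x \<ge> 0"
  by (simp add: heat_def)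

lemma bump_minus: "bump r (- x) = bump r x" by (simp add: bump_def)

lemma bump_support: "r > 0 \<Longrightarrow> bump r x \<le> indicator (ball 0 r) x"
  using bump_le_1[of r x] bump_eq_0[of r x] by (auto simp: indicator_def)

lemma bump_integral:
  assumes r: "r > 0"
  shows "integrable lborel (bump r :: 'a::euclidean_space \<Rightarrow> real)" "(\<integral>x. bump r (x::'a) \<partial>lborel) > 0"
proof -
  have b: "integrable lborel (indicator (ball 0 r) :: 'a \<Rightarrow> real)"
    using emeasure_lborel_ball_finite[of "0::'a" r] by (intro integrable_real_indicator) auto
  show i: "integrable lborel (bump r :: 'a \<Rightarrow> real)"
    by (rule Bochner_Integration.integrable_bound[OF b]) (use bump_support[OF r] in auto)
  have "0 < exp (- 1 / 3 :: real) * measure lborel (ball (0::'a) (r / 2))"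
    using r content_ball_pos[of "r / 2" "0::'a"] by simp
  also have "\<dots> = (\<integral>x. exp (- 1 / 3 :: real) * indicator (ball (0::'a) (r / 2)) x \<partial>lborel)" by simp
  also have "\<dots> \<le> (\<integral>x. bump r (x::'a) \<partial>lborel)"
  proof (rule integral_mono)
    show "integrable lborel (\<lambda>x::'a. exp (- 1 / 3 :: real) * indicator (ball (0::'a) (r / 2)) x)"
    proof -
      have "integrable lborel (indicator (ball (0::'a) (r / 2)) :: 'a \<Rightarrow> real)"
        using emeasure_lborel_ball_finite[of "0::'a" "r / 2"] by (intro integrable_real_indicator) auto
      then show ?thesis by simp
    qed
    show "exp (- 1 / 3 :: real) * indicator (ball (0::'a) (r / 2)) x \<le> bump r x" for x :: 'a
      using bump_ge[OF r, of x] by (auto simp: indicator_def)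
  qed (rule i)
  finally show "(\<integral>x. bump r (x::'a) \<partial>lborel) > 0" .
qed

text \<open>Factorisation over an orthonormal basis reduces the total mass to that of
  one-dimensional normal densities.\<close>

lemma heat_eq_prod:
  fixes x :: "'a::euclidean_space"
  assumes "e > 0"
  shows "heat e x = (\<Prod>b\<in>Basis. normal_density 0 (sqrt e) (x \<bullet> b))"
proof -
  have "(\<Prod>b\<in>Basis. normal_density 0 (sqrt e) (x \<bullet> b)) =
     (1 / sqrt (2 * pi * e)) ^ DIM('a) * exp (\<Sum>b\<in>Basis. - (x \<bullet> b)\<^sup>2 / (2 * e))"
    using assms by (simp add: normal_density_def exp_sum prod_dividef power_divide prod.distrib)
  also have "(\<Sum>b\<in>Basis. - (x \<bullet> b)\<^sup>2 / (2 * e)) = - (norm x)\<^sup>2 / (2 * e)"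
    unfolding power2_norm_eq_inner euclidean_inner[of x x]
    by (simp add: sum_negf sum_divide_distrib power2_eq_square)
  also have "(1 / sqrt (2 * pi * e)) ^ DIM('a) = (2 * pi * e) powr (- real DIM('a) / 2)"
  proof -
    have "1 / sqrt (2 * pi * e) = (2 * pi * e) powr (- 1 / 2)"
      using assms powr_minus[of "2 * pi * e" "1 / 2"] powr_half_sqrt[of "2 * pi * e"] by (simp add: inverse_eq_divide)
    then show ?thesis using assms by (simp add: powr_powr flip: powr_realpow)
  qed
  finally show ?thesis by (simp add: heat_def)
qed

lemma heat_integral:
  assumes "e > 0" shows "(\<integral>\<^sup>+x. ennreal (heat e (x::'a::euclidean_space)) \<partial>lborel) = 1"
proof -
  have "(\<integral>\<^sup>+x. ennreal (normal_density 0 (sqrt e) x) \<partial>lborel) = 1"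
    using assms by (subst nn_integral_eq_integral) auto
  then show ?thesis
    unfolding heat_eq_prod[OF assms]
    using nn_integral_lborel_prod[where 'a = 'a and f = "\<lambda>b x. ennreal (normal_density 0 (sqrt e) x)"]
    by (simp add: prod_ennreal[symmetric])
qed

lemma heat_integral_shift:
  assumes "e > 0" shows "(\<integral>\<^sup>+y. ennreal (heat e (x - y :: 'a::euclidean_space)) \<partial>lborel) = 1"
  using nn_integral_lborel_reflect[of "\<lambda>y. ennreal (heat e y)" x] heat_integral[OF assms, where 'a = 'a] by simp

locale spectral_kernel =
  fixes \<gamma> :: "'a::euclidean_space \<Rightarrow> ennreal" and \<mu> :: "'a measure"
  assumes dim: "DIM('a) \<in> {1, 2}"
    and four: "is_fourier_of \<gamma> \<mu>"
    and A: "assumption_A \<gamma> \<mu>"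
    and C: "condition_C \<mu>"
    and temp: "tempered_measure \<mu>"
begin

definition gr :: "'a \<Rightarrow> real" where "gr = gamma_r \<gamma>"

lemma gr_nonneg [simp]: "gr x \<ge> 0" by (simp add: gr_def gamma_r_def)

lemma gr_minus: "gr (- x) = gr x" using A by (simp add: gr_def gamma_r_def assumption_A_def)

lemma gr_meas [measurable]: "gr \<in> borel_measurable borel"
proof -
  have "\<gamma> \<in> borel_measurable borel"
    using A by (intro borel_measurable_continuous_onI) (auto simp: assumption_A_def)
  then show ?thesis unfolding gr_def gamma_r_def[abs_def] by measurable
qed

lemma sets_mu [measurable_cong]: "sets \<mu> = sets borel" using temp by (simp add: tempered_measure_def)

text \<open>The weight of condition (C) is positive and integrable, so its superlevel sets have
  finite measure and exhaust the space. Fubini between Lebesgue measure and \<mu> relies on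
  this.\<close>

lemma mu_sigma_finite: "sigma_finite_measure \<mu>"
proof
  let ?w = "\<lambda>\<xi>::'a. (1 + (norm \<xi>)\<^sup>2) powr (- 1 / 2)"
  have fin: "(\<integral>\<^sup>+\<xi>. ennreal (?w \<xi>) \<partial>\<mu>) < \<infinity>" using C by (simp add: condition_C_def)
  define F where "F n = {\<xi>::'a. ?w \<xi> \<ge> 1 / real (Suc n)}" for n
  have F: "F n \<in> sets \<mu>" for n unfolding F_def sets_mu by measurable
  have "emeasure \<mu> (F n) \<noteq> \<infinity>" for n
  proof -
    have "ennreal (1 / real (Suc n)) * emeasure \<mu> (F n) = (\<integral>\<^sup>+\<xi>. ennreal (1 / real (Suc n)) * indicator (F n) \<xi> \<partial>\<mu>)"
      using F by (simp add: nn_integral_cmult_indicator)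
    also have "\<dots> \<le> (\<integral>\<^sup>+\<xi>. ennreal (?w \<xi>) \<partial>\<mu>)"
      by (intro nn_integral_mono) (auto simp: F_def indicator_def intro!: ennreal_leI)
    also have "\<dots> < \<infinity>" by (rule fin)
    finally show ?thesis by (auto simp: ennreal_mult_less_top less_top)
  qed
  moreover have "(\<Union>n. F n) = space \<mu>"
  proof -
    have "\<exists>n. \<xi> \<in> F n" for \<xi>
    proof -
      have "0 < 1 + (norm \<xi>)\<^sup>2" by (simp add: add_pos_nonneg)
      then have "?w \<xi> > 0" by (metis less_irrefl powr_gt_zero)
      then obtain n where "1 / real (Suc n) < ?w \<xi>" using nat_approx_posE by blast
      then show ?thesis by (intro exI[of _ n]) (simp add: F_def)
    qed
    moreover have "space \<mu> = UNIV" using sets_eq_imp_space_eq[OF sets_mu] by simp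
    ultimately show ?thesis by auto
  qed
  ultimately show "\<exists>A. countable A \<and> A \<subseteq> sets \<mu> \<and> \<Union> A = space \<mu> \<and> (\<forall>a\<in>A. emeasure \<mu> a \<noteq> \<infinity>)"
    using F by (intro exI[of _ "range F"]) auto
qed

text \<open>The bump is even, so \<open>bump r (x - y)\<close> is a translate in \<open>y\<close>;
  it is again a test function, and its transform differs by a phase only.\<close>

lemma bump_spectral:
  assumes r: "r > 0"
  shows "complex_integrable \<mu> (fourier (bump r))"
    and "(\<integral>\<^sup>+y. ennreal (gr y * bump r (x - y)) \<partial>lborel) = ennreal (\<integral>y. gr y * bump r (x - y) \<partial>lborel)"
    and "complex_of_real (\<integral>y. gr y * bump r (x - y) \<partial>lborel) = (CLINT \<xi>|\<mu>. cis (- (\<xi> \<bullet> x)) * fourier (bump r) \<xi>)"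
proof -
  have sh: "(\<lambda>y. bump r (x - y)) = (\<lambda>y. bump r (y - x))" for x :: 'a
    using bump_minus[of r "_ - x"] by (metis minus_diff_eq)
  have b: "(\<lambda>y. bump r (x - y)) \<in> Cc_inf" for x :: 'a by (rule bump_Cc_inf[OF r])
  have F: "fourier (\<lambda>y. bump r (x - y)) = (\<lambda>\<xi>. cis (- (\<xi> \<bullet> x)) * fourier (bump r) \<xi>)" for x :: 'a
    unfolding sh by (rule ext, rule fourier_shift) measurable
  show "complex_integrable \<mu> (fourier (bump r))"
    using four b[of 0] F[of 0] unfolding is_fourier_of_def by (auto simp: bump_minus)
  have i: "integrable lborel (\<lambda>y. gr y * bump r (x - y))"
    using four b[of x] unfolding is_fourier_of_def gr_def by auto
  then show "(\<integral>\<^sup>+y. ennreal (gr y * bump r (x - y)) \<partial>lborel) = ennreal (\<integral>y. gr y * bump r (x - y) \<partial>lborel)"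
    by (rule nn_integral_eq_integral) simp
  show "complex_of_real (\<integral>y. gr y * bump r (x - y) \<partial>lborel) = (CLINT \<xi>|\<mu>. cis (- (\<xi> \<bullet> x)) * fourier (bump r) \<xi>)"
    using four b[of x] unfolding is_fourier_of_def gr_def F[symmetric] by auto
qed

text \<open>The phase has modulus 1, so the L^1(\<mu>) norm of one transform bounds all translates
  at once.\<close>

lemma bump_bound:
  assumes r: "r > 0"
  obtains B where "B \<ge> 0" "\<And>x. (\<integral>\<^sup>+y. ennreal (gr y) * ennreal (bump r (x - y)) \<partial>lborel) \<le> ennreal B"
proof
  let ?B = "\<integral>\<xi>. norm (fourier (bump r) \<xi>) \<partial>\<mu>"
  show "?B \<ge> 0" by simp
  fix x :: 'a
  have "(\<integral>y. gr y * bump r (x - y) \<partial>lborel) \<le> norm (complex_of_real (\<integral>y. gr y * bump r (x - y) \<partial>lborel))" by simp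
  also have "\<dots> \<le> (\<integral>\<xi>. norm (cis (- (\<xi> \<bullet> x)) * fourier (bump r) \<xi>) \<partial>\<mu>)"
    unfolding bump_spectral(3)[OF r] by (rule integral_norm_bound)
  also have "\<dots> = ?B" by (simp add: norm_mult)
  finally show "(\<integral>\<^sup>+y. ennreal (gr y) * ennreal (bump r (x - y)) \<partial>lborel) \<le> ennreal ?B"
    using bump_spectral(2)[OF r, of x] by (simp add: ennreal_mult ennreal_leI)
qed

end

text \<open>Half of an approximate identity: on the shrinking support of the bump, \<open>g\<close>
  is at least \<open>g (x - y) - \<eta>\<close>. Continuity at a single point suffices and no upper
  bound on \<open>g\<close> is involved, which suits the singular planar kernel. The factor
  \<open>c\<close> will be a value of \<open>gr\<close>.\<close>

lemma ennreal_le_liminf_smoothing: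
  fixes g :: "'a::euclidean_space \<Rightarrow> real"
  assumes g: "isCont g (x - y)" and [measurable]: "g \<in> borel_measurable borel" and c: "c \<ge> 0"
  shows "ennreal (c * g (x - y)) \<le> liminf (\<lambda>k. ennreal c *
    (\<integral>\<^sup>+w. ennreal (g (x - w)) * ennreal (bump (1 / real (Suc k)) (w - y) / (\<integral>z. bump (1 / real (Suc k)) (z::'a) \<partial>lborel)) \<partial>lborel))"
    (is "_ \<le> liminf ?X")
proof (rule ennreal_le_epsilon)
  fix e :: real assume e: "e > 0"
  define \<eta> where "\<eta> = e / (c + 1)"
  have \<eta>: "\<eta> > 0" "c * \<eta> \<le> e" using e c by (auto simp: \<eta>_def field_simps)
  obtain d where d: "d > 0" "\<And>u. dist u (x - y) < d \<Longrightarrow> dist (g u) (g (x - y)) < \<eta>"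
    using g \<eta>(1) unfolding continuous_at_eps_delta by (metis dist_commute)
  have ev: "\<forall>\<^sub>F k in sequentially. 1 / real (Suc k) < d"
    using order_tendstoD(2)[OF LIMSEQ_inverse_real_of_nat d(1)] by (simp add: inverse_eq_divide)
  have "\<forall>\<^sub>F k in sequentially. ennreal c * ennreal (g (x - y) - \<eta>) \<le> ?X k"
    using ev
  proof eventually_elim
    case (elim k)
    define r where "r = 1 / real (Suc k)"
    define I where "I = (\<integral>z. bump r (z::'a) \<partial>lborel)"
    have r: "r > 0" by (simp add: r_def)
    have I: "I > 0" unfolding I_def by (rule bump_integral(2)[OF r])
    have mass: "(\<integral>\<^sup>+w. ennreal (bump r (w - y) / I) \<partial>lborel) = 1"
    proof -
      have "(\<integral>\<^sup>+w. ennreal (bump r (w - y) / I) \<partial>lborel) = (\<integral>\<^sup>+w. ennreal (bump r (w::'a) / I) \<partial>lborel)"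
        using nn_integral_lborel_shift[of "\<lambda>w. ennreal (bump r w / I)" "- y"] by simp
      also have "\<dots> = ennreal (\<integral>w. bump r (w::'a) / I \<partial>lborel)"
        using I bump_integral(1)[OF r, where 'a = 'a] by (intro nn_integral_eq_integral) auto
      also have "(\<integral>w. bump r (w::'a) / I \<partial>lborel) = 1" using I by (simp add: I_def)
      finally show ?thesis by simp
    qed
    have "ennreal (g (x - y) - \<eta>) = ennreal (g (x - y) - \<eta>) * (\<integral>\<^sup>+w. ennreal (bump r (w - y) / I) \<partial>lborel)"
      by (simp add: mass)
    also have "\<dots> = (\<integral>\<^sup>+w. ennreal (g (x - y) - \<eta>) * ennreal (bump r (w - y) / I) \<partial>lborel)"
      by (rule nn_integral_cmult[symmetric]) measurable
    also have "\<dots> \<le> (\<integral>\<^sup>+w. ennreal (g (x - w)) * ennreal (bump r (w - y) / I) \<partial>lborel)"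
    proof (rule nn_integral_mono)
      fix w
      show "ennreal (g (x - y) - \<eta>) * ennreal (bump r (w - y) / I) \<le> ennreal (g (x - w)) * ennreal (bump r (w - y) / I)"
      proof (cases "norm (w - y) < r")
        case True
        then have "dist (x - w) (x - y) < d" using elim by (simp add: dist_norm r_def norm_minus_commute)
        from d(2)[OF this] have "g (x - y) - \<eta> \<le> g (x - w)" by (simp add: dist_real_def)
        then show ?thesis by (intro mult_right_mono ennreal_leI) auto
      qed (simp add: bump_eq_0[OF r])
    qed
    finally show ?case unfolding r_def I_def by (rule mult_left_mono) simp
  qed
  then have le: "ennreal c * ennreal (g (x - y) - \<eta>) \<le> liminf ?X" by (rule Liminf_bounded)
  have "ennreal (c * g (x - y)) \<le> ennreal (c * (g (x - y) - \<eta>) + e)"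
    using \<eta> by (intro ennreal_leI) (simp add: algebra_simps)
  \<comment> \<open>\<open>ennreal\<close> truncates negative numbers to 0, so a negative first term
    has to be treated separately.\<close>
  also have "\<dots> \<le> ennreal (c * (g (x - y) - \<eta>)) + ennreal e"
  proof (cases "c * (g (x - y) - \<eta>) \<ge> 0")
    case False
    then have "ennreal (c * (g (x - y) - \<eta>) + e) \<le> ennreal e" by (intro ennreal_leI) simp
    also have "\<dots> \<le> ennreal (c * (g (x - y) - \<eta>)) + ennreal e" by simp
    finally show ?thesis .
  qed (use e in simp)
  also have "ennreal (c * (g (x - y) - \<eta>)) = ennreal c * ennreal (g (x - y) - \<eta>)"
    using c by (rule ennreal_mult')
  finally show "ennreal (c * g (x - y)) \<le> liminf ?X + ennreal e"
    using le by (meson add_right_mono order_trans)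
qed

lemma isCont_G:
  fixes z :: "'a::euclidean_space"
  assumes "norm z < t" shows "isCont (G t) z"
proof -
  have pos: "t\<^sup>2 - (norm u)\<^sup>2 > 0" if "norm u < t" for u :: 'a
    using that by (simp add: power_strict_mono)
  have "continuous_on (ball 0 t) (\<lambda>u::'a. if DIM('a) = 1 then 1 / 2 else 1 / (2 * pi) / sqrt (t\<^sup>2 - (norm u)\<^sup>2))"
    using pos by (cases "DIM('a) = 1") (auto intro!: continuous_intros simp: less_le)
  then have "continuous_on (ball 0 t) (G t :: 'a \<Rightarrow> real)"
    by (rule continuous_on_cong[THEN iffD1, rotated -1]) (auto simp: G_def)
  then show ?thesis using assms by (simp add: continuous_on_eq_continuous_at)
qed

context spectral_kernel
begin

text \<open>A positive multiple of \<open>heat \<epsilon>\<close> is dominated by the convolution of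
  \<open>heat (2 * \<epsilon>)\<close> with a unit bump, and translates of the bump are controlled
  by \<open>bump_bound\<close>. The bound is uniform in \<open>a\<close> but depends on
  \<epsilon>.\<close>

lemma heat_bound:
  assumes e: "\<epsilon> > 0"
  obtains B where "B \<ge> 0" "\<And>a. (\<integral>\<^sup>+y. ennreal (heat \<epsilon> (a - y)) * ennreal (gr y) \<partial>lborel) \<le> ennreal B"
proof -
  obtain B where B: "B \<ge> 0" "\<And>x. (\<integral>\<^sup>+y. ennreal (gr y) * ennreal (bump 1 (x - y)) \<partial>lborel) \<le> ennreal B"
    by (rule bump_bound[of 1]) auto
  define I where "I = (\<integral>x. bump 1 (x::'a) \<partial>lborel)"
  have I: "I > 0" unfolding I_def by (rule bump_integral) simp
  \<comment> \<open>If |z - w| < 1 then |w|^2 is at most 2 |z|^2 + 2; doubling the variance absorbs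
    the first 2, and \<open>c\<close> collects the remaining exponential and the ratio of the
    prefactors.\<close>
  define c where "c = 2 powr (- real DIM('a) / 2) * exp (- 1 / (2 * \<epsilon>))"
  have c: "c > 0" by (simp add: c_def)
  have heat_le: "c * heat \<epsilon> z \<le> heat (2 * \<epsilon>) w" if "norm (z - w) < 1" for z w :: 'a
  proof -
    have "norm w \<le> norm z + 1" using that norm_triangle_ineq2[of w z] by (simp add: norm_minus_commute)
    then have "(norm w)\<^sup>2 \<le> (norm z + 1)\<^sup>2" by (intro power_mono) auto
    also have "\<dots> \<le> 2 * (norm z)\<^sup>2 + 2"
      using zero_le_power2[of "norm z - 1"] by (simp add: power2_eq_square algebra_simps)
    finally have "(norm w)\<^sup>2 / (2 * (2 * \<epsilon>)) \<le> (2 * (norm z)\<^sup>2 + 2) / (2 * (2 * \<epsilon>))"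
      using e by (intro divide_right_mono) auto
    moreover have "(2 * (norm z)\<^sup>2 + 2) / (2 * (2 * \<epsilon>)) = (norm z)\<^sup>2 / (2 * \<epsilon>) + 1 / (2 * \<epsilon>)"
      using e by (simp add: field_simps)
    ultimately have "- (norm z)\<^sup>2 / (2 * \<epsilon>) - 1 / (2 * \<epsilon>) \<le> - (norm w)\<^sup>2 / (2 * (2 * \<epsilon>))"
      by simp
    then have ex: "exp (- (norm z)\<^sup>2 / (2 * \<epsilon>)) * exp (- 1 / (2 * \<epsilon>)) \<le> exp (- (norm w)\<^sup>2 / (2 * (2 * \<epsilon>)))"
      by (simp flip: exp_add)
    have "(2 * pi * (2 * \<epsilon>)) powr (- real DIM('a) / 2) = 2 powr (- real DIM('a) / 2) * (2 * pi * \<epsilon>) powr (- real DIM('a) / 2)"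
      using e by (subst powr_mult[symmetric]) (auto simp: mult_ac)
    then show ?thesis
      using mult_left_mono[OF ex, of "2 powr (- real DIM('a) / 2) * (2 * pi * \<epsilon>) powr (- real DIM('a) / 2)"]
      by (simp add: heat_def c_def mult_ac)
  qed
  have "(\<integral>\<^sup>+y. ennreal (heat \<epsilon> (a - y)) * ennreal (gr y) \<partial>lborel) \<le> ennreal (B / (c * I))" for a
  proof -
    have pt: "ennreal (c * I) * ennreal (heat \<epsilon> z) \<le> (\<integral>\<^sup>+w. ennreal (heat (2 * \<epsilon>) w) * ennreal (bump 1 (z - w)) \<partial>lborel)" for z :: 'a
    proof -
      have "ennreal (c * I) * ennreal (heat \<epsilon> z) = ennreal (c * heat \<epsilon> z) * ennreal I"
        using c I by (simp add: mult_ac flip: ennreal_mult)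
      also have "ennreal I = (\<integral>\<^sup>+w. ennreal (bump 1 (w::'a)) \<partial>lborel)"
        unfolding I_def using bump_integral(1)[of 1, where 'a = 'a] by (intro nn_integral_eq_integral[symmetric]) auto
      also have "\<dots> = (\<integral>\<^sup>+w. ennreal (bump 1 (z - w)) \<partial>lborel)"
        by (rule nn_integral_lborel_reflect[symmetric]) measurable
      also have "ennreal (c * heat \<epsilon> z) * \<dots> = (\<integral>\<^sup>+w. ennreal (c * heat \<epsilon> z) * ennreal (bump 1 (z - w)) \<partial>lborel)"
        by (rule nn_integral_cmult[symmetric]) measurable
      also have "\<dots> \<le> (\<integral>\<^sup>+w. ennreal (heat (2 * \<epsilon>) w) * ennreal (bump 1 (z - w)) \<partial>lborel)"
      proof (rule nn_integral_mono)
        fix w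
        show "ennreal (c * heat \<epsilon> z) * ennreal (bump 1 (z - w)) \<le> ennreal (heat (2 * \<epsilon>) w) * ennreal (bump 1 (z - w))"
          using heat_le[of z w] by (cases "norm (z - w) < 1") (auto intro!: mult_right_mono ennreal_leI simp: bump_eq_0)
      qed
      finally show ?thesis .
    qed
    have "ennreal (c * I) * (\<integral>\<^sup>+y. ennreal (heat \<epsilon> (a - y)) * ennreal (gr y) \<partial>lborel)
       = (\<integral>\<^sup>+y. ennreal (c * I) * ennreal (heat \<epsilon> (a - y)) * ennreal (gr y) \<partial>lborel)"
      by (subst nn_integral_cmult[symmetric]) (auto simp: mult.assoc)
    also have "\<dots> \<le> (\<integral>\<^sup>+y. (\<integral>\<^sup>+w. ennreal (heat (2 * \<epsilon>) w) * ennreal (bump 1 (a - y - w)) \<partial>lborel) * ennreal (gr y) \<partial>lborel)"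
      by (intro nn_integral_mono mult_right_mono pt) simp
    also have "\<dots> = (\<integral>\<^sup>+y. (\<integral>\<^sup>+w. ennreal (heat (2 * \<epsilon>) w) * (ennreal (gr y) * ennreal (bump 1 (a - w - y))) \<partial>lborel) \<partial>lborel)"
      by (intro nn_integral_cong, subst nn_integral_multc[symmetric]) (auto simp: mult_ac algebra_simps)
    also have "\<dots> = (\<integral>\<^sup>+w. (\<integral>\<^sup>+y. ennreal (heat (2 * \<epsilon>) w) * (ennreal (gr y) * ennreal (bump 1 (a - w - y))) \<partial>lborel) \<partial>lborel)"
      by (rule lborel_pair.Fubini') measurable
    also have "\<dots> = (\<integral>\<^sup>+w. ennreal (heat (2 * \<epsilon>) w) * (\<integral>\<^sup>+y. ennreal (gr y) * ennreal (bump 1 (a - w - y)) \<partial>lborel) \<partial>lborel)"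
      by (intro nn_integral_cong nn_integral_cmult) measurable
    also have "\<dots> \<le> (\<integral>\<^sup>+w. ennreal (heat (2 * \<epsilon>) (w::'a)) * ennreal B \<partial>lborel)"
      by (intro nn_integral_mono mult_left_mono B) simp
    also have "\<dots> = ennreal B"
      using e by (subst nn_integral_multc) (auto simp: heat_integral)
    finally have "ennreal (1 / (c * I)) * (ennreal (c * I) * (\<integral>\<^sup>+y. ennreal (heat \<epsilon> (a - y)) * ennreal (gr y) \<partial>lborel)) \<le> ennreal (1 / (c * I)) * ennreal B"
      by (rule mult_left_mono) simp
    then show ?thesis using c I B(1) by (simp add: mult.assoc[symmetric] flip: ennreal_mult)
  qed
  moreover have "B / (c * I) \<ge> 0" using B c I by simp
  ultimately show ?thesis using that by blast
qed

section \<open>Kernel bounds in dimensions one and two\<close>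

text \<open>On the line \<open>G\<close> is bounded with compact support, so a multiple of one bump
  of radius \<open>2 * T\<close> dominates it for all \<open>t \<le> T\<close>.\<close>

lemma G_bound_line:
  assumes D: "DIM('a) = 1" and T: "T > 0"
  obtains B where "B \<ge> 0" "\<And>t x. t \<le> T \<Longrightarrow> (\<integral>\<^sup>+y. ennreal (G t (x - y)) * ennreal (gr y) \<partial>lborel) \<le> ennreal B"
    "\<And>t x. t \<le> T \<Longrightarrow> (\<integral>\<^sup>+y. ennreal (G t (x - y :: 'a)) \<partial>lborel) \<le> ennreal B"
proof -
  obtain B where B: "B \<ge> 0" "\<And>x. (\<integral>\<^sup>+y. ennreal (gr y) * ennreal (bump (2 * T) (x - y)) \<partial>lborel) \<le> ennreal B"
    by (rule bump_bound[of "2 * T"]) (use T in auto)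
  \<comment> \<open>The inverse of the lower bound in \<open>bump_ge\<close>: on the ball of radius
    \<open>T\<close> the scaled bump is at least 1.\<close>
  define c :: real where "c = exp (1 / 3)"
  have c: "c > 0" by (simp add: c_def)
  have GB: "G t z \<le> c * bump (2 * T) z" if "t \<le> T" for t and z :: 'a
  proof (cases "norm z < t")
    case True
    then have "exp (- 1 / 3) \<le> bump (2 * T) z" using that T by (intro bump_ge) auto
    then have "c * exp (- 1 / 3) \<le> c * bump (2 * T) z" using c by (intro mult_left_mono) auto
    moreover have "c * exp (- 1 / 3) = 1" by (simp add: c_def flip: exp_add)
    ultimately show ?thesis using True D by (simp add: G_def)
  qed (use c in \<open>simp add: G_def\<close>)
  define J where "J = (\<integral>x. bump (2 * T) (x::'a) \<partial>lborel)"
  have J: "J \<ge> 0" "(\<integral>\<^sup>+x. ennreal (bump (2 * T) (x::'a)) \<partial>lborel) = ennreal J"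
    unfolding J_def using bump_integral[of "2 * T", where 'a = 'a] T
    by (auto intro!: nn_integral_eq_integral less_imp_le)
  show ?thesis
  proof
    show "c * B + c * J \<ge> 0" using c B J by simp
    fix t :: real and x :: 'a assume t: "t \<le> T"
    have "(\<integral>\<^sup>+y. ennreal (G t (x - y)) * ennreal (gr y) \<partial>lborel)
      \<le> (\<integral>\<^sup>+y. ennreal c * (ennreal (gr y) * ennreal (bump (2 * T) (x - y))) \<partial>lborel)"
    proof (rule nn_integral_mono)
      fix y
      have "G t (x - y) * gr y \<le> c * (gr y * bump (2 * T) (x - y))"
        using mult_right_mono[OF GB[OF t, of "x - y"], of "gr y"] by (simp add: mult_ac)
      then show "ennreal (G t (x - y)) * ennreal (gr y) \<le> ennreal c * (ennreal (gr y) * ennreal (bump (2 * T) (x - y)))"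
        using c by (simp add: ennreal_leI flip: ennreal_mult)
    qed
    also have "\<dots> = ennreal c * (\<integral>\<^sup>+y. ennreal (gr y) * ennreal (bump (2 * T) (x - y)) \<partial>lborel)"
      by (rule nn_integral_cmult) measurable
    also have "\<dots> \<le> ennreal c * ennreal B" by (intro mult_left_mono B) simp
    also have "\<dots> \<le> ennreal (c * B + c * J)" using c B J by (simp add: ennreal_leI flip: ennreal_mult)
    finally show "(\<integral>\<^sup>+y. ennreal (G t (x - y)) * ennreal (gr y) \<partial>lborel) \<le> ennreal (c * B + c * J)" .
    have "(\<integral>\<^sup>+y. ennreal (G t (x - y)) \<partial>lborel) = (\<integral>\<^sup>+y. ennreal (G t (y::'a)) \<partial>lborel)"
      by (rule nn_integral_lborel_reflect) measurable
    also have "\<dots> \<le> (\<integral>\<^sup>+y. ennreal c * ennreal (bump (2 * T) (y::'a)) \<partial>lborel)"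
      using c by (intro nn_integral_mono) (simp add: ennreal_leI GB[OF t] flip: ennreal_mult)
    also have "\<dots> = ennreal c * (\<integral>\<^sup>+y. ennreal (bump (2 * T) (y::'a)) \<partial>lborel)"
      by (rule nn_integral_cmult) measurable
    also have "\<dots> \<le> ennreal (c * B + c * J)" using c B J by (simp add: ennreal_leI flip: ennreal_mult)
    finally show "(\<integral>\<^sup>+y. ennreal (G t (x - y)) \<partial>lborel) \<le> ennreal (c * B + c * J)" .
  qed
qed

definition spectral_mass :: real where
  "spectral_mass = (\<integral>\<xi>. (1 + (norm \<xi>)\<^sup>2) powr (- 1 / 2) \<partial>\<mu>)"

lemma weight_integrable: "integrable \<mu> (\<lambda>\<xi>. (1 + (norm \<xi>)\<^sup>2) powr (- 1 / 2))"
proof (rule integrableI_bounded)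
  show "(\<lambda>\<xi>. (1 + (norm \<xi>)\<^sup>2) powr (- 1 / 2)) \<in> borel_measurable \<mu>" by measurable
  show "(\<integral>\<^sup>+\<xi>. ennreal (norm ((1 + (norm \<xi>)\<^sup>2) powr (- 1 / 2))) \<partial>\<mu>) < \<infinity>"
    using C by (simp add: condition_C_def)
qed

text \<open>Fubini moves the frequency integral outside; the inner one is, up to a phase, the
  transform of the bump times that of \<open>G t\<close>. Integrability of \<open>F\<close> licenses
  Fubini, but the bound uses \<open>norm (F \<xi>) \<le> I\<close>, so that dividing by the mass
  \<open>I\<close> later removes every trace of \<open>r\<close>.\<close>

lemma G_mollified_bound:
  assumes D: "DIM('a) = 2" and t: "t > 0" and r: "r > 0"
  shows "(\<integral>\<^sup>+w. ennreal (G t (x - w)) * (\<integral>\<^sup>+y. ennreal (gr y) * ennreal (bump r (w - y)) \<partial>lborel) \<partial>lborel)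
    \<le> ennreal ((\<integral>z. bump r (z::'a) \<partial>lborel) * (2 * (1 + t) * spectral_mass))"
proof -
  interpret mu: sigma_finite_measure \<mu> by (rule mu_sigma_finite)
  interpret lm: pair_sigma_finite "lborel :: 'a measure" \<mu> ..
  define I where "I = (\<integral>z. bump r (z::'a) \<partial>lborel)"
  define F where "F = fourier (bump r :: 'a \<Rightarrow> real)"
  have Fi: "complex_integrable \<mu> F" unfolding F_def by (rule bump_spectral(1)[OF r])
  then have Fm [measurable]: "F \<in> borel_measurable \<mu>" by auto
  have FI: "norm (F \<xi>) \<le> I" for \<xi>
  proof -
    have "norm (F \<xi>) \<le> (\<integral>x. norm (cis (- (\<xi> \<bullet> x)) * of_real (bump r x)) \<partial>lborel)"
      unfolding F_def fourier_def by (rule integral_norm_bound)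
    then show ?thesis by (simp add: norm_mult I_def)
  qed
  define \<Phi> where "\<Phi> w = (\<integral>y. gr y * bump r (w - y) \<partial>lborel)" for w
  have \<Phi>0: "\<Phi> w \<ge> 0" for w unfolding \<Phi>_def by (intro integral_nonneg_AE) auto
  have \<Phi>: "(\<integral>\<^sup>+y. ennreal (gr y) * ennreal (bump r (w - y)) \<partial>lborel) = ennreal (\<Phi> w)" for w
    using bump_spectral(2)[OF r, of w] by (simp add: \<Phi>_def ennreal_mult)
  have \<Phi>F: "complex_of_real (\<Phi> w) = (CLINT \<xi>|\<mu>. cis (- (\<xi> \<bullet> w)) * F \<xi>)" for w
    unfolding \<Phi>_def F_def by (rule bump_spectral(3)[OF r])
  define H where "H w \<xi> = of_real (G t (x - w)) * (cis (- (\<xi> \<bullet> w)) * F \<xi>)" for w \<xi>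
  have Gmass: "(\<integral>\<^sup>+w. ennreal (G t (x - w)) \<partial>lborel) = ennreal t"
    using nn_integral_lborel_reflect[of "\<lambda>w. ennreal (G t w)" x] G_plane_integrable[OF D t] by simp
  have Hm: "(\<lambda>(w, \<xi>). H w \<xi>) \<in> borel_measurable (lborel \<Otimes>\<^sub>M \<mu>)"
    unfolding H_def by measurable
  have Hi: "complex_integrable (lborel \<Otimes>\<^sub>M \<mu>) (\<lambda>(w, \<xi>). H w \<xi>)"
  proof (rule integrableI_bounded[OF Hm])
    have "(\<integral>\<^sup>+z. ennreal (norm (case z of (w, \<xi>) \<Rightarrow> H w \<xi>)) \<partial>(lborel \<Otimes>\<^sub>M \<mu>)) =
       (\<integral>\<^sup>+w. \<integral>\<^sup>+\<xi>. ennreal (norm (H w \<xi>)) \<partial>\<mu> \<partial>lborel)"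
      using mu.nn_integral_fst[OF measurable_compose[OF measurable_compose[OF Hm borel_measurable_norm] measurable_ennreal]]
      by simp
    also have "\<dots> = (\<integral>\<^sup>+w. ennreal (G t (x - w)) * (\<integral>\<^sup>+\<xi>. ennreal (norm (F \<xi>)) \<partial>\<mu>) \<partial>lborel)"
      by (intro nn_integral_cong) (simp add: H_def norm_mult ennreal_mult nn_integral_cmult)
    also have "\<dots> = ennreal t * (\<integral>\<^sup>+\<xi>. ennreal (norm (F \<xi>)) \<partial>\<mu>)"
      by (simp add: nn_integral_multc Gmass)
    also have "\<dots> < \<infinity>" using Fi by (auto simp: integrable_iff_bounded ennreal_mult_less_top)
    finally show "(\<integral>\<^sup>+z. ennreal (norm (case z of (w, \<xi>) \<Rightarrow> H w \<xi>)) \<partial>(lborel \<Otimes>\<^sub>M \<mu>)) < \<infinity>" .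
  qed
  have inner1: "(CLINT \<xi>|\<mu>. H w \<xi>) = of_real (G t (x - w) * \<Phi> w)" for w
    unfolding H_def of_real_mult \<Phi>F by (rule integral_mult_right_zero)
  have inner2: "norm (CLINT w|lborel. H w \<xi>) \<le> I * (2 * (1 + t) * (1 + (norm \<xi>)\<^sup>2) powr (- 1 / 2))" for \<xi>
  proof -
    \<comment> \<open>The reflection \<open>w = x - u\<close> produces the transform of
      \<open>G t\<close> at frequency \<open>- \<xi>\<close>.\<close>
    have "(CLINT w|lborel. H w \<xi>) = (CLINT w|distr lborel borel (\<lambda>u. x - u). H w \<xi>)"
      unfolding lborel_distr_reflect ..
    also have "\<dots> = (CLINT u|lborel. H (x - u) \<xi>)"
      unfolding H_def by (rule integral_distr) measurable
    also have "\<dots> = (CLINT u|lborel. (F \<xi> * cis (- (\<xi> \<bullet> x))) * (cis (- (- \<xi> \<bullet> u)) * of_real (G t u)))"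
    proof (rule Bochner_Integration.integral_cong[OF refl])
      fix u
      have "cis (- (\<xi> \<bullet> (x - u))) = cis (- (\<xi> \<bullet> x)) * cis (- (- \<xi> \<bullet> u))"
        by (simp add: cis_mult inner_diff_right)
      then show "H (x - u) \<xi> = (F \<xi> * cis (- (\<xi> \<bullet> x))) * (cis (- (- \<xi> \<bullet> u)) * of_real (G t u))"
        by (simp only: H_def mult_ac diff_diff_eq2 add_diff_cancel_left')
    qed
    also have "\<dots> = (F \<xi> * cis (- (\<xi> \<bullet> x))) * fourier (G t) (- \<xi>)"
      unfolding fourier_def by (rule integral_mult_right_zero)
    finally have "norm (CLINT w|lborel. H w \<xi>) = norm (F \<xi>) * norm (fourier (G t) (- \<xi>))"
      by (simp add: norm_mult)
    also have "\<dots> \<le> I * (2 * (1 + t) * (1 + (norm \<xi>)\<^sup>2) powr (- 1 / 2))"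
      using fourier_G_plane_weight[OF D t, of "- \<xi>"] FI[of \<xi>] order_trans[OF norm_ge_zero FI[of \<xi>]]
      by (intro mult_mono) auto
    finally show ?thesis .
  qed
  have i1: "complex_integrable lborel (\<lambda>w. complex_of_real (G t (x - w) * \<Phi> w))"
    using lm.integrable_fst[OF Hi] unfolding inner1 .
  then have i2: "integrable lborel (\<lambda>w. G t (x - w) * \<Phi> w)"
    by (simp only: complex_of_real_integrable_eq)
  have "(\<integral>\<^sup>+w. ennreal (G t (x - w)) * (\<integral>\<^sup>+y. ennreal (gr y) * ennreal (bump r (w - y)) \<partial>lborel) \<partial>lborel)
    = (\<integral>\<^sup>+w. ennreal (G t (x - w) * \<Phi> w) \<partial>lborel)"
    unfolding \<Phi> by (simp add: ennreal_mult \<Phi>0)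
  also have "\<dots> = ennreal (\<integral>w. G t (x - w) * \<Phi> w \<partial>lborel)"
    by (rule nn_integral_eq_integral[OF i2]) (simp add: \<Phi>0)
  also have "\<dots> \<le> ennreal (I * (2 * (1 + t) * spectral_mass))"
  proof (rule ennreal_leI)
    have "(\<integral>w. G t (x - w) * \<Phi> w \<partial>lborel) \<le> norm (complex_of_real (\<integral>w. G t (x - w) * \<Phi> w \<partial>lborel))" by simp
    also have "complex_of_real (\<integral>w. G t (x - w) * \<Phi> w \<partial>lborel) = (CLINT w|lborel. complex_of_real (G t (x - w) * \<Phi> w))"
      by (rule integral_complex_of_real[symmetric])
    also have "\<dots> = (CLINT w|lborel. CLINT \<xi>|\<mu>. H w \<xi>)" unfolding inner1 ..
    also have "\<dots> = (CLINT \<xi>|\<mu>. CLINT w|lborel. H w \<xi>)"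
      by (rule lm.Fubini_integral[symmetric, OF Hi])
    also have "norm \<dots> \<le> (\<integral>\<xi>. I * (2 * (1 + t) * (1 + (norm \<xi>)\<^sup>2) powr (- 1 / 2)) \<partial>\<mu>)"
    proof (rule order_trans[OF integral_norm_bound integral_mono])
      show "integrable \<mu> (\<lambda>\<xi>. norm (CLINT w|lborel. H w \<xi>))"
        using lm.integrable_snd[OF Hi] by (rule integrable_norm)
      show "integrable \<mu> (\<lambda>\<xi>. I * (2 * (1 + t) * (1 + (norm \<xi>)\<^sup>2) powr (- 1 / 2)))"
        by (intro integrable_mult_right weight_integrable)
    qed (rule inner2)
    also have "\<dots> = I * (2 * (1 + t) * spectral_mass)"
      by (simp add: spectral_mass_def)
    finally show "(\<integral>w. G t (x - w) * \<Phi> w \<partial>lborel) \<le> I * (2 * (1 + t) * spectral_mass)" .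
  qed
  finally show ?thesis unfolding I_def .
qed

text \<open>Fatou with the kernel mollified at scale 1 / (k + 1). The pointwise lower bound uses
  continuity of \<open>G\<close> inside the light cone only, since \<open>G\<close> is 0 elsewhere;
  Tonelli moves the mollification onto \<open>gr\<close>, where \<open>G_mollified_bound\<close>
  applies.\<close>

lemma G_bound_plane:
  assumes D: "DIM('a) = 2" and t: "t > 0"
  shows "(\<integral>\<^sup>+y. ennreal (G t (x - y)) * ennreal (gr y) \<partial>lborel) \<le> ennreal (2 * (1 + t) * spectral_mass)"
proof -
  define r where "r k = 1 / real (Suc k)" for k
  define I where "I k = (\<integral>z. bump (r k) (z::'a) \<partial>lborel)" for k
  have r: "r k > 0" for k by (simp add: r_def)
  have I: "I k > 0" for k unfolding I_def by (rule bump_integral(2)[OF r])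
  define L where "L k y = ennreal (gr y) * (\<integral>\<^sup>+w. ennreal (G t (x - w)) * ennreal (bump (r k) (w - y) / I k) \<partial>lborel)" for k y
  have Lm: "L k \<in> borel_measurable lborel" for k unfolding L_def[abs_def] by measurable
  have pt: "ennreal (G t (x - y)) * ennreal (gr y) \<le> liminf (\<lambda>k. L k y)" for y
  proof (cases "norm (x - y) < t")
    case True
    have "ennreal (gr y * G t (x - y)) \<le> liminf (\<lambda>k. L k y)"
      unfolding L_def r_def I_def
      by (rule ennreal_le_liminf_smoothing) (use True in \<open>auto intro: isCont_G\<close>)
    then show ?thesis by (simp add: ennreal_mult mult.commute)
  qed (simp add: G_def)
  have bd: "(\<integral>\<^sup>+y. L k y \<partial>lborel) \<le> ennreal (2 * (1 + t) * spectral_mass)" for k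
  proof -
    have "(\<integral>\<^sup>+y. L k y \<partial>lborel) = (\<integral>\<^sup>+y. (\<integral>\<^sup>+w. ennreal (1 / I k) * (ennreal (G t (x - w)) * (ennreal (gr y) * ennreal (bump (r k) (w - y)))) \<partial>lborel) \<partial>lborel)"
    proof (rule nn_integral_cong)
      fix y
      have "L k y = (\<integral>\<^sup>+w. ennreal (gr y) * (ennreal (G t (x - w)) * ennreal (bump (r k) (w - y) / I k)) \<partial>lborel)"
        unfolding L_def by (rule nn_integral_cmult[symmetric]) measurable
      also have "\<dots> = (\<integral>\<^sup>+w. ennreal (1 / I k) * (ennreal (G t (x - w)) * (ennreal (gr y) * ennreal (bump (r k) (w - y)))) \<partial>lborel)"
        using I[of k] by (intro nn_integral_cong) (simp add: mult_ac flip: ennreal_mult)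
      finally show "L k y = \<dots>" .
    qed
    also have "\<dots> = (\<integral>\<^sup>+w. (\<integral>\<^sup>+y. ennreal (1 / I k) * (ennreal (G t (x - w)) * (ennreal (gr y) * ennreal (bump (r k) (w - y)))) \<partial>lborel) \<partial>lborel)"
      by (rule lborel_pair.Fubini') measurable
    also have "\<dots> = (\<integral>\<^sup>+w. ennreal (1 / I k) * (ennreal (G t (x - w)) * (\<integral>\<^sup>+y. ennreal (gr y) * ennreal (bump (r k) (w - y)) \<partial>lborel)) \<partial>lborel)"
      by (intro nn_integral_cong) (simp add: nn_integral_cmult)
    also have "\<dots> = ennreal (1 / I k) * (\<integral>\<^sup>+w. ennreal (G t (x - w)) * (\<integral>\<^sup>+y. ennreal (gr y) * ennreal (bump (r k) (w - y)) \<partial>lborel) \<partial>lborel)"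
      by (rule nn_integral_cmult) measurable
    also have "\<dots> \<le> ennreal (1 / I k) * ennreal (I k * (2 * (1 + t) * spectral_mass))"
      unfolding I_def by (intro mult_left_mono G_mollified_bound[OF D t r]) simp
    also have "\<dots> = ennreal (1 / I k * (I k * (2 * (1 + t) * spectral_mass)))"
      using I[of k] by (intro ennreal_mult'[symmetric]) simp
    also have "1 / I k * (I k * (2 * (1 + t) * spectral_mass)) = 2 * (1 + t) * spectral_mass"
      using I[of k] by simp
    finally show ?thesis .
  qed
  have "(\<integral>\<^sup>+y. ennreal (G t (x - y)) * ennreal (gr y) \<partial>lborel) \<le> (\<integral>\<^sup>+y. liminf (\<lambda>k. L k y) \<partial>lborel)"
    by (intro nn_integral_mono pt)
  also have "\<dots> \<le> liminf (\<lambda>k. \<integral>\<^sup>+y. L k y \<partial>lborel)"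
    by (rule nn_integral_liminf[OF Lm])
  also have "\<dots> \<le> ennreal (2 * (1 + t) * spectral_mass)"
    using Liminf_mono[of "\<lambda>k. \<integral>\<^sup>+y. L k y \<partial>lborel" "\<lambda>_. ennreal (2 * (1 + t) * spectral_mass)" sequentially] bd
    by (simp add: Liminf_const)
  finally show ?thesis .
qed

lemma G_bound:
  assumes T: "T > 0"
  obtains B where "B \<ge> 1" "\<And>t x. t \<le> T \<Longrightarrow> (\<integral>\<^sup>+y. ennreal (G t (x - y)) * ennreal (gr y) \<partial>lborel) \<le> ennreal B"
    "\<And>t x. t \<le> T \<Longrightarrow> (\<integral>\<^sup>+y. ennreal (G t (x - y :: 'a)) \<partial>lborel) \<le> ennreal B"
proof (cases "DIM('a) = 1")
  case True
  obtain B where B: "B \<ge> 0" "\<And>t x. t \<le> T \<Longrightarrow> (\<integral>\<^sup>+y. ennreal (G t (x - y)) * ennreal (gr y) \<partial>lborel) \<le> ennreal B"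
    "\<And>t x. t \<le> T \<Longrightarrow> (\<integral>\<^sup>+y. ennreal (G t (x - y :: 'a)) \<partial>lborel) \<le> ennreal B"
    using G_bound_line[OF True T] by metis
  have le: "ennreal B \<le> ennreal (B + 1)" by (intro ennreal_leI) simp
  show ?thesis
  proof (rule that[of "B + 1"])
    show "1 \<le> B + 1" using B(1) by simp
  qed (rule order_trans[OF B(2) le] order_trans[OF B(3) le], assumption)+
next
  case False
  then have D: "DIM('a) = 2" using dim by simp
  have sm: "spectral_mass \<ge> 0" by (simp add: spectral_mass_def)
  \<comment> \<open>The summand 1 secures \<open>B \<ge> 1\<close>, \<open>T\<close> bounds the mass
    of \<open>G\<close>, and the last term is the plane bound at time \<open>T\<close>.\<close>
  define B where "B = 1 + T + 2 * (1 + T) * spectral_mass"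
  show ?thesis
  proof
    show "B \<ge> 1" using T sm by (simp add: B_def)
    fix t :: real and x :: 'a assume t: "t \<le> T"
    show "(\<integral>\<^sup>+y. ennreal (G t (x - y)) * ennreal (gr y) \<partial>lborel) \<le> ennreal B"
    proof (cases "t > 0")
      case True
      have "(1 + t) * spectral_mass \<le> (1 + T) * spectral_mass" using sm t by (intro mult_right_mono) auto
      then have "2 * (1 + t) * spectral_mass \<le> B" unfolding B_def using T by linarith
      then show ?thesis using G_bound_plane[OF D True, of x] ennreal_leI order_trans by blast
    qed (simp add: G_nonpos)
    show "(\<integral>\<^sup>+y. ennreal (G t (x - y :: 'a)) \<partial>lborel) \<le> ennreal B"
    proof (cases "t > 0")
      case True
      have "(\<integral>\<^sup>+y. ennreal (G t (x - y :: 'a)) \<partial>lborel) = ennreal t"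
        using nn_integral_lborel_reflect[of "\<lambda>w. ennreal (G t w)" x] G_plane_integrable[OF D True] by simp
      also have "\<dots> \<le> ennreal B" using T t sm unfolding B_def by (intro ennreal_leI) (simp add: add_increasing2)
      finally show ?thesis .
    qed (simp add: G_nonpos)
  qed
qed

end

section \<open>The mollified noise\<close>

text \<open>Young's inequality |u| \<le> e / 2 + u^2 / (2 e) in place of Cauchy-Schwarz, which stays
  within \<open>ennreal\<close> integrals.\<close>

lemma nn_integral_abs_le_of_square:
  assumes M: "prob_space M" and [measurable]: "u \<in> borel_measurable M" and e: "e > 0"
    and le: "(\<integral>\<^sup>+\<omega>. ennreal ((u \<omega>)\<^sup>2) \<partial>M) \<le> ennreal (e\<^sup>2)"
  shows "(\<integral>\<^sup>+\<omega>. ennreal \<bar>u \<omega>\<bar> \<partial>M) \<le> ennreal e"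
proof -
  interpret prob_space M by fact
  have "(\<integral>\<^sup>+\<omega>. ennreal \<bar>u \<omega>\<bar> \<partial>M) \<le> (\<integral>\<^sup>+\<omega>. ennreal (e / 2) + ennreal (1 / (2 * e)) * ennreal ((u \<omega>)\<^sup>2) \<partial>M)"
  proof (rule nn_integral_mono)
    fix \<omega>
    have "\<bar>u \<omega>\<bar> * (2 * e) \<le> e\<^sup>2 + (u \<omega>)\<^sup>2"
      using zero_le_power2[of "\<bar>u \<omega>\<bar> - e"] by (simp add: power2_eq_square algebra_simps)
    then have "\<bar>u \<omega>\<bar> \<le> (e\<^sup>2 + (u \<omega>)\<^sup>2) / (2 * e)" using e by (simp add: pos_le_divide_eq)
    also have "\<dots> = e / 2 + 1 / (2 * e) * (u \<omega>)\<^sup>2" using e by (simp add: field_simps power2_eq_square)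
    finally show "ennreal \<bar>u \<omega>\<bar> \<le> ennreal (e / 2) + ennreal (1 / (2 * e)) * ennreal ((u \<omega>)\<^sup>2)"
      using e by (simp add: ennreal_leI flip: ennreal_mult ennreal_plus)
  qed
  also have "\<dots> = ennreal (e / 2) + ennreal (1 / (2 * e)) * (\<integral>\<^sup>+\<omega>. ennreal ((u \<omega>)\<^sup>2) \<partial>M)"
    by (simp add: nn_integral_add nn_integral_cmult emeasure_space_1)
  also have "\<dots> \<le> ennreal (e / 2) + ennreal (1 / (2 * e)) * ennreal (e\<^sup>2)"
    by (intro add_left_mono mult_left_mono le) simp
  also have "\<dots> = ennreal (e / 2 + 1 / (2 * e) * e\<^sup>2)"
    using e by (simp flip: ennreal_mult ennreal_plus)
  also have "e / 2 + 1 / (2 * e) * e\<^sup>2 = e" using e by (simp add: power2_eq_square)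
  finally show ?thesis .
qed

text \<open>\<open>cis\<close> is 1-Lipschitz, so the difference is bounded by L^1 distances, and on
  a probability space these are controlled by L^2 distances.\<close>

lemma tendsto_expectation_cis:
  fixes u :: "nat \<Rightarrow> nat \<Rightarrow> 'w \<Rightarrow> real"
  assumes M: "prob_space M" and I: "finite I"
    and [measurable]: "\<And>k i. i \<in> I \<Longrightarrow> u k i \<in> borel_measurable M" "\<And>i. i \<in> I \<Longrightarrow> w i \<in> borel_measurable M"
    and lim: "\<And>i. i \<in> I \<Longrightarrow> (\<lambda>k. \<integral>\<^sup>+\<omega>. ennreal ((u k i \<omega> - w i \<omega>)\<^sup>2) \<partial>M) \<longlonglongrightarrow> 0"
  shows "(\<lambda>k. CLINT \<omega>|M. cis (\<Sum>i\<in>I. c i * u k i \<omega>)) \<longlonglongrightarrow> (CLINT \<omega>|M. cis (\<Sum>i\<in>I. c i * w i \<omega>))"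
proof (rule LIMSEQ_I)
  interpret prob_space M by fact
  fix r :: real assume r: "r > 0"
  define s where "s = 1 + (\<Sum>i\<in>I. \<bar>c i\<bar>)"
  have s: "s > 0" unfolding s_def by (simp add: add_pos_nonneg sum_nonneg)
  define e where "e = r / (2 * s)"
  have e: "e > 0" using r s by (simp add: e_def)
  have "\<forall>\<^sub>F k in sequentially. \<forall>i\<in>I. (\<integral>\<^sup>+\<omega>. ennreal ((u k i \<omega> - w i \<omega>)\<^sup>2) \<partial>M) < ennreal (e\<^sup>2)"
    using e by (intro eventually_ball_finite I ballI order_tendstoD(2)[OF lim]) auto
  then obtain N where N: "\<And>k i. k \<ge> N \<Longrightarrow> i \<in> I \<Longrightarrow> (\<integral>\<^sup>+\<omega>. ennreal ((u k i \<omega> - w i \<omega>)\<^sup>2) \<partial>M) < ennreal (e\<^sup>2)"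
    by (auto simp: eventually_sequentially)
  have "norm ((CLINT \<omega>|M. cis (\<Sum>i\<in>I. c i * u k i \<omega>)) - (CLINT \<omega>|M. cis (\<Sum>i\<in>I. c i * w i \<omega>))) < r" if k: "k \<ge> N" for k
  proof -
    let ?f = "\<lambda>\<omega>. cis (\<Sum>i\<in>I. c i * u k i \<omega>) - cis (\<Sum>i\<in>I. c i * w i \<omega>)"
    have m1: "(\<lambda>\<omega>. cis (\<Sum>i\<in>I. c i * u k i \<omega>)) \<in> borel_measurable M" by measurable
    have m2: "(\<lambda>\<omega>. cis (\<Sum>i\<in>I. c i * w i \<omega>)) \<in> borel_measurable M" by measurable
    have i1: "complex_integrable M (\<lambda>\<omega>. cis (\<Sum>i\<in>I. c i * u k i \<omega>))"
      by (rule integrable_const_bound[of _ 1]) (use m1 in auto)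
    have i2: "complex_integrable M (\<lambda>\<omega>. cis (\<Sum>i\<in>I. c i * w i \<omega>))"
      by (rule integrable_const_bound[of _ 1]) (use m2 in auto)
    have "ennreal (norm (CLINT \<omega>|M. ?f \<omega>)) \<le> (\<integral>\<^sup>+\<omega>. ennreal (norm (?f \<omega>)) \<partial>M)"
      using i1 i2 by (intro integral_norm_bound_ennreal Bochner_Integration.integrable_diff)
    also have "\<dots> \<le> (\<integral>\<^sup>+\<omega>. (\<Sum>i\<in>I. ennreal \<bar>c i\<bar> * ennreal \<bar>u k i \<omega> - w i \<omega>\<bar>) \<partial>M)"
    proof (rule nn_integral_mono)
      fix \<omega>
      have "norm (?f \<omega>) \<le> \<bar>(\<Sum>i\<in>I. c i * u k i \<omega>) - (\<Sum>i\<in>I. c i * w i \<omega>)\<bar>" by (rule norm_cis_diff_le)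
      also have "(\<Sum>i\<in>I. c i * u k i \<omega>) - (\<Sum>i\<in>I. c i * w i \<omega>) = (\<Sum>i\<in>I. c i * (u k i \<omega> - w i \<omega>))"
        by (simp add: sum_subtractf right_diff_distrib)
      also have "\<bar>\<dots>\<bar> \<le> (\<Sum>i\<in>I. \<bar>c i * (u k i \<omega> - w i \<omega>)\<bar>)" by (rule sum_abs)
      finally show "ennreal (norm (?f \<omega>)) \<le> (\<Sum>i\<in>I. ennreal \<bar>c i\<bar> * ennreal \<bar>u k i \<omega> - w i \<omega>\<bar>)"
        by (simp add: abs_mult ennreal_leI sum_ennreal flip: ennreal_mult)
    qed
    also have "\<dots> = (\<Sum>i\<in>I. ennreal \<bar>c i\<bar> * (\<integral>\<^sup>+\<omega>. ennreal \<bar>u k i \<omega> - w i \<omega>\<bar> \<partial>M))"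
      by (simp add: nn_integral_sum nn_integral_cmult)
    also have "\<dots> \<le> (\<Sum>i\<in>I. ennreal \<bar>c i\<bar> * ennreal e)"
      using N[OF k] by (intro sum_mono mult_left_mono nn_integral_abs_le_of_square[OF M] e) (auto intro: less_imp_le)
    also have "\<dots> = ennreal ((\<Sum>i\<in>I. \<bar>c i\<bar>) * e)"
      using e by (simp add: sum_distrib_right flip: ennreal_mult)
    finally have "norm (CLINT \<omega>|M. ?f \<omega>) \<le> (\<Sum>i\<in>I. \<bar>c i\<bar>) * e"
      using e by (simp add: sum_nonneg)
    also have "\<dots> < s * e" using e by (simp add: s_def)
    also have "\<dots> < r" using r s by (simp add: e_def)
    finally show ?thesis using i1 i2 by simp
  qed
  then show "\<exists>no. \<forall>k\<ge>no. norm ((CLINT \<omega>|M. cis (\<Sum>i\<in>I. c i * u k i \<omega>)) - (CLINT \<omega>|M. cis (\<Sum>i\<in>I. c i * w i \<omega>))) < r"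
    by blast
qed

context spectral_kernel
begin

definition cov :: "real \<Rightarrow> 'a \<Rightarrow> 'a \<Rightarrow> real" where
  "cov \<epsilon> x x' = cov_form \<gamma> (\<lambda>y. heat \<epsilon> (x - y)) (\<lambda>y. heat \<epsilon> (x' - y))"

lemma cov_nn_integral:
  "(\<integral>\<^sup>+z. ennreal (heat \<epsilon> (x - fst z) * heat \<epsilon> (x' - snd z) * gr (fst z - snd z)) \<partial>(lborel \<Otimes>\<^sub>M lborel))
    = (\<integral>\<^sup>+y'. ennreal (heat \<epsilon> (x' - y')) * (\<integral>\<^sup>+y. ennreal (heat \<epsilon> (x - y)) * ennreal (gr (y - y')) \<partial>lborel) \<partial>lborel)"
proof -
  have "(\<integral>\<^sup>+z. ennreal (heat \<epsilon> (x - fst z) * heat \<epsilon> (x' - snd z) * gr (fst z - snd z)) \<partial>(lborel \<Otimes>\<^sub>M lborel))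
    = (\<integral>\<^sup>+y'. \<integral>\<^sup>+y. ennreal (heat \<epsilon> (x - y) * heat \<epsilon> (x' - y') * gr (y - y')) \<partial>lborel \<partial>lborel)"
    by (subst lborel_pair.nn_integral_snd[symmetric]) auto
  also have "\<dots> = (\<integral>\<^sup>+y'. ennreal (heat \<epsilon> (x' - y')) * (\<integral>\<^sup>+y. ennreal (heat \<epsilon> (x - y)) * ennreal (gr (y - y')) \<partial>lborel) \<partial>lborel)"
    by (intro nn_integral_cong, subst nn_integral_cmult[symmetric]) (auto simp: ennreal_mult mult_ac)
  finally show ?thesis .
qed

lemma heat_gr_shift:
  "(\<integral>\<^sup>+y. ennreal (heat \<epsilon> (x - y)) * ennreal (gr (y - y')) \<partial>lborel) = (\<integral>\<^sup>+y. ennreal (heat \<epsilon> (x - y' - y)) * ennreal (gr y) \<partial>lborel)"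
  using nn_integral_lborel_shift[of "\<lambda>y. ennreal (heat \<epsilon> (x - y' - y)) * ennreal (gr y)" "- y'"] by simp

text \<open>Tonelli leaves an average of translates of the integral in \<open>heat_bound\<close>,
  and the averaging heat kernel has mass 1; hence finiteness, and the same bound
  \<open>B\<close>.\<close>

lemma cov_integrable:
  assumes e: "\<epsilon> > 0"
  shows "integrable (lborel \<Otimes>\<^sub>M lborel) (\<lambda>z. heat \<epsilon> (x - fst z) * heat \<epsilon> (x' - snd z) * gr (fst z - snd z))" (is ?i)
    and "ennreal (cov \<epsilon> x x') = (\<integral>\<^sup>+y'. ennreal (heat \<epsilon> (x' - y')) * (\<integral>\<^sup>+y. ennreal (heat \<epsilon> (x - y)) * ennreal (gr (y - y')) \<partial>lborel) \<partial>lborel)"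
    and "cov \<epsilon> x x' \<ge> 0"
    and "\<And>B. (\<And>a. (\<integral>\<^sup>+y. ennreal (heat \<epsilon> (a - y)) * ennreal (gr y) \<partial>lborel) \<le> ennreal B) \<Longrightarrow> B \<ge> 0 \<Longrightarrow> cov \<epsilon> x x' \<le> B"
proof -
  have bd: "(\<integral>\<^sup>+y'. ennreal (heat \<epsilon> (x' - y')) * (\<integral>\<^sup>+y. ennreal (heat \<epsilon> (x - y)) * ennreal (gr (y - y')) \<partial>lborel) \<partial>lborel) \<le> ennreal B"
    if B: "\<And>a. (\<integral>\<^sup>+y. ennreal (heat \<epsilon> (a - y)) * ennreal (gr y) \<partial>lborel) \<le> ennreal B" for B
  proof -
    have "(\<integral>\<^sup>+y'. ennreal (heat \<epsilon> (x' - y')) * (\<integral>\<^sup>+y. ennreal (heat \<epsilon> (x - y)) * ennreal (gr (y - y')) \<partial>lborel) \<partial>lborel)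
      \<le> (\<integral>\<^sup>+y'. ennreal (heat \<epsilon> (x' - y')) * ennreal B \<partial>lborel)"
      unfolding heat_gr_shift by (intro nn_integral_mono mult_left_mono B) simp
    also have "\<dots> = ennreal B"
      by (subst nn_integral_multc) (auto simp: heat_integral_shift[OF e])
    finally show ?thesis .
  qed
  obtain B0 where B0: "B0 \<ge> 0" "\<And>a. (\<integral>\<^sup>+y. ennreal (heat \<epsilon> (a - y)) * ennreal (gr y) \<partial>lborel) \<le> ennreal B0"
    using heat_bound[OF e] by metis
  show i: ?i
  proof (rule integrableI_bounded)
    show "(\<integral>\<^sup>+z. ennreal (norm (heat \<epsilon> (x - fst z) * heat \<epsilon> (x' - snd z) * gr (fst z - snd z))) \<partial>(lborel \<Otimes>\<^sub>M lborel)) < \<infinity>"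
      using cov_nn_integral[of \<epsilon> x x'] bd[OF B0(2)] by (simp add: le_less_trans)
  qed measurable
  have c: "cov \<epsilon> x x' = (\<integral>z. heat \<epsilon> (x - fst z) * heat \<epsilon> (x' - snd z) * gr (fst z - snd z) \<partial>(lborel \<Otimes>\<^sub>M lborel))"
    by (simp add: cov_def cov_form_def gr_def)
  then show e1: "ennreal (cov \<epsilon> x x') = (\<integral>\<^sup>+y'. ennreal (heat \<epsilon> (x' - y')) * (\<integral>\<^sup>+y. ennreal (heat \<epsilon> (x - y)) * ennreal (gr (y - y')) \<partial>lborel) \<partial>lborel)"
    unfolding cov_nn_integral[symmetric] by (simp add: nn_integral_eq_integral[OF i])
  show "cov \<epsilon> x x' \<ge> 0" unfolding c by (intro integral_nonneg_AE) auto
  show "cov \<epsilon> x x' \<le> B" if "\<And>a. (\<integral>\<^sup>+y. ennreal (heat \<epsilon> (a - y)) * ennreal (gr y) \<partial>lborel) \<le> ennreal B" "B \<ge> 0" for B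
    using bd[OF that(1)] that(2) unfolding e1[symmetric] by (simp add: ennreal_le_iff)
qed

lemma cov_sym: "cov \<epsilon> x x' = cov \<epsilon> x' x"
proof -
  have "cov \<epsilon> x x' = (\<integral>z. heat \<epsilon> (x - fst z) * heat \<epsilon> (x' - snd z) * gr (fst z - snd z) \<partial>(lborel \<Otimes>\<^sub>M lborel))"
    by (simp add: cov_def cov_form_def gr_def)
  also have "\<dots> = (\<integral>z. heat \<epsilon> (x - snd z) * heat \<epsilon> (x' - fst z) * gr (snd z - fst z) \<partial>(lborel \<Otimes>\<^sub>M lborel))"
    by (subst lborel_pair.integral_product_swap[symmetric]) (auto simp: case_prod_beta')
  also have "\<dots> = (\<integral>z. heat \<epsilon> (x' - fst z) * heat \<epsilon> (x - snd z) * gr (fst z - snd z) \<partial>(lborel \<Otimes>\<^sub>M lborel))"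
  proof (rule Bochner_Integration.integral_cong[OF refl])
    fix z :: "'a \<times> 'a"
    have "gr (snd z - fst z) = gr (fst z - snd z)" using gr_minus[of "fst z - snd z"] by simp
    then show "heat \<epsilon> (x - snd z) * heat \<epsilon> (x' - fst z) * gr (snd z - fst z) = heat \<epsilon> (x' - fst z) * heat \<epsilon> (x - snd z) * gr (fst z - snd z)"
      by simp
  qed
  finally show ?thesis by (simp add: cov_def cov_form_def gr_def)
qed

text \<open>Rewritten as an iterated \<open>ennreal\<close> integral, whose measurability in the
  parameter is automatic.\<close>

lemma cov_measurable:
  assumes e: "\<epsilon> > 0" shows "(\<lambda>x. cov \<epsilon> x x') \<in> borel_measurable borel"
proof -
  have "cov \<epsilon> x x' = enn2real (\<integral>\<^sup>+y'. ennreal (heat \<epsilon> (x' - y')) * (\<integral>\<^sup>+y. ennreal (heat \<epsilon> (x - y)) * ennreal (gr (y - y')) \<partial>lborel) \<partial>lborel)" for x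
    unfolding cov_integrable(2)[OF e, symmetric] using cov_integrable(3)[OF e] by simp
  then show ?thesis by (simp only:) measurable
qed

text \<open>Tonelli puts the integral against \<open>k\<close> innermost; a translation there moves
  the shift from \<open>gr\<close> to the base point of \<open>k\<close>, where \<open>D\<close>
  applies. Both heat kernels have mass 1, so no \<epsilon> is left in the bound.\<close>

lemma kernel_cov_le:
  fixes k :: "'a \<Rightarrow> real"
  assumes e: "\<epsilon> > 0" and [measurable]: "k \<in> borel_measurable borel"
    and D: "\<And>x. (\<integral>\<^sup>+y. ennreal (k (x - y)) * ennreal (gr y) \<partial>lborel) \<le> ennreal D"
  shows "(\<integral>\<^sup>+y. ennreal (k (x - y)) * ennreal (cov \<epsilon> y x') \<partial>lborel) \<le> ennreal D"
proof -
  have c: "ennreal (cov \<epsilon> y x') = (\<integral>\<^sup>+y'. ennreal (heat \<epsilon> (x' - y')) * (\<integral>\<^sup>+u. ennreal (heat \<epsilon> u) * ennreal (gr (y - u - y')) \<partial>lborel) \<partial>lborel)" for y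
  proof -
    have "(\<integral>\<^sup>+u. ennreal (heat \<epsilon> (y - u)) * ennreal (gr (u - y')) \<partial>lborel) = (\<integral>\<^sup>+u. ennreal (heat \<epsilon> u) * ennreal (gr (y - u - y')) \<partial>lborel)" for y'
      using nn_integral_lborel_reflect[of "\<lambda>u. ennreal (heat \<epsilon> u) * ennreal (gr (y - u - y'))" y] by simp
    then show ?thesis unfolding cov_integrable(2)[OF e] by simp
  qed
  have "(\<integral>\<^sup>+y. ennreal (k (x - y)) * ennreal (cov \<epsilon> y x') \<partial>lborel)
     = (\<integral>\<^sup>+y. \<integral>\<^sup>+y'. ennreal (k (x - y)) * (ennreal (heat \<epsilon> (x' - y')) * (\<integral>\<^sup>+u. ennreal (heat \<epsilon> u) * ennreal (gr (y - u - y')) \<partial>lborel)) \<partial>lborel \<partial>lborel)"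
    unfolding c by (intro nn_integral_cong nn_integral_cmult[symmetric]) measurable
  also have "\<dots> = (\<integral>\<^sup>+y'. \<integral>\<^sup>+y. ennreal (k (x - y)) * (ennreal (heat \<epsilon> (x' - y')) * (\<integral>\<^sup>+u. ennreal (heat \<epsilon> u) * ennreal (gr (y - u - y')) \<partial>lborel)) \<partial>lborel \<partial>lborel)"
    by (rule lborel_pair.Fubini') measurable
  also have "\<dots> \<le> (\<integral>\<^sup>+y'. ennreal (heat \<epsilon> (x' - y')) * ennreal D \<partial>lborel)"
  proof (rule nn_integral_mono)
    fix y'
    have "(\<integral>\<^sup>+y. ennreal (k (x - y)) * (ennreal (heat \<epsilon> (x' - y')) * (\<integral>\<^sup>+u. ennreal (heat \<epsilon> u) * ennreal (gr (y - u - y')) \<partial>lborel)) \<partial>lborel)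
       = ennreal (heat \<epsilon> (x' - y')) * (\<integral>\<^sup>+y. ennreal (k (x - y)) * (\<integral>\<^sup>+u. ennreal (heat \<epsilon> u) * ennreal (gr (y - u - y')) \<partial>lborel) \<partial>lborel)"
      unfolding mult.left_commute[of "ennreal (k _)"] by (rule nn_integral_cmult) measurable
    also have "(\<integral>\<^sup>+y. ennreal (k (x - y)) * (\<integral>\<^sup>+u. ennreal (heat \<epsilon> u) * ennreal (gr (y - u - y')) \<partial>lborel) \<partial>lborel)
       = (\<integral>\<^sup>+y. \<integral>\<^sup>+u. ennreal (k (x - y)) * (ennreal (heat \<epsilon> u) * ennreal (gr (y - u - y'))) \<partial>lborel \<partial>lborel)"
      by (intro nn_integral_cong nn_integral_cmult[symmetric]) measurable
    also have "\<dots> = (\<integral>\<^sup>+u. \<integral>\<^sup>+y. ennreal (k (x - y)) * (ennreal (heat \<epsilon> u) * ennreal (gr (y - u - y'))) \<partial>lborel \<partial>lborel)"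
      by (rule lborel_pair.Fubini') measurable
    also have "\<dots> \<le> (\<integral>\<^sup>+u. ennreal (heat \<epsilon> (u::'a)) * ennreal D \<partial>lborel)"
    proof (rule nn_integral_mono)
      fix u :: 'a
      have "(\<integral>\<^sup>+y. ennreal (k (x - y)) * (ennreal (heat \<epsilon> u) * ennreal (gr (y - u - y'))) \<partial>lborel)
        = ennreal (heat \<epsilon> u) * (\<integral>\<^sup>+y. ennreal (k (x - y)) * ennreal (gr (y - u - y')) \<partial>lborel)"
        unfolding mult.left_commute[of "ennreal (k _)"] by (rule nn_integral_cmult) measurable
      also have "(\<integral>\<^sup>+y. ennreal (k (x - y)) * ennreal (gr (y - u - y')) \<partial>lborel) = (\<integral>\<^sup>+y. ennreal (k (x - u - y' - y)) * ennreal (gr y) \<partial>lborel)"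
        using nn_integral_lborel_shift[of "\<lambda>y. ennreal (k (x - u - y' - y)) * ennreal (gr y)" "- u - y'"]
        by (simp add: algebra_simps)
      also have "ennreal (heat \<epsilon> u) * \<dots> \<le> ennreal (heat \<epsilon> u) * ennreal D"
        by (intro mult_left_mono D) simp
      finally show "(\<integral>\<^sup>+y. ennreal (k (x - y)) * (ennreal (heat \<epsilon> u) * ennreal (gr (y - u - y'))) \<partial>lborel) \<le> ennreal (heat \<epsilon> u) * ennreal D" .
    qed
    also have "\<dots> = ennreal D" by (subst nn_integral_multc) (auto simp: heat_integral[OF e])
    finally show "(\<integral>\<^sup>+y. ennreal (k (x - y)) * (ennreal (heat \<epsilon> (x' - y')) * (\<integral>\<^sup>+u. ennreal (heat \<epsilon> u) * ennreal (gr (y - u - y')) \<partial>lborel)) \<partial>lborel) \<le> ennreal (heat \<epsilon> (x' - y')) * ennreal D"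
      by (simp add: mult_left_mono)
  qed
  also have "\<dots> = ennreal D" by (subst nn_integral_multc) (auto simp: heat_integral_shift[OF e])
  finally show ?thesis .
qed

text \<open>Dominated convergence with the integrable majorant from \<open>cov_integrable\<close>;
  applied to the truncated heat kernels and to their truncation errors.\<close>

lemma cov_form_tendsto:
  assumes e: "\<epsilon> > 0"
    and [measurable]: "\<And>k. a k \<in> borel_measurable borel" "\<And>k. b k \<in> borel_measurable borel"
      "a' \<in> borel_measurable borel" "b' \<in> borel_measurable borel"
    and lim: "\<And>y. (\<lambda>k. a k y) \<longlonglongrightarrow> a' y" "\<And>y. (\<lambda>k. b k y) \<longlonglongrightarrow> b' y"
    and le: "\<And>k y. \<bar>a k y\<bar> \<le> heat \<epsilon> (x - y)" "\<And>k y. \<bar>b k y\<bar> \<le> heat \<epsilon> (x' - y)"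
  shows "(\<lambda>k. cov_form \<gamma> (a k) (b k)) \<longlonglongrightarrow> cov_form \<gamma> a' b'"
  unfolding cov_form_def gr_def[symmetric]
proof (rule integral_dominated_convergence[OF _ _ cov_integrable(1)[OF e, of x x']])
  show "AE z in lborel \<Otimes>\<^sub>M lborel. norm (a k (fst z) * b k (snd z) * gr (fst z - snd z))
       \<le> heat \<epsilon> (x - fst z) * heat \<epsilon> (x' - snd z) * gr (fst z - snd z)" for k
    using le by (intro AE_I2) (simp add: abs_mult mult_mono mult_right_mono)
  show "AE z in lborel \<Otimes>\<^sub>M lborel. (\<lambda>k. a k (fst z) * b k (snd z) * gr (fst z - snd z))
       \<longlonglongrightarrow> a' (fst z) * b' (snd z) * gr (fst z - snd z)"
    by (intro AE_I2 tendsto_mult lim tendsto_const)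
qed measurable

text \<open>Truncated heat kernels are test functions, and their errors are dominated by the heat
  kernel itself. The errors thus tend to 0 in the norm of H, \<open>extends_at\<close> gives L^2
  convergence, and both sides of the characteristic function identity pass to the limit.\<close>

theorem Wdot_gaussian:
  fixes W :: "('a \<Rightarrow> real) \<Rightarrow> 'w \<Rightarrow> real" and x :: "'i \<Rightarrow> 'a"
  assumes M: "prob_space M" and noise: "gaussian_noise M \<gamma> W" and e: "\<epsilon> > 0"
    and ext: "\<And>x. extends_at M \<gamma> W (\<lambda>y. heat \<epsilon> (x - y))"
  shows "gaussian_family M (\<lambda>i. Wdot W \<epsilon> (x i)) (\<lambda>i j. cov \<epsilon> (x i) (x j))"
proof -
  interpret prob_space M by fact
  define f where "f k x y = heat \<epsilon> (x - y) * bump (real (Suc k)) (x - y)" for k and x y :: 'a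
  have fC: "f k x \<in> Cc_inf" for k x
    unfolding f_def[abs_def] by (rule heat_bump_Cc_inf) simp
  have fm [measurable]: "f k x \<in> borel_measurable borel" for k x unfolding f_def[abs_def] by measurable
  have flim: "(\<lambda>k. f k x y) \<longlonglongrightarrow> heat \<epsilon> (x - y)" for x y
    unfolding f_def using tendsto_mult_left[OF bump_tendsto_1[of "x - y"], of "heat \<epsilon> (x - y)"] by simp
  have f0: "f k x y \<ge> 0" for k x y by (simp add: f_def)
  have f1: "f k x y \<le> heat \<epsilon> (x - y)" for k x y
    unfolding f_def using mult_left_mono[OF bump_le_1[of "real (Suc k)" "x - y"], of "heat \<epsilon> (x - y)"] by simp
  have L2: "(\<lambda>k. \<integral>\<^sup>+\<omega>. ennreal ((W (f k x) \<omega> - Wdot W \<epsilon> x \<omega>)\<^sup>2) \<partial>M) \<longlonglongrightarrow> 0" for x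
  proof -
    have "(\<lambda>k. cov_form \<gamma> (\<lambda>y. f k x y - heat \<epsilon> (x - y)) (\<lambda>y. f k x y - heat \<epsilon> (x - y))) \<longlonglongrightarrow> cov_form \<gamma> (\<lambda>y. 0) (\<lambda>y. 0)"
    proof (rule cov_form_tendsto[OF e])
      show "(\<lambda>k. f k x y - heat \<epsilon> (x - y)) \<longlonglongrightarrow> 0" "(\<lambda>k. f k x y - heat \<epsilon> (x - y)) \<longlonglongrightarrow> 0" for y
        using tendsto_diff[OF flim[of x y] tendsto_const[of "heat \<epsilon> (x - y)"]] by simp_all
      show "\<bar>f k x y - heat \<epsilon> (x - y)\<bar> \<le> heat \<epsilon> (x - y)" "\<bar>f k x y - heat \<epsilon> (x - y)\<bar> \<le> heat \<epsilon> (x - y)" for k y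
        using f0[of k x y] f1[of k x y] by simp_all
    qed measurable
    then have "(\<lambda>k. cov_form \<gamma> (\<lambda>y. f k x y - heat \<epsilon> (x - y)) (\<lambda>y. f k x y - heat \<epsilon> (x - y))) \<longlonglongrightarrow> 0"
      by (simp add: cov_form_def)
    then show ?thesis
      unfolding Wdot_def
      using ext[of x, unfolded extends_at_def, THEN conjunct2, THEN spec[where x = "\<lambda>k. f k x"]] fC by simp
  qed
  have Wm: "Wdot W \<epsilon> x \<in> borel_measurable M" for x
    using ext[of x] by (simp add: extends_at_def Wdot_def)
  have Wfm: "W (f k x) \<in> borel_measurable M" for k x
    using noise fC[of k x] by (auto simp: gaussian_noise_def)
  have nat_char: "(CLINT \<omega>|M. cis (\<Sum>i\<in>I. c i * Wdot W \<epsilon> (x i) \<omega>)) =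
      of_real (exp (- (\<Sum>i\<in>I. \<Sum>j\<in>I. c i * c j * cov \<epsilon> (x i) (x j)) / 2))"
    if I: "finite I" for I :: "nat set" and c and x :: "nat \<Rightarrow> 'a"
  proof (rule LIMSEQ_unique)
    show "(\<lambda>k. CLINT \<omega>|M. cis (\<Sum>i\<in>I. c i * W (f k (x i)) \<omega>)) \<longlonglongrightarrow> (CLINT \<omega>|M. cis (\<Sum>i\<in>I. c i * Wdot W \<epsilon> (x i) \<omega>))"
      by (rule tendsto_expectation_cis[OF M I Wfm Wm L2])
    have "(CLINT \<omega>|M. cis (\<Sum>i\<in>I. c i * W (f k (x i)) \<omega>)) =
      of_real (exp (- (\<Sum>i\<in>I. \<Sum>j\<in>I. c i * c j * cov_form \<gamma> (f k (x i)) (f k (x j))) / 2))" for k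
      using noise[unfolded gaussian_noise_def, THEN conjunct2, THEN spec[where x = I],
          THEN spec[where x = "\<lambda>i. f k (x i)"], THEN spec[where x = c]] I fC by simp
    moreover have "(\<lambda>k. complex_of_real (exp (- (\<Sum>i\<in>I. \<Sum>j\<in>I. c i * c j * cov_form \<gamma> (f k (x i)) (f k (x j))) / 2)))
      \<longlonglongrightarrow> of_real (exp (- (\<Sum>i\<in>I. \<Sum>j\<in>I. c i * c j * cov \<epsilon> (x i) (x j)) / 2))"
    proof (intro tendsto_of_real tendsto_exp tendsto_divide tendsto_minus tendsto_sum tendsto_mult_left tendsto_const)
      show "(\<lambda>k. cov_form \<gamma> (f k (x i)) (f k (x j))) \<longlonglongrightarrow> cov \<epsilon> (x i) (x j)" for i j
        unfolding cov_def
      proof (rule cov_form_tendsto[OF e])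
        show "\<bar>f k (x i) y\<bar> \<le> heat \<epsilon> (x i - y)" "\<bar>f k (x j) y\<bar> \<le> heat \<epsilon> (x j - y)" for k y
          using f0 f1 by simp_all
        show "(\<lambda>k. f k (x i) y) \<longlonglongrightarrow> heat \<epsilon> (x i - y)" "(\<lambda>k. f k (x j) y) \<longlonglongrightarrow> heat \<epsilon> (x j - y)" for y
          by (rule flim)+
      qed measurable
    qed simp
    ultimately show "(\<lambda>k. CLINT \<omega>|M. cis (\<Sum>i\<in>I. c i * W (f k (x i)) \<omega>))
      \<longlonglongrightarrow> of_real (exp (- (\<Sum>i\<in>I. \<Sum>j\<in>I. c i * c j * cov \<epsilon> (x i) (x j)) / 2))"
      by simp
  qed
  show ?thesis
  proof
    show "Wdot W \<epsilon> (x i) \<in> borel_measurable M" for i by (rule Wm)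
    show "cov \<epsilon> (x i) (x j) = cov \<epsilon> (x j) (x i)" for i j by (rule cov_sym)
    show "cov \<epsilon> (x i) (x i) \<ge> 0" for i by (rule cov_integrable(3)[OF e])
    fix I :: "'i set" and c :: "'i \<Rightarrow> real" assume I: "finite I"
    \<comment> \<open>\<open>gaussian_noise\<close> indexes by sets of naturals, so a general finite
      index set is enumerated first.\<close>
    obtain h where h: "bij_betw h {0..<card I} I" using ex_bij_betw_nat_finite[OF I] by blast
    have s: "(\<Sum>i\<in>I. F i) = (\<Sum>n\<in>{0..<card I}. F (h n))" for F :: "'i \<Rightarrow> real"
      by (rule sum.reindex_bij_betw[OF h, symmetric])
    show "(CLINT \<omega>|M. cis (\<Sum>i\<in>I. c i * Wdot W \<epsilon> (x i) \<omega>)) =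
      of_real (exp (- (\<Sum>i\<in>I. \<Sum>j\<in>I. c i * c j * cov \<epsilon> (x i) (x j)) / 2))"
      unfolding s using nat_char[of "{0..<card I}" "\<lambda>n. c (h n)" "\<lambda>n. x (h n)"] by simp
  qed
qed

end

section \<open>Moments of the chaos terms and uniform convergence\<close>

text \<open>The multinomial coefficient (q n)! / (n!)^q is at most q^(q n). The induction adds
  \<open>q\<close> factors at a time, each at most q (n + 1).\<close>

lemma fact_mult_le: "fact (q * n) \<le> real q ^ (q * n) * fact n ^ q"
proof (induction n)
  case (Suc n)
  have step: "fact (m + j) \<le> (fact m * real (m + j) ^ j :: real)" for m j
  proof (induction j)
    case (Suc j)
    have "(fact (m + Suc j) :: real) = real (m + Suc j) * fact (m + j)" by simp
    also have "\<dots> \<le> real (m + Suc j) * (fact m * real (m + j) ^ j)"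
      by (intro mult_left_mono Suc.IH) simp
    also have "\<dots> \<le> real (m + Suc j) * (fact m * real (m + Suc j) ^ j)"
      by (intro mult_left_mono power_mono) auto
    finally show ?case by (simp add: mult_ac)
  qed simp
  have "(fact (q * Suc n) :: real) = fact (q * n + q)" by (simp add: algebra_simps)
  also have "\<dots> \<le> fact (q * n) * real (q * n + q) ^ q" by (rule step)
  also have "\<dots> \<le> (real q ^ (q * n) * fact n ^ q) * real (q * n + q) ^ q"
    by (intro mult_right_mono Suc.IH) simp
  also have "real (q * n + q) = real q * real (Suc n)" by (simp add: algebra_simps)
  also have "(real q ^ (q * n) * fact n ^ q) * (real q * real (Suc n)) ^ q = real q ^ (q * Suc n) * fact (Suc n) ^ q"
  proof -
    have "real q ^ (q * Suc n) = real q ^ (q * n) * real q ^ q"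
      by (simp add: power_add[symmetric] add.commute)
    moreover have "(fact (Suc n) :: real) = fact n * real (Suc n)" by simp
    ultimately show ?thesis by (simp only: power_mult_distrib mult_ac)
  qed
  finally show ?case .
qed simp

text \<open>With \<open>c\<close> the largest of the numbers 2^k b_k, each b_k is at most c 2^(-k),
  and these weights over k \<ge> 1 sum to at most 1. The price of avoiding Minkowski is a factor
  2^(k q), harmless against the factorials.\<close>

lemma sum_power_le_weighted:
  fixes b :: "nat \<Rightarrow> real"
  assumes b: "\<And>k. k \<in> A \<Longrightarrow> b k \<ge> 0" and A: "finite A" "A \<subseteq> {1..}" and q: "q > 0"
  shows "(\<Sum>k\<in>A. b k) ^ q \<le> (\<Sum>k\<in>A. (2 ^ k * b k) ^ q)"
proof (cases "A = {}")
  case False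
  define c where "c = Max ((\<lambda>k. 2 ^ k * b k) ` A)"
  have "c \<in> (\<lambda>k. 2 ^ k * b k) ` A" unfolding c_def using False A by (intro Max_in) auto
  then obtain j where j: "j \<in> A" "c = 2 ^ j * b j" by auto
  have c0: "c \<ge> 0" using j b by simp
  have bc: "b k \<le> c * (1 / 2) ^ k" if "k \<in> A" for k
  proof -
    have "2 ^ k * b k \<le> c" unfolding c_def using A that by (intro Max_ge) auto
    then show ?thesis by (simp add: power_divide field_simps)
  qed
  have "(\<Sum>k\<in>A. b k) \<le> (\<Sum>k\<in>A. c * (1 / 2) ^ k)" by (intro sum_mono bc)
  also have "\<dots> = c * (\<Sum>k\<in>A. (1 / 2) ^ k)" by (simp add: sum_distrib_left)
  also have "\<dots> \<le> c * 1"
  proof (intro mult_left_mono c0)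
    obtain N where N: "A \<subseteq> {..N}" using A(1) by (meson finite_nat_iff_bounded_le)
    have "(\<Sum>k\<in>A. (1 / 2 :: real) ^ k) \<le> (\<Sum>k\<in>{1..N}. (1 / 2) ^ k)"
      using N A by (intro sum_mono2) auto
    also have "\<dots> \<le> 1"
    proof -
      have "(\<Sum>k\<in>{1..N}. (1 / 2 :: real) ^ k) = 1 - (1 / 2) ^ N" by (induction N) auto
      then show ?thesis by simp
    qed
    finally show "(\<Sum>k\<in>A. (1 / 2 :: real) ^ k) \<le> 1" .
  qed
  finally have "(\<Sum>k\<in>A. b k) \<le> c" by simp
  then have "(\<Sum>k\<in>A. b k) ^ q \<le> c ^ q" using b by (intro power_mono sum_nonneg)
  also have "\<dots> \<le> (\<Sum>k\<in>A. (2 ^ k * b k) ^ q)"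
    unfolding j(2) using j(1) A b by (intro member_le_sum[of j A "\<lambda>k. (2 ^ k * b k) ^ q"]) auto
  finally show ?thesis .
qed (use q in \<open>simp add: zero_power\<close>)

text \<open>Differences of consecutive times never exceed \<open>T\<close>, so the cut-off does not change \<open>Hn\<close>; it makes the
  kernel bounds uniform in the time argument.\<close>

definition cut_kernel :: "real \<Rightarrow> real \<Rightarrow> 'a::euclidean_space \<Rightarrow> real" where
  "cut_kernel T r x = (if r \<le> T then G r x else 0)"

lemma cut_kernel_measurable: "(\<lambda>(r, x). cut_kernel T r (x::'a::euclidean_space)) \<in> borel_measurable (borel \<Otimes>\<^sub>M borel)"
  unfolding cut_kernel_def by measurable

text \<open>The integrands agree pointwise. For increasing positive times the cut-off is inactive;
  otherwise a kernel with nonpositive gap, or the simplex weight at the first time,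
  vanishes.\<close>

lemma (in gaussian_chain_at) Hn_eq_chain_integral:
  assumes K: "K = cut_kernel T" and V: "V = (\<lambda>y. Wdot W \<epsilon> y)" and n: "n \<ge> 1" and t: "t \<le> T"
  shows "Hn W n \<epsilon> t x \<omega> = chain_integral \<omega>"
  unfolding Hn_def chain_integral_def
proof (rule Bochner_Integration.integral_cong[OF refl])
  fix z :: "nat \<Rightarrow> real \<times> 'a"
  define tt where "tt i = fst (node z i)" for i
  define xx where "xx i = snd (node z i)" for i
  have tt: "(\<lambda>i. if i = Suc n then t else fst (z i)) = tt" and xx: "(\<lambda>i. if i = Suc n then x else snd (z i)) = xx"
    by (auto simp: tt_def xx_def node_def)
  have V': "(\<Prod>i\<in>{1..n}. Wdot W \<epsilon> (xx i) \<omega>) = (\<Prod>i\<in>{1..n}. V (snd (z i)) \<omega>)"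
    unfolding V xx_def node_def by (intro prod.cong) auto
  have ch: "chain 0 z = (if 0 < tt 1 then 1 else 0) * (\<Prod>i\<in>{1..n}. cut_kernel T (tt (Suc i) - tt i) (xx (Suc i) - xx i))"
    unfolding chain_def unfolding K by (simp add: simplex_weight_def tt_def xx_def)
  have *: "(if (n = 0 \<or> 0 < tt 1) \<and> (\<forall>i\<in>{1..n}. tt i < tt (Suc i)) then 1 else 0) * (\<Prod>i\<in>{1..n}. G (tt (Suc i) - tt i) (xx (Suc i) - xx i))
      = chain 0 z"
  proof (cases "0 < tt 1 \<and> (\<forall>i\<in>{1..n}. tt i < tt (Suc i))")
    case True
    \<comment> \<open>\<open>up\<close> and \<open>down\<close> confine all times to the interval
      from 0 to \<open>t\<close>, so every gap is at most \<open>T\<close>.\<close>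
    have up: "tt 1 \<le> tt (Suc i)" if "i \<le> n" for i using that
    proof (induction i)
      case (Suc i)
      then have "tt (Suc i) < tt (Suc (Suc i))" using True by simp
      then show ?case using Suc by simp
    qed simp
    have down: "tt (Suc (n - i)) \<le> t" if "i \<le> n" for i using that
    proof (induction i)
      case 0 then show ?case by (simp add: tt_def node_def)
    next
      case (Suc i)
      then have "n - i \<in> {1..n}" "Suc (n - Suc i) = n - i" by auto
      then have "tt (Suc (n - Suc i)) < tt (Suc (n - i))" using True by metis
      then show ?case using Suc by simp
    qed
    have "tt (Suc i) - tt i \<le> T" if i: "i \<in> {1..n}" for i
    proof -
      have "tt (Suc i) \<le> t" using down[of "n - i"] i by simp
      moreover have "i - 1 \<le> n" "Suc (i - 1) = i" using i by auto
      then have "tt i > 0" using up[of "i - 1"] True by simp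
      ultimately show ?thesis using t by simp
    qed
    then have "(\<Prod>i\<in>{1..n}. cut_kernel T (tt (Suc i) - tt i) (xx (Suc i) - xx i)) = (\<Prod>i\<in>{1..n}. G (tt (Suc i) - tt i) (xx (Suc i) - xx i))"
      by (intro prod.cong) (auto simp: cut_kernel_def)
    then show ?thesis using True n unfolding ch by simp
  next
    case False
    have "chain 0 z = 0"
    proof (cases "0 < tt 1")
      case True
      then obtain i where i: "i \<in> {1..n}" "tt (Suc i) - tt i \<le> 0" using False by (auto simp: not_less)
      have "cut_kernel T (tt (Suc i) - tt i) (xx (Suc i) - xx i) = 0" using i(2) by (simp add: cut_kernel_def G_nonpos)
      then have "(\<Prod>i\<in>{1..n}. cut_kernel T (tt (Suc i) - tt i) (xx (Suc i) - xx i)) = 0" using i(1) by (intro prod_zero) auto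
      then show ?thesis unfolding ch by simp
    qed (simp add: ch)
    moreover have "\<not> ((n = 0 \<or> 0 < tt 1) \<and> (\<forall>i\<in>{1..n}. tt i < tt (Suc i)))" using False n by auto
    ultimately show ?thesis by (simp only: if_False mult_zero_left)
  qed
  show "(let tt = (\<lambda>i. if i = Suc n then t else fst (z i)); xx = (\<lambda>i. if i = Suc n then x else snd (z i))
            in (if (n = 0 \<or> 0 < tt 1) \<and> (\<forall>i\<in>{1..n}. tt i < tt (Suc i)) then 1 else 0) *
               (\<Prod>i\<in>{1..n}. G (tt (Suc i) - tt i) (xx (Suc i) - xx i)) *
               (\<Prod>i\<in>{1..n}. Wdot W \<epsilon> (xx i) \<omega>)) = chain 0 z * (\<Prod>i\<in>{1..n}. V (snd (z i)) \<omega>)"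
    unfolding Let_def tt xx * V' ..
qed

text \<open>The order of the choices gives the uniformity: \<open>D\<close> comes from
  \<open>G_bound\<close> before \<open>n\<close>, \<epsilon>, \<open>t\<close> and \<open>x\<close>
  are fixed, while the variance bound \<open>B\<close> is chosen after \<epsilon>.\<close>

lemma (in spectral_kernel) Hn_moment:
  fixes M :: "'w measure" and W :: "('a \<Rightarrow> real) \<Rightarrow> 'w \<Rightarrow> real"
  assumes M: "prob_space M" and noise: "gaussian_noise M \<gamma> W"
    and ext: "\<And>\<epsilon> x. \<epsilon> > 0 \<Longrightarrow> extends_at M \<gamma> W (\<lambda>y. heat \<epsilon> (x - y))"
    and meas: "\<And>\<epsilon>. \<epsilon> > 0 \<Longrightarrow> (\<lambda>(x, \<omega>). Wdot W \<epsilon> x \<omega>) \<in> borel_measurable (lborel \<Otimes>\<^sub>M M)"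
    and T: "T > 0"
  obtains D where "D \<ge> 1"
    "\<And>n \<epsilon> t x. n \<ge> 1 \<Longrightarrow> \<epsilon> > 0 \<Longrightarrow> t \<in> {0..T} \<Longrightarrow> Hn W n \<epsilon> t x \<in> borel_measurable M"
    "\<And>n \<epsilon> t x q. n \<ge> 1 \<Longrightarrow> \<epsilon> > 0 \<Longrightarrow> t \<in> {0..T} \<Longrightarrow> even q \<Longrightarrow> q > 0 \<Longrightarrow>
      (\<integral>\<^sup>+\<omega>. ennreal (Hn W n \<epsilon> t x \<omega> ^ q) \<partial>M) \<le> ennreal ((D ^ n * (T ^ n / fact n)) ^ q * sqrt (fact (q * n)))"
proof -
  obtain D where D: "D \<ge> 1" "\<And>t x. t \<le> T \<Longrightarrow> (\<integral>\<^sup>+y. ennreal (G t (x - y)) * ennreal (gr y) \<partial>lborel) \<le> ennreal D"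
    "\<And>t x. t \<le> T \<Longrightarrow> (\<integral>\<^sup>+y. ennreal (G t (x - y :: 'a)) \<partial>lborel) \<le> ennreal D"
    using G_bound[OF T] by metis
  have main: "Hn W n \<epsilon> t x \<in> borel_measurable M \<and> (even q \<longrightarrow> q > 0 \<longrightarrow>
      (\<integral>\<^sup>+\<omega>. ennreal (Hn W n \<epsilon> t x \<omega> ^ q) \<partial>M) \<le> ennreal ((D ^ n * (T ^ n / fact n)) ^ q * sqrt (fact (q * n))))"
    if n: "n \<ge> 1" and e: "\<epsilon> > 0" and t: "t \<in> {0..T}" for n \<epsilon> t x and q :: nat
  proof -
    obtain B where B: "B \<ge> 0" "\<And>a. (\<integral>\<^sup>+y. ennreal (heat \<epsilon> (a - y)) * ennreal (gr y) \<partial>lborel) \<le> ennreal B"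
      using heat_bound[OF e] by metis
    have cutD: "(\<integral>\<^sup>+y. ennreal (cut_kernel T r (x - y)) * ennreal (gr y) \<partial>lborel) \<le> ennreal D" for r and x :: 'a
      using D(2) by (cases "r \<le> T") (auto simp: cut_kernel_def)
    have cutm: "cut_kernel T r \<in> borel_measurable (borel :: 'a measure)" for r
      unfolding cut_kernel_def[abs_def] by measurable
    have "gaussian_chain M (\<lambda>y. Wdot W \<epsilon> y) (cov \<epsilon>) (cut_kernel T) B D"
    proof (intro gaussian_chain.intro gaussian_chain_axioms.intro M)
      show "(\<lambda>(x, \<omega>). Wdot W \<epsilon> x \<omega>) \<in> borel_measurable (lborel \<Otimes>\<^sub>M M)" by (rule meas[OF e])
      show "cov \<epsilon> x y \<ge> 0" for x y by (rule cov_integrable(3)[OF e])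
      show "(\<lambda>x. cov \<epsilon> x y) \<in> borel_measurable borel" for y by (rule cov_measurable[OF e])
      show "gaussian_family M (\<lambda>i. Wdot W \<epsilon> (x i)) (\<lambda>i j. cov \<epsilon> (x i) (x j))" for x :: "nat \<times> nat \<Rightarrow> 'a"
        by (rule Wdot_gaussian[OF M noise e ext[OF e]])
      show "cov \<epsilon> x x \<le> B" for x by (rule cov_integrable(4)[OF e B(2,1)])
      show "cut_kernel T r x \<ge> 0" for r and x :: 'a by (simp add: cut_kernel_def)
      show "(\<lambda>(r, x::'a). cut_kernel T r x) \<in> borel_measurable (borel \<Otimes>\<^sub>M borel)" by (rule cut_kernel_measurable)
      show "cut_kernel T r x = 0" if "r \<le> 0" for r and x :: 'a using that by (simp add: cut_kernel_def G_nonpos)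
      show "D \<ge> 1" by (rule D(1))
      show "(\<integral>\<^sup>+y. ennreal (cut_kernel T r (x - y)) \<partial>lborel) \<le> ennreal D" for r and x :: 'a
        using D(3) by (cases "r \<le> T") (auto simp: cut_kernel_def)
      show "(\<integral>\<^sup>+y. ennreal (cut_kernel T r (x - y)) * ennreal (cov \<epsilon> y x') \<partial>lborel) \<le> ennreal D" for r x x'
        by (rule kernel_cov_le[OF e cutm cutD])
    qed
    then interpret gaussian_chain_at M "\<lambda>y. Wdot W \<epsilon> y" "cov \<epsilon>" "cut_kernel T" B D n t x
      by (rule gaussian_chain_at.intro)
    have H: "Hn W n \<epsilon> t x = chain_integral"
      using Hn_eq_chain_integral[OF refl refl n] t by auto
    have vol: "simplex_vol \<le> T ^ n / fact n" "simplex_vol \<ge> 0"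
      using t T power_mono[of t T n] by (auto simp: simplex_vol_def simplex_weight_def divide_right_mono)
    have "ennreal ((D ^ n * simplex_vol) ^ q * sqrt (fact (q * n))) \<le> ennreal ((D ^ n * (T ^ n / fact n)) ^ q * sqrt (fact (q * n)))"
      using vol D(1) by (intro ennreal_leI mult_right_mono power_mono mult_left_mono) auto
    then show ?thesis
      unfolding H using chain_integral_measurable chain_integral_moment[of q] order_trans by blast
  qed
  show ?thesis
    by (rule that[OF D(1)]) (use main in blast)+
qed

section \<open>Summation of the moment bounds\<close>

text \<open>The root of (q n)! costs (n!)^m against (n!)^(-q) from the simplices; with
  \<open>q = 2 * m\<close> the net (n!)^(-m) is at most 1 / n!. The leading power of 2 is the price
  of \<open>sum_power_le_weighted\<close>, and the right side is the term of an exponential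
  series.\<close>

lemma moment_bound_le_geometric:
  fixes D T :: real
  assumes D: "D \<ge> 1" and T: "T > 0" and m: "m \<ge> 1" and q: "q = 2 * m"
  shows "2 ^ (n * q) * ((D ^ n * (T ^ n / fact n)) ^ q * sqrt (fact (q * n)))
    \<le> ((2 * D * T) ^ q * real q ^ m) ^ n / fact n"
proof -
  have "sqrt (fact (q * n)) \<le> real q ^ (m * n) * fact n ^ m"
  proof (rule real_le_lsqrt)
    have "fact (q * n) \<le> real q ^ (q * n) * fact n ^ q" by (rule fact_mult_le)
    also have "\<dots> = (real q ^ (m * n) * fact n ^ m)\<^sup>2"
      by (simp add: q power_mult_distrib flip: power_mult) (simp add: mult_ac)
    finally show "fact (q * n) \<le> (real q ^ (m * n) * fact n ^ m)\<^sup>2" .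
  qed simp
  then have "2 ^ (n * q) * ((D ^ n * (T ^ n / fact n)) ^ q * sqrt (fact (q * n)))
    \<le> 2 ^ (n * q) * ((D ^ n * (T ^ n / fact n)) ^ q * (real q ^ (m * n) * fact n ^ m))"
    using D T by (intro mult_left_mono) auto
  also have "\<dots> = ((2 * D * T) ^ q * real q ^ m) ^ n * (fact n ^ m / fact n ^ q)"
    by (simp add: power_mult_distrib power_divide mult_ac flip: power_mult)
  also have "fact n ^ m / fact n ^ q = 1 / (fact n ^ m :: real)"
    by (simp add: q mult_2 power_add)
  also have "((2 * D * T) ^ q * real q ^ m) ^ n * (1 / fact n ^ m) \<le> ((2 * D * T) ^ q * real q ^ m) ^ n * (1 / fact n)"
  proof (intro mult_left_mono divide_left_mono)
    show "(fact n :: real) \<le> fact n ^ m" using m self_le_power[of "fact n :: real" m] by (simp add: fact_ge_1)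
  qed (use D T in auto)
  finally show ?thesis by simp
qed

text \<open>The bound is a series tail free of \<open>m\<close>, which later permits
  \<open>m\<close> to tend to infinity.\<close>

lemma vn_diff_moment:
  fixes M :: "'w measure"
  assumes Hm: "\<And>k. k \<ge> 1 \<Longrightarrow> Hn W k \<epsilon> t x \<in> borel_measurable M"
    and H: "\<And>k. k \<ge> 1 \<Longrightarrow> (\<integral>\<^sup>+\<omega>. ennreal (Hn W k \<epsilon> t x \<omega> ^ q) \<partial>M) \<le> ennreal (b k)"
    and s: "\<And>k. 2 ^ (k * q) * b k \<le> s k" "summable s" "\<And>k. s k \<ge> 0" "\<And>k. b k \<ge> 0"
    and q: "even q" "q > 0" and nm: "n \<le> m"
  shows "(\<integral>\<^sup>+\<omega>. ennreal ((vn W n \<epsilon> t x \<omega> - vn W m \<epsilon> t x \<omega>) ^ q) \<partial>M) \<le> ennreal (suminf s - (\<Sum>k\<le>n. s k))"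
proof -
  let ?A = "{Suc n..m}"
  have "(\<integral>\<^sup>+\<omega>. ennreal ((vn W n \<epsilon> t x \<omega> - vn W m \<epsilon> t x \<omega>) ^ q) \<partial>M)
    \<le> (\<integral>\<^sup>+\<omega>. (\<Sum>k\<in>?A. ennreal (2 ^ (k * q)) * ennreal (Hn W k \<epsilon> t x \<omega> ^ q)) \<partial>M)"
  proof (rule nn_integral_mono)
    fix \<omega>
    have "{1..m} = {1..n} \<union> ?A" using nm by auto
    then have "vn W m \<epsilon> t x \<omega> - vn W n \<epsilon> t x \<omega> = (\<Sum>k\<in>?A. Hn W k \<epsilon> t x \<omega>)"
      unfolding vn_def by (simp add: sum.union_disjoint)
    then have "\<bar>vn W n \<epsilon> t x \<omega> - vn W m \<epsilon> t x \<omega>\<bar> \<le> (\<Sum>k\<in>?A. \<bar>Hn W k \<epsilon> t x \<omega>\<bar>)"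
      using sum_abs[of "\<lambda>k. Hn W k \<epsilon> t x \<omega>" ?A] by (simp add: abs_minus_commute)
    then have "\<bar>vn W n \<epsilon> t x \<omega> - vn W m \<epsilon> t x \<omega>\<bar> ^ q \<le> (\<Sum>k\<in>?A. \<bar>Hn W k \<epsilon> t x \<omega>\<bar>) ^ q"
      by (intro power_mono) auto
    also have "\<dots> \<le> (\<Sum>k\<in>?A. (2 ^ k * \<bar>Hn W k \<epsilon> t x \<omega>\<bar>) ^ q)"
      using q by (intro sum_power_le_weighted) auto
    finally have "(vn W n \<epsilon> t x \<omega> - vn W m \<epsilon> t x \<omega>) ^ q \<le> (\<Sum>k\<in>?A. 2 ^ (k * q) * Hn W k \<epsilon> t x \<omega> ^ q)"
      using q(1) by (simp add: power_even_abs power_mult_distrib power_mult)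
    then show "ennreal ((vn W n \<epsilon> t x \<omega> - vn W m \<epsilon> t x \<omega>) ^ q) \<le> (\<Sum>k\<in>?A. ennreal (2 ^ (k * q)) * ennreal (Hn W k \<epsilon> t x \<omega> ^ q))"
      using q(1) by (simp add: ennreal_leI sum_ennreal zero_le_even_power flip: ennreal_mult)
  qed
  also have "\<dots> = (\<Sum>k\<in>?A. ennreal (2 ^ (k * q)) * (\<integral>\<^sup>+\<omega>. ennreal (Hn W k \<epsilon> t x \<omega> ^ q) \<partial>M))"
  proof -
    have "(\<lambda>\<omega>. ennreal (Hn W k \<epsilon> t x \<omega> ^ q)) \<in> borel_measurable M" if "k \<in> ?A" for k
      using Hm[of k] that by (intro measurable_compose[OF _ measurable_ennreal] borel_measurable_power) auto
    then have "(\<integral>\<^sup>+\<omega>. ennreal (2 ^ (k * q)) * ennreal (Hn W k \<epsilon> t x \<omega> ^ q) \<partial>M)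
        = ennreal (2 ^ (k * q)) * (\<integral>\<^sup>+\<omega>. ennreal (Hn W k \<epsilon> t x \<omega> ^ q) \<partial>M)"
      and "(\<lambda>\<omega>. ennreal (2 ^ (k * q)) * ennreal (Hn W k \<epsilon> t x \<omega> ^ q)) \<in> borel_measurable M" if "k \<in> ?A" for k
      using that by (auto intro!: nn_integral_cmult)
    then show ?thesis by (subst nn_integral_sum) (auto intro!: sum.cong)
  qed
  also have "\<dots> \<le> (\<Sum>k\<in>?A. ennreal (2 ^ (k * q)) * ennreal (b k))"
    by (intro sum_mono mult_left_mono H) auto
  also have "\<dots> = ennreal (\<Sum>k\<in>?A. 2 ^ (k * q) * b k)"
    using s(4) by (simp add: sum_ennreal flip: ennreal_mult)
  also have "\<dots> \<le> ennreal (suminf s - (\<Sum>k\<le>n. s k))"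
  proof (rule ennreal_leI)
    have "(\<Sum>k\<in>?A. 2 ^ (k * q) * b k) \<le> (\<Sum>k\<in>?A. s k)" by (intro sum_mono s(1))
    also have "\<dots> = (\<Sum>k\<le>m. s k) - (\<Sum>k\<le>n. s k)"
    proof -
      have "{..m} = {..n} \<union> ?A" using nm by auto
      then show ?thesis by (simp add: sum.union_disjoint)
    qed
    also have "\<dots> \<le> suminf s - (\<Sum>k\<le>n. s k)"
      using sum_le_suminf[OF s(2), of "{..m}"] s(3) by simp
    finally show "(\<Sum>k\<in>?A. 2 ^ (k * q) * b k) \<le> suminf s - (\<Sum>k\<le>n. s k)" .
  qed
  finally show ?thesis .
qed

lemma add_power_le:
  fixes a b :: real
  assumes "a \<ge> 0" "b \<ge> 0" shows "(a + b) ^ q \<le> 2 ^ q * (a ^ q + b ^ q)"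
proof -
  have "(a + b) ^ q \<le> (2 * max a b) ^ q" using assms by (intro power_mono) auto
  also have "\<dots> = 2 ^ q * max a b ^ q" by (simp add: power_mult_distrib)
  also have "max a b ^ q \<le> a ^ q + b ^ q" using assms by (cases "a \<le> b") (auto simp: max_def)
  finally show ?thesis by simp
qed

text \<open>Below \<eta> the first term suffices; above it the nonpositive exponent
  \<open>p - q\<close> turns |y| \<ge> \<eta> in the right direction. It replaces Jensen's
  inequality in passing from \<open>q\<close> to \<open>p\<close>.\<close>

lemma powr_le_interpolate:
  fixes y \<eta> p :: real
  assumes "\<eta> > 0" "p > 0" "p \<le> real q"
  shows "\<bar>y\<bar> powr p \<le> \<eta> powr p + \<eta> powr (p - real q) * \<bar>y\<bar> ^ q"
proof (cases "\<bar>y\<bar> \<le> \<eta>")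
  case True
  then have "\<bar>y\<bar> powr p \<le> \<eta> powr p" using assms by (intro powr_mono2) auto
  then show ?thesis by (simp add: add_increasing2)
next
  case False
  then have y: "\<bar>y\<bar> > 0" using assms by simp
  have "\<bar>y\<bar> powr p = \<bar>y\<bar> powr (p - real q) * \<bar>y\<bar> ^ q"
    using y by (simp flip: powr_realpow powr_add)
  also have "\<dots> \<le> \<eta> powr (p - real q) * \<bar>y\<bar> ^ q"
    using False assms by (intro mult_right_mono powr_mono2') auto
  finally show ?thesis by (simp add: add_increasing)
qed

text \<open>\<open>v\<close> is accessible only through \<open>vlim\<close>: \<open>vn\<close> is
  compared with a later partial sum, which is then sent to infinity, at an even exponent not below
  \<open>p\<close>. The rate involves neither \<epsilon> nor the point, and interpolation transfers
  it to \<open>p\<close>. \<open>meas\<close> fixes a jointly measurable version of the mollified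
  noise, on which the measurability of the pathwise integrals \<open>Hn\<close> rests.\<close>

theorem theorem3p4:
  fixes M :: "'w measure"
    and \<gamma> :: "'a::euclidean_space \<Rightarrow> ennreal"
    and \<mu> :: "'a measure"
    and W :: "('a \<Rightarrow> real) \<Rightarrow> 'w \<Rightarrow> real"
    and v :: "real \<Rightarrow> real \<Rightarrow> 'a \<Rightarrow> 'w \<Rightarrow> real"
    and p T :: real
  assumes dim: "DIM('a) \<in> {1, 2}"
    and nnd: "nonneg_definite \<gamma>"
    and temp: "tempered_measure \<mu>"
    and four: "is_fourier_of \<gamma> \<mu>"
    and A: "assumption_A \<gamma> \<mu>"
    and C: "condition_C \<mu>"
    and prob: "prob_space M"
    and noise: "gaussian_noise M \<gamma> W"
    and ext: "\<And>\<epsilon> x. \<epsilon> > 0 \<Longrightarrow> extends_at M \<gamma> W (\<lambda>y. heat \<epsilon> (x - y))"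
    and meas: "\<And>\<epsilon>. \<epsilon> > 0 \<Longrightarrow>
                 (\<lambda>(x, \<omega>). Wdot W \<epsilon> x \<omega>) \<in> borel_measurable (lborel \<Otimes>\<^sub>M M)"
    and vlim: "\<And>\<epsilon> t x q. \<epsilon> > 0 \<Longrightarrow> t \<ge> 0 \<Longrightarrow> q \<ge> 2 \<Longrightarrow>
                 v \<epsilon> t x \<in> borel_measurable M \<and>
                 (\<lambda>n. \<integral>\<^sup>+\<omega>. ennreal (\<bar>vn W n \<epsilon> t x \<omega> - v \<epsilon> t x \<omega>\<bar> powr q) \<partial>M) \<longlonglongrightarrow> 0"
    and p: "p \<ge> 2"
    and T: "T > 0"
  shows "(\<lambda>n. SUP \<epsilon>\<in>{0<..}. SUP tx\<in>{0..T} \<times> (UNIV :: 'a set).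
            \<integral>\<^sup>+\<omega>. ennreal (\<bar>vn W n \<epsilon> (fst tx) (snd tx) \<omega> - v \<epsilon> (fst tx) (snd tx) \<omega>\<bar> powr p) \<partial>M)
         \<longlonglongrightarrow> 0"
proof -
  interpret prob_space M by (rule prob)
  interpret spectral_kernel \<gamma> \<mu> by (unfold_locales) (fact dim four A C temp)+
  obtain D where D: "D \<ge> 1"
    and Hm: "\<And>n \<epsilon> t x. n \<ge> 1 \<Longrightarrow> \<epsilon> > 0 \<Longrightarrow> t \<in> {0..T} \<Longrightarrow> Hn W n \<epsilon> t x \<in> borel_measurable M"
    and H: "\<And>n \<epsilon> t x q. n \<ge> 1 \<Longrightarrow> \<epsilon> > 0 \<Longrightarrow> t \<in> {0..T} \<Longrightarrow> even q \<Longrightarrow> q > 0 \<Longrightarrow>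
      (\<integral>\<^sup>+\<omega>. ennreal (Hn W n \<epsilon> t x \<omega> ^ q) \<partial>M) \<le> ennreal ((D ^ n * (T ^ n / fact n)) ^ q * sqrt (fact (q * n)))"
    using Hn_moment[OF prob noise ext meas T] by metis
  \<comment> \<open>Rounding up and doubling gives an even integer \<open>q \<ge> p\<close>, whose
    half is the \<open>m\<close> of \<open>moment_bound_le_geometric\<close>.\<close>
  define m where "m = nat \<lceil>p\<rceil>"
  define q where "q = 2 * m"
  have m: "m \<ge> 1" using p unfolding m_def by linarith
  have q: "even q" "q > 0" "p \<le> real q" "real q \<ge> 2"
    using p m unfolding q_def m_def by (simp_all, linarith)
  define R where "R = (2 * D * T) ^ q * real q ^ m"
  have R: "R > 0" unfolding R_def using D T q by simp
  define s where "s k = R ^ k / fact k" for k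
  define b where "b k = (D ^ k * (T ^ k / fact k)) ^ q * sqrt (fact (q * k))" for k
  have s: "2 ^ (k * q) * b k \<le> s k" "s k \<ge> 0" "b k \<ge> 0" for k
    using moment_bound_le_geometric[OF D T m q_def, of k] R D T by (simp_all add: b_def s_def R_def)
  have sums: "summable s" unfolding s_def using summable_exp[of R] by (simp add: divide_inverse mult.commute)
  \<comment> \<open>The added \<open>1 / Suc n\<close> keeps \<rho> strictly positive, as negative
    powers of it occur below; \<open>2 ^ q\<close> stems from \<open>add_power_le\<close>.\<close>
  define \<rho> where "\<rho> n = 2 ^ q * (suminf s - (\<Sum>k\<le>n. s k)) + 1 / real (Suc n)" for n
  have tail0: "suminf s - (\<Sum>k\<le>n. s k) \<ge> 0" for n
    using sum_le_suminf[OF sums, of "{..n}"] s by simp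
  have \<rho>0: "\<rho> n > 0" for n unfolding \<rho>_def using tail0[of n] by (intro add_nonneg_pos) auto
  have \<rho>lim: "\<rho> \<longlonglongrightarrow> 0"
  proof -
    have "(\<lambda>n. suminf s - (\<Sum>k\<le>n. s k)) \<longlonglongrightarrow> suminf s - suminf s"
      using summable_LIMSEQ'[OF sums] by (intro tendsto_intros)
    from tendsto_add[OF tendsto_mult_left[OF this, of "2 ^ q"] LIMSEQ_inverse_real_of_nat]
    show ?thesis unfolding \<rho>_def by (simp add: inverse_eq_divide)
  qed
  have vm: "vn W n \<epsilon> t x \<in> borel_measurable M" if "\<epsilon> > 0" "t \<in> {0..T}" for n \<epsilon> t x
    unfolding vn_def[abs_def] using Hm that by (intro borel_measurable_add borel_measurable_sum borel_measurable_const) auto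
  have Lq: "(\<integral>\<^sup>+\<omega>. ennreal (\<bar>vn W n \<epsilon> t x \<omega> - v \<epsilon> t x \<omega>\<bar> ^ q) \<partial>M) \<le> ennreal (\<rho> n)"
    if e: "\<epsilon> > 0" and t: "t \<in> {0..T}" for n \<epsilon> t x
  proof -
    define a where "a l = (\<integral>\<^sup>+\<omega>. ennreal (\<bar>vn W l \<epsilon> t x \<omega> - v \<epsilon> t x \<omega>\<bar> ^ q) \<partial>M)" for l
    have pw: "\<bar>y\<bar> powr real q = \<bar>y\<bar> ^ q" for y :: real
      using q(2) by (simp add: powr_realpow')
    have a: "a \<longlonglongrightarrow> 0"
      using vlim[OF e _ q(4), of t x] t unfolding a_def pw by auto
    have v: "v \<epsilon> t x \<in> borel_measurable M" using vlim[OF e _ q(4), of t x] t by auto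
    have le: "a n \<le> ennreal (2 ^ q * (suminf s - (\<Sum>k\<le>n. s k))) + ennreal (2 ^ q) * a l" if l: "l \<ge> n" for l
    proof -
      have "a n \<le> (\<integral>\<^sup>+\<omega>. ennreal (2 ^ q) * ennreal ((vn W n \<epsilon> t x \<omega> - vn W l \<epsilon> t x \<omega>) ^ q)
          + ennreal (2 ^ q) * ennreal (\<bar>vn W l \<epsilon> t x \<omega> - v \<epsilon> t x \<omega>\<bar> ^ q) \<partial>M)"
        unfolding a_def
      proof (rule nn_integral_mono)
        fix \<omega>
        have "\<bar>vn W n \<epsilon> t x \<omega> - v \<epsilon> t x \<omega>\<bar> ^ q \<le> (\<bar>vn W n \<epsilon> t x \<omega> - vn W l \<epsilon> t x \<omega>\<bar> + \<bar>vn W l \<epsilon> t x \<omega> - v \<epsilon> t x \<omega>\<bar>) ^ q"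
          by (intro power_mono) auto
        also have "\<dots> \<le> 2 ^ q * (\<bar>vn W n \<epsilon> t x \<omega> - vn W l \<epsilon> t x \<omega>\<bar> ^ q + \<bar>vn W l \<epsilon> t x \<omega> - v \<epsilon> t x \<omega>\<bar> ^ q)"
          by (rule add_power_le) auto
        finally have "\<bar>vn W n \<epsilon> t x \<omega> - v \<epsilon> t x \<omega>\<bar> ^ q \<le> 2 ^ q * (vn W n \<epsilon> t x \<omega> - vn W l \<epsilon> t x \<omega>) ^ q
            + 2 ^ q * \<bar>vn W l \<epsilon> t x \<omega> - v \<epsilon> t x \<omega>\<bar> ^ q"
          using q(1) by (simp add: power_even_abs distrib_left)
        then show "ennreal (\<bar>vn W n \<epsilon> t x \<omega> - v \<epsilon> t x \<omega>\<bar> ^ q) \<le> ennreal (2 ^ q) * ennreal ((vn W n \<epsilon> t x \<omega> - vn W l \<epsilon> t x \<omega>) ^ q)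
          + ennreal (2 ^ q) * ennreal (\<bar>vn W l \<epsilon> t x \<omega> - v \<epsilon> t x \<omega>\<bar> ^ q)"
          using q(1) by (simp add: ennreal_leI zero_le_even_power flip: ennreal_mult ennreal_plus)
      qed
      also have "\<dots> = ennreal (2 ^ q) * (\<integral>\<^sup>+\<omega>. ennreal ((vn W n \<epsilon> t x \<omega> - vn W l \<epsilon> t x \<omega>) ^ q) \<partial>M) + ennreal (2 ^ q) * a l"
      proof -
        note [measurable] = vm[OF e t] v
        show ?thesis unfolding a_def by (simp add: nn_integral_add nn_integral_cmult)
      qed
      also have "\<dots> \<le> ennreal (2 ^ q) * ennreal (suminf s - (\<Sum>k\<le>n. s k)) + ennreal (2 ^ q) * a l"
      proof (intro add_right_mono mult_left_mono)
        show "(\<integral>\<^sup>+\<omega>. ennreal ((vn W n \<epsilon> t x \<omega> - vn W l \<epsilon> t x \<omega>) ^ q) \<partial>M) \<le> ennreal (suminf s - (\<Sum>k\<le>n. s k))"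
          by (rule vn_diff_moment[OF _ _ s(1) sums s(2,3) q(1,2) l])
            (use Hm[OF _ e t] H[OF _ e t q(1,2)] in \<open>auto simp: b_def\<close>)
      qed simp
      also have "ennreal (2 ^ q) * ennreal (suminf s - (\<Sum>k\<le>n. s k)) = ennreal (2 ^ q * (suminf s - (\<Sum>k\<le>n. s k)))"
        by (rule ennreal_mult'[symmetric]) simp
      finally show ?thesis .
    qed
    \<comment> \<open>The left side does not depend on \<open>l\<close>, so \<open>l\<close> may
      tend to infinity and the term \<open>a l\<close> disappears.\<close>
    have "a n \<le> ennreal (2 ^ q * (suminf s - (\<Sum>k\<le>n. s k)))"
    proof (rule LIMSEQ_le_const)
      have "(\<lambda>l. ennreal (2 ^ q) * a l) \<longlonglongrightarrow> ennreal (2 ^ q) * 0"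
        by (rule ennreal_tendsto_cmult[OF _ a]) simp
      from tendsto_add[OF tendsto_const this]
      show "(\<lambda>l. ennreal (2 ^ q * (suminf s - (\<Sum>k\<le>n. s k))) + ennreal (2 ^ q) * a l) \<longlonglongrightarrow> ennreal (2 ^ q * (suminf s - (\<Sum>k\<le>n. s k)))"
        by simp
    qed (use le in blast)
    also have "\<dots> \<le> ennreal (\<rho> n)" unfolding \<rho>_def by (intro ennreal_leI) simp
    finally show ?thesis by (simp add: a_def)
  qed
  have Lp: "(\<integral>\<^sup>+\<omega>. ennreal (\<bar>vn W n \<epsilon> t x \<omega> - v \<epsilon> t x \<omega>\<bar> powr p) \<partial>M) \<le> ennreal (2 * \<rho> n powr (p / real q))"
    if e: "\<epsilon> > 0" and t: "t \<in> {0..T}" for n \<epsilon> t x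
  proof -
    \<comment> \<open>This threshold balances the interpolation: both terms become
      \<open>\<rho> n powr (p / real q)\<close>.\<close>
    define \<eta> where "\<eta> = \<rho> n powr (1 / real q)"
    have \<eta>: "\<eta> > 0" unfolding \<eta>_def using \<rho>0[of n] by simp
    have v: "v \<epsilon> t x \<in> borel_measurable M" using vlim[OF e _ q(4), of t x] t by auto
    note [measurable] = vm[OF e t] v
    have "(\<integral>\<^sup>+\<omega>. ennreal (\<bar>vn W n \<epsilon> t x \<omega> - v \<epsilon> t x \<omega>\<bar> powr p) \<partial>M)
      \<le> (\<integral>\<^sup>+\<omega>. ennreal (\<eta> powr p) + ennreal (\<eta> powr (p - real q)) * ennreal (\<bar>vn W n \<epsilon> t x \<omega> - v \<epsilon> t x \<omega>\<bar> ^ q) \<partial>M)"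
      using powr_le_interpolate[OF \<eta> _ q(3)] p
      by (intro nn_integral_mono) (simp add: ennreal_leI flip: ennreal_mult ennreal_plus)
    also have "\<dots> = ennreal (\<eta> powr p) + ennreal (\<eta> powr (p - real q)) * (\<integral>\<^sup>+\<omega>. ennreal (\<bar>vn W n \<epsilon> t x \<omega> - v \<epsilon> t x \<omega>\<bar> ^ q) \<partial>M)"
      by (simp add: nn_integral_add nn_integral_cmult emeasure_space_1)
    also have "\<dots> \<le> ennreal (\<eta> powr p) + ennreal (\<eta> powr (p - real q)) * ennreal (\<rho> n)"
      by (intro add_left_mono mult_left_mono Lq e t) simp
    also have "\<dots> = ennreal (\<eta> powr p + \<eta> powr (p - real q) * \<rho> n)"
      using \<rho>0[of n] by (simp flip: ennreal_mult ennreal_plus)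
    also have "\<eta> powr p = \<rho> n powr (p / real q)" unfolding \<eta>_def by (simp add: powr_powr)
    also have "\<eta> powr (p - real q) * \<rho> n = \<rho> n powr (p / real q)"
    proof -
      have "\<eta> powr (p - real q) * \<rho> n = \<rho> n powr ((p - real q) / real q) * \<rho> n powr 1"
        using \<rho>0[of n] by (simp add: \<eta>_def powr_powr)
      also have "\<dots> = \<rho> n powr ((p - real q) / real q + 1)" by (simp only: powr_add)
      also have "(p - real q) / real q + 1 = p / real q" using q(2) by (simp add: field_simps)
      finally show ?thesis .
    qed
    finally show ?thesis by simp
  qed
  show ?thesis
  proof (rule tendsto_sandwich[OF _ _ tendsto_const])
    show "\<forall>\<^sub>F n in sequentially. (SUP \<epsilon>\<in>{0<..}. SUP tx\<in>{0..T} \<times> (UNIV :: 'a set).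
            \<integral>\<^sup>+\<omega>. ennreal (\<bar>vn W n \<epsilon> (fst tx) (snd tx) \<omega> - v \<epsilon> (fst tx) (snd tx) \<omega>\<bar> powr p) \<partial>M)
        \<le> ennreal (2 * \<rho> n powr (p / real q))"
      using Lp by (intro always_eventually allI SUP_least) auto
    have "(\<lambda>n. \<rho> n powr (p / real q)) \<longlonglongrightarrow> 0"
      using \<rho>0 p q(2) by (intro tendsto_zero_powrI[OF \<rho>lim tendsto_const]) (auto intro: always_eventually less_imp_le)
    from tendsto_ennrealI[OF tendsto_mult_left[OF this, of 2]]
    show "(\<lambda>n. ennreal (2 * \<rho> n powr (p / real q))) \<longlonglongrightarrow> 0" by simp
  qed simp
qed

end
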